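(* Let $n$ be a positive integer, and let $\mathsf D$ be the vector field on $\mathsf T=\mathsf T_n$ given either by Option 1 or by Option 2, $\mathsf H$ the radial vector field, $\mathfrak G$ the AMSY-Lie algebra (all as defined in the context), and $\delta_2^n$ the Kronecker delta. Then the Lie algebra generated by the vector fields $\mathsf D$, $\mathsf H$ and $(1+\delta_2^n)\frac{\partial}{\partial t_2}$ in the AMSY-Lie algebra $\mathfrak G\subset\mathfrak X(\mathsf T)$ is isomorphic to $\mathfrak{sl}_2(\mathbb C)$.
   Context: $\mathfrak X(\mathsf T)$ denotes the Lie algebra of vector fields on $\mathsf T$. **The moduli space $\mathsf T$.** Fix $n\ge 1$. Put $m=\frac{n+1}2$ if $n$ is odd, $m=\frac n2$ if $n$ is even; $d=\frac{(n+1)(n+3)}4+1$ if $n$ is odd, $d=\frac{n(n+2)}4+1$ if $n$ is even. $\mathsf T=\mathsf T_n$ is the moduli space of pairs $(X,[\alpha_1,\dots,\alpha_{n+1}])$, where $X$ is a mirror $n$-fold of the Dwork family (desingularized quotient of $t_{n+2}x_0^{n+2}+x_1^{n+2}+\dots+x_{n+1}^{n+2}-(n+2)t_1x_0\cdots x_{n+1}=0$ by the group of $(\zeta_0,\dots,\zeta_{n+1})$ with $\zeta_i^{n+2}=1$, $\prod\zeta_i=1$) and $\alpha_1,\dots,\alpha_{n+1}$ is a basis of $H^n_{\rm dR}(X)$ with $\alpha_i\in F^{n+1-i}\setminus F^{n+2-i}$ (Hodge filtration) and intersection matrix $(\langle\alpha_i,\alpha_j\rangle)=\Phi$, where $\Phi=\begin{pmatrix}0&J_m\\-J_m&0\end{pmatrix}$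 for $n$ odd, $\Phi=J_{n+1}$ for $n$ even, $J_k$ being the $k\times k$ matrix with $1$'s on the antidiagonal and $0$ elsewhere. It has the following explicit description. Let $B$ be the $(n+1)\times(n+1)$ matrix of $1$-forms in $t_1,t_{n+2}$ (Gauss-Manin matrix in a basis $\omega=(\omega_1,\dots,\omega_{n+1})^{\rm tr}$) with entries: $B[i,i]=-\frac{i}{(n+2)t_{n+2}}dt_{n+2}$ and $B[i,i+1]=dt_1-\frac{t_1}{(n+2)t_{n+2}}dt_{n+2}$ for $1\le i\le n$; $B[n+1,j]=\frac{-S_2(n+2,j)t_1^j}{t_1^{n+2}-t_{n+2}}dt_1+\frac{S_2(n+2,j)t_1^{j+1}}{(n+2)t_{n+2}(t_1^{n+2}-t_{n+2})}dt_{n+2}$ for $1\le j\le n$; $B[n+1,n+1]=\frac{-S_2(n+2,n+1)t_1^{n+1}}{t_1^{n+2}-t_{n+2}}dt_1+\frac{\frac{n(n+1)}2t_1^{n+2}+(n+1)t_{n+2}}{(n+2)t_{n+2}(t_1^{n+2}-t_{n+2})}dt_{n+2}$; all other entries $0$. Here $S_2$ denotes Stirling numbers of the second kind. Let $\Omega=(\langle\omega_i,\omega_j\rangle)$ be the $(-1)^n$-symmetric matrix determined by $\Omega_{ij}=0$ for $i+j\le n+1$, $\Omega_{1,n+1}=(-(n+2))^n\frac{c_n}{t_1^{n+2}-t_{n+2}}$ ($c_n$ a fixed nonzero constant), $\Omega_{j,n+2-j}=(-1)^{j-1}\Omega_{1,n+1}$, and $d\Omega=B\Omega+\Omega B^{\rm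 tr}$. Points of $\mathsf T$ are given by $(t_1,t_{n+2})$ with $t_{n+2}(t_1^{n+2}-t_{n+2})\ne0$ and an invertible lower triangular matrix $S=(s_{ij})$ with $s_{11}=1$ and $S\Omega S^{\rm tr}=\Phi$; then $\alpha=S\omega$. Independent coordinates: the entries $s_{ij}$, $i\ge j$, $(i,j)\neq(1,1)$, with $i+j\le n+2$ ($n$ odd) or $i+j<n+2$ ($n$ even), read from left to right and top to bottom, are named $t_2,t_3,\dots$ in order, skipping the index $n+2$ (already used). So $t_2=s_{21}$. Let $I=\{1,\dots,d\}$ if $n\ne2$, $I=\{1,2,4\}$ if $n=2$; $(t_j)_{j\in I}$ is the chart. For $n$ even let in addition $u=s_{\frac{n+2}2\frac{n+2}2}$, so $u^2=\frac{(-1)^{n/2}}{c_n(n+2)^n}(t_1^{n+2}-t_{n+2})$ ($u$ is called $t_{d+1}$, and $t_3$ when $n=2$). All other entries of $S$ are regular functions of these, and $\mathcal O_{\mathsf T}=\mathbb C\big[t_j\,(j\in I),\,u,\,\frac1{t_{n+2}(t_{n+2}-t_1^{n+2})\check t}\big]$ ($u$ present only for $n$ even, subject to its quadratic relation), where $\check t$ is the product of the $m-1$ coordinates $t_j$ lying on the main diagonal of $S$. Vector fields on $\mathsf T$ are $\mathbb C$-derivations of $\mathcal O_{\mathsf T}$, written $\sum_{j\in I}E^j\frac{\partial}{\partial t_j}$ ($\frac{\partial}{\partial t_j}$ extends uniquely to $u$); $[\cdot,\cdot]$ is the Lie bracket of vector fields, $[V,W]=VW-WV$. **Vector fields.** For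 a vector field $E$ its Gauss-Manin matrix $A_E$ (i.e. $\nabla_E\alpha=A_E\alpha$) is determined by $E(S)=A_ES-S\,B(E)$, with $E(S)$ taken entrywise; $E$ is determined by $A_E$. - The modular vector field $\mathsf R$ is the unique vector field for which there are regular functions $\mathsf Y_1,\dots,\mathsf Y_{n-2}$ such that $A_{\mathsf R}=\mathsf Y$, where $\mathsf Y$ has superdiagonal $(1,\mathsf Y_1,\dots,\mathsf Y_{n-2},-1)$ (for $n=2$: $(1,-1)$; for $n=1$: $(1)$) and zeros elsewhere, and $\mathsf Y\Phi+\Phi\mathsf Y^{\rm tr}=0$. - For $\mathfrak g$ upper triangular with $\mathfrak g^{\rm tr}\Phi+\Phi\mathfrak g=0$, $\mathsf R_{\mathfrak g}$ is the unique vector field with $A_{\mathsf R_{\mathfrak g}}=\mathfrak g^{\rm tr}$. With $E_{ij}$ the matrix units put $\mathfrak g_{11}=E_{11}-E_{n+1,n+1}$ and, for $n\ge3$, $\mathfrak g_{22}=E_{22}-E_{nn}$. - $\mathsf H:=-\mathsf R_{\mathfrak g_{11}}$ if $n=1$, $\mathsf H:=-2\mathsf R_{\mathfrak g_{11}}$ if $n=2$, $\mathsf H:=\mathsf R_{\mathfrak g_{22}}-\mathsf R_{\mathfrak g_{11}}$ if $n\ge3$. One has $\mathsf H=\sum_{j\in I}w_jt_j\frac{\partial}{\partial t_j}$ with non-negative integers $w_j$: for $n=1$, $(w_1,w_2,w_3)=(1,2,3)$; for $n=2$, $(w_1,w_2,w_4)=(2,2,8)$; for $n\ge3$, $w_1=1$,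 $w_{n+2}=n+2$, and if $t_j=s_{ik}$ then $w_j=k+1$ for $i\in\{2,n+1\}$, $w_j=k$ for $3\le i\le n-1$, $w_j=k-1$ for $i=n$. - The AMSY-Lie algebra $\mathfrak G$ is the $\mathcal O_{\mathsf T}$-submodule of $\mathfrak X(\mathsf T)$ generated by $\mathsf R$ and all $\mathsf R_{\mathfrak g}$, where $\mathfrak g$ runs over the upper triangular complex $(n+1)\times(n+1)$ matrices with $\mathfrak g^{\rm tr}\Phi+\Phi\mathfrak g=0$. **The vector field $\mathsf D$.** Option 1: $\mathsf D:=\mathsf R$, but for odd $n\ge3$ the coordinate $t_d$ of the chart is replaced by $\tilde t_d:=t_7+t_2t_4$ if $n=3$ (here $d=7$), $\tilde t_d:=t_d+t_2t_{d-2}$ if $n\ge5$; $\tilde t_d$ is again denoted $t_d$, and all partial derivatives $\frac{\partial}{\partial t_j}$ (in particular $\frac{\partial}{\partial t_2}$) are with respect to the new chart. Option 2: the original chart is kept and $\mathsf D:=\mathsf R+t_2\big([\mathsf R,(1+\delta_2^n)\frac{\partial}{\partial t_2}]-\mathsf H\big)$. *)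

theory Defs
  imports
    "HOL-Library.Function_Algebras"
    "HOL-Combinatorics.Stirling"
    "Jordan_Normal_Form.Matrix"
begin

text \<open>
  Matrix entries and rows are numbered from 1, as in the literature on the Dwork family;
  \<open>mat1\<close> and \<open>entry\<close> translate to the 0-based matrices of Jordan_Normal_Form.
\<close>

definition mat1 :: "nat \<Rightarrow> (nat \<Rightarrow> nat \<Rightarrow> 'a) \<Rightarrow> 'a mat" where
  "mat1 N f = mat N N (\<lambda>(i, j). f (i + 1) (j + 1))"

definition entry :: "'a mat \<Rightarrow> nat \<Rightarrow> nat \<Rightarrow> 'a" where
  "entry A i j = A $$ (i - 1, j - 1)"


section \<open>The Gauss--Manin matrix, the intersection form and the moduli space\<close>

definition half_dim :: "nat \<Rightarrow> nat" where
  "half_dim n = (if odd n then (n + 1) div 2 else n div 2)"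

definition dim_T :: "nat \<Rightarrow> nat" where
  "dim_T n = (if odd n then (n + 1) * (n + 3) div 4 + 1 else n * (n + 2) div 4 + 1)"

definition antidiag :: "nat \<Rightarrow> complex mat" where
  "antidiag k = mat1 k (\<lambda>i j. if i + j = k + 1 then 1 else 0)"

definition Phi :: "nat \<Rightarrow> complex mat" where
  "Phi n = (let m = half_dim n in
     if odd n then four_block_mat (0\<^sub>m m m) (antidiag m) (- antidiag m) (0\<^sub>m m m)
     else antidiag (n + 1))"

text \<open>
  The Gauss--Manin matrix is \<open>B = B1 dt\<^sub>1 + B2 dt\<^sub>n\<^sub>+\<^sub>2\<close>.
  Throughout, \<open>x\<close> stands for \<open>t\<^sub>1\<close> and \<open>y\<close> for \<open>t\<^sub>n\<^sub>+\<^sub>2\<close>.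
\<close>

definition B1 :: "nat \<Rightarrow> complex \<Rightarrow> complex \<Rightarrow> complex mat" where
  "B1 n x y = mat1 (n + 1) (\<lambda>i j.
     if i \<le> n then (if j = i + 1 then 1 else 0)
     else - of_nat (Stirling (n + 2) j) * x ^ j / (x ^ (n + 2) - y))"

definition B2 :: "nat \<Rightarrow> complex \<Rightarrow> complex \<Rightarrow> complex mat" where
  "B2 n x y = mat1 (n + 1) (\<lambda>i j.
     if i \<le> n then
       (if j = i then - of_nat i / (of_nat (n + 2) * y)
        else if j = i + 1 then - x / (of_nat (n + 2) * y)
        else 0)
     else if j \<le> n then
       of_nat (Stirling (n + 2) j) * x ^ (j + 1) / (of_nat (n + 2) * y * (x ^ (n + 2) - y))
     else (of_nat n * of_nat (n + 1) / 2 * x ^ (n + 2) + of_nat (n + 1) * y)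
            / (of_nat (n + 2) * y * (x ^ (n + 2) - y)))"

definition base :: "nat \<Rightarrow> (complex \<times> complex) set" where
  "base n = {(x, y). y * (x ^ (n + 2) - y) \<noteq> 0}"

text \<open>
  \<open>Om x y\<close> is the matrix \<open>\<Omega>\<close> at \<open>(t\<^sub>1, t\<^sub>n\<^sub>+\<^sub>2) = (x, y)\<close>.  The last two conjuncts are the
  \<open>dt\<^sub>1\<close>- and the \<open>dt\<^sub>n\<^sub>+\<^sub>2\<close>-component of \<open>d\<Omega> = B \<Omega> + \<Omega> B\<^sup>t\<^sup>r\<close>.  These conditions determine
  \<open>\<Omega>\<close> on \<open>base n\<close>, row by row; values of \<open>Om\<close> outside of \<open>base n\<close> are irrelevant.
\<close>

definition is_intersection_matrix ::
  "nat \<Rightarrow> complex \<Rightarrow> (complex \<Rightarrow> complex \<Rightarrow> complex mat) \<Rightarrow> bool" where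
  "is_intersection_matrix n c Om \<longleftrightarrow> (\<forall>(x, y) \<in> base n.
     Om x y \<in> carrier_mat (n + 1) (n + 1) \<and>
     (Om x y)\<^sup>T = (- 1) ^ n \<cdot>\<^sub>m Om x y \<and>
     (\<forall>i\<in>{1..n + 1}. \<forall>j\<in>{1..n + 1}. i + j \<le> n + 1 \<longrightarrow> entry (Om x y) i j = 0) \<and>
     entry (Om x y) 1 (n + 1) = (- of_nat (n + 2)) ^ n * (c / (x ^ (n + 2) - y)) \<and>
     (\<forall>j\<in>{1..n + 1}.
        entry (Om x y) j (n + 2 - j) = (- 1) ^ (j - 1) * entry (Om x y) 1 (n + 1)) \<and>
     (\<forall>i\<in>{1..n + 1}. \<forall>j\<in>{1..n + 1}.
        ((\<lambda>x'. entry (Om x' y) i j) has_field_derivative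
           entry (B1 n x y * Om x y + Om x y * (B1 n x y)\<^sup>T) i j) (at x) \<and>
        ((\<lambda>y'. entry (Om x y') i j) has_field_derivative
           entry (B2 n x y * Om x y + Om x y * (B2 n x y)\<^sup>T) i j) (at y)))"

datatype point = Point (pt_x: complex) (pt_y: complex) (pt_S: "complex mat")

definition T :: "nat \<Rightarrow> (complex \<Rightarrow> complex \<Rightarrow> complex mat) \<Rightarrow> point set" where
  "T n Om = {Point x y S | x y S.
     (x, y) \<in> base n \<and>
     S \<in> carrier_mat (n + 1) (n + 1) \<and> invertible_mat S \<and> upper_triangular S\<^sup>T \<and>
     entry S 1 1 = 1 \<and> S * Om x y * S\<^sup>T = Phi n}"


section \<open>Regular functions\<close>

text \<open>
  Functions on \<open>T\<close> are represented by functions on the type \<^typ>\<open>point\<close> vanishing outside of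
  \<open>T\<close>, so that equality is equality on \<open>T\<close>; ring operations are pointwise.  The unit of the ring
  of regular functions is therefore \<open>on_T n Om (\<lambda>_. 1)\<close>, not the constant function 1.
\<close>

type_synonym func = "point \<Rightarrow> complex"

definition on_T :: "nat \<Rightarrow> (complex \<Rightarrow> complex \<Rightarrow> complex mat) \<Rightarrow> func \<Rightarrow> func" where
  "on_T n Om f = (\<lambda>p. if p \<in> T n Om then f p else 0)"

definition S_entry :: "nat \<Rightarrow> (complex \<Rightarrow> complex \<Rightarrow> complex mat) \<Rightarrow> nat \<Rightarrow> nat \<Rightarrow> func" where
  "S_entry n Om i j = on_T n Om (\<lambda>p. entry (pt_S p) i j)"

definition coord_entries :: "nat \<Rightarrow> (nat \<times> nat) list" where
  "coord_entries n = [(i, j). i \<leftarrow> [1..<n + 2], j \<leftarrow> [1..<i + 1],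
     (i, j) \<noteq> (1, 1) \<and> (if odd n then i + j \<le> n + 2 else i + j < n + 2)]"

text \<open>\<open>tcoord n Om j\<close> is \<open>t\<^sub>j\<close>.  The index \<open>n + 2\<close> is skipped in the numbering of the entries of \<open>S\<close>.\<close>

definition tcoord :: "nat \<Rightarrow> (complex \<Rightarrow> complex \<Rightarrow> complex mat) \<Rightarrow> nat \<Rightarrow> func" where
  "tcoord n Om j =
     (if j = 1 then on_T n Om pt_x
      else if j = n + 2 then on_T n Om pt_y
      else (case coord_entries n ! (if j < n + 2 then j - 2 else j - 3) of
              (i, k) \<Rightarrow> S_entry n Om i k))"

definition chart_idx :: "nat \<Rightarrow> nat set" where
  "chart_idx n = (if n = 2 then {1, 2, 4} else {1..dim_T n})"

definition t_check :: "nat \<Rightarrow> (complex \<Rightarrow> complex \<Rightarrow> complex mat) \<Rightarrow> func" where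
  "t_check n Om = (\<lambda>p. \<Prod>(i, j)\<in>{e \<in> set (coord_entries n). fst e = snd e}. S_entry n Om i j p)"

definition u_coord :: "nat \<Rightarrow> (complex \<Rightarrow> complex \<Rightarrow> complex mat) \<Rightarrow> func" where
  "u_coord n Om = S_entry n Om ((n + 2) div 2) ((n + 2) div 2)"

inductive_set O_T :: "nat \<Rightarrow> (complex \<Rightarrow> complex \<Rightarrow> complex mat) \<Rightarrow> func set"
  for n :: nat and Om :: "complex \<Rightarrow> complex \<Rightarrow> complex mat" where
  const: "on_T n Om (\<lambda>_. a) \<in> O_T n Om"
| coord: "j \<in> chart_idx n \<Longrightarrow> tcoord n Om j \<in> O_T n Om"
| u: "even n \<Longrightarrow> u_coord n Om \<in> O_T n Om"
| inv: "on_T n Om (\<lambda>p. 1 / (pt_y p * (pt_y p - pt_x p ^ (n + 2)) * t_check n Om p)) \<in> O_T n Om"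
| add: "f \<in> O_T n Om \<Longrightarrow> g \<in> O_T n Om \<Longrightarrow> f + g \<in> O_T n Om"
| mult: "f \<in> O_T n Om \<Longrightarrow> g \<in> O_T n Om \<Longrightarrow> f * g \<in> O_T n Om"


section \<open>Vector fields\<close>

text \<open>
  Derivations of \<open>O_T\<close>, extended by 0 to functions that are not regular.  The vector space
  operations are the pointwise ones.
\<close>

type_synonym vfield = "func \<Rightarrow> func"

definition fscale :: "func \<Rightarrow> vfield \<Rightarrow> vfield" where
  "fscale f V = (\<lambda>g. f * V g)"

definition cscale :: "complex \<Rightarrow> vfield \<Rightarrow> vfield" where
  "cscale a V = fscale (\<lambda>_. a) V"

definition lie_bracket :: "vfield \<Rightarrow> vfield \<Rightarrow> vfield" where
  "lie_bracket V W = (\<lambda>f. V (W f) - W (V f))"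

definition vector_fields :: "nat \<Rightarrow> (complex \<Rightarrow> complex \<Rightarrow> complex mat) \<Rightarrow> vfield set" where
  "vector_fields n Om = {V.
     (\<forall>f\<in>O_T n Om. V f \<in> O_T n Om) \<and>
     (\<forall>f. f \<notin> O_T n Om \<longrightarrow> V f = 0) \<and>
     (\<forall>f\<in>O_T n Om. \<forall>g\<in>O_T n Om. V (f + g) = V f + V g) \<and>
     (\<forall>a. \<forall>f\<in>O_T n Om. V ((\<lambda>_. a) * f) = (\<lambda>_. a) * V f) \<and>
     (\<forall>f\<in>O_T n Om. \<forall>g\<in>O_T n Om. V (f * g) = V f * g + f * V g)}"

text \<open>\<open>V = \<partial>/\<partial>\<tau>\<^sub>j\<close> with respect to the chart \<open>(\<tau>\<^sub>k)\<close>, \<open>k \<in> chart_idx n\<close>.\<close>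

definition is_partial_derivative ::
  "nat \<Rightarrow> (complex \<Rightarrow> complex \<Rightarrow> complex mat) \<Rightarrow> (nat \<Rightarrow> func) \<Rightarrow> nat \<Rightarrow> vfield \<Rightarrow> bool" where
  "is_partial_derivative n Om tau j V \<longleftrightarrow> V \<in> vector_fields n Om \<and>
     (\<forall>k\<in>chart_idx n. V (tau k) = on_T n Om (\<lambda>_. if k = j then 1 else 0))"

definition S_mat :: "nat \<Rightarrow> (complex \<Rightarrow> complex \<Rightarrow> complex mat) \<Rightarrow> func mat" where
  "S_mat n Om = mat1 (n + 1) (S_entry n Om)"

definition B_along :: "nat \<Rightarrow> (complex \<Rightarrow> complex \<Rightarrow> complex mat) \<Rightarrow> vfield \<Rightarrow> func mat" where
  "B_along n Om V =
     V (on_T n Om pt_x) \<cdot>\<^sub>m mat1 (n + 1) (\<lambda>i j. on_T n Om (\<lambda>p. entry (B1 n (pt_x p) (pt_y p)) i j)) +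
     V (on_T n Om pt_y) \<cdot>\<^sub>m mat1 (n + 1) (\<lambda>i j. on_T n Om (\<lambda>p. entry (B2 n (pt_x p) (pt_y p)) i j))"

definition is_gauss_manin_matrix ::
  "nat \<Rightarrow> (complex \<Rightarrow> complex \<Rightarrow> complex mat) \<Rightarrow> vfield \<Rightarrow> func mat \<Rightarrow> bool" where
  "is_gauss_manin_matrix n Om V A \<longleftrightarrow>
     A \<in> carrier_mat (n + 1) (n + 1) \<and> elements_mat A \<subseteq> O_T n Om \<and>
     map_mat V (S_mat n Om) = A * S_mat n Om - S_mat n Om * B_along n Om V"

definition const_mat :: "nat \<Rightarrow> (complex \<Rightarrow> complex \<Rightarrow> complex mat) \<Rightarrow> complex mat \<Rightarrow> func mat" where
  "const_mat n Om g = map_mat (\<lambda>a. on_T n Om (\<lambda>_. a)) g"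

definition Y_mat ::
  "nat \<Rightarrow> (complex \<Rightarrow> complex \<Rightarrow> complex mat) \<Rightarrow> (nat \<Rightarrow> func) \<Rightarrow> func mat" where
  "Y_mat n Om Y = mat1 (n + 1) (\<lambda>i j.
     if j = i + 1 then
       (if i = 1 then on_T n Om (\<lambda>_. 1) else if i = n then on_T n Om (\<lambda>_. - 1) else Y (i - 1))
     else 0)"

definition is_modular_vector_field ::
  "nat \<Rightarrow> (complex \<Rightarrow> complex \<Rightarrow> complex mat) \<Rightarrow> vfield \<Rightarrow> bool" where
  "is_modular_vector_field n Om R \<longleftrightarrow> R \<in> vector_fields n Om \<and>
     (\<exists>Y. (\<forall>k\<in>{1..n - 2}. Y k \<in> O_T n Om) \<and>
        is_gauss_manin_matrix n Om R (Y_mat n Om Y) \<and>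
        Y_mat n Om Y * const_mat n Om (Phi n) + const_mat n Om (Phi n) * (Y_mat n Om Y)\<^sup>T
          = 0\<^sub>m (n + 1) (n + 1))"

definition lie_G :: "nat \<Rightarrow> complex mat set" where
  "lie_G n = {g \<in> carrier_mat (n + 1) (n + 1).
     upper_triangular g \<and> g\<^sup>T * Phi n + Phi n * g = 0\<^sub>m (n + 1) (n + 1)}"

text \<open>\<open>V = R\<^sub>g\<close>\<close>

definition is_R_g ::
  "nat \<Rightarrow> (complex \<Rightarrow> complex \<Rightarrow> complex mat) \<Rightarrow> complex mat \<Rightarrow> vfield \<Rightarrow> bool" where
  "is_R_g n Om g V \<longleftrightarrow> V \<in> vector_fields n Om \<and>
     is_gauss_manin_matrix n Om V (const_mat n Om g\<^sup>T)"

definition mat_unit :: "nat \<Rightarrow> nat \<Rightarrow> nat \<Rightarrow> complex mat" where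
  "mat_unit N i j = mat1 N (\<lambda>k l. if k = i \<and> l = j then 1 else 0)"

definition g11 :: "nat \<Rightarrow> complex mat" where
  "g11 n = mat_unit (n + 1) 1 1 - mat_unit (n + 1) (n + 1) (n + 1)"

definition g22 :: "nat \<Rightarrow> complex mat" where
  "g22 n = mat_unit (n + 1) 2 2 - mat_unit (n + 1) n n"

definition is_radial_vector_field ::
  "nat \<Rightarrow> (complex \<Rightarrow> complex \<Rightarrow> complex mat) \<Rightarrow> vfield \<Rightarrow> bool" where
  "is_radial_vector_field n Om H \<longleftrightarrow>
     (\<exists>R11. is_R_g n Om (g11 n) R11 \<and>
        (if n = 1 then H = - R11
         else if n = 2 then H = cscale (- 2) R11
         else (\<exists>R22. is_R_g n Om (g22 n) R22 \<and> H = R22 - R11)))"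

definition is_O_T_submodule ::
  "nat \<Rightarrow> (complex \<Rightarrow> complex \<Rightarrow> complex mat) \<Rightarrow> vfield set \<Rightarrow> bool" where
  "is_O_T_submodule n Om M \<longleftrightarrow> M \<subseteq> vector_fields n Om \<and> 0 \<in> M \<and>
     (\<forall>V\<in>M. \<forall>W\<in>M. V + W \<in> M) \<and> (\<forall>f\<in>O_T n Om. \<forall>V\<in>M. fscale f V \<in> M)"

definition AMSY :: "nat \<Rightarrow> (complex \<Rightarrow> complex \<Rightarrow> complex mat) \<Rightarrow> vfield set" where
  "AMSY n Om = \<Inter> {M. is_O_T_submodule n Om M \<and>
     {R. is_modular_vector_field n Om R} \<union> {V. \<exists>g\<in>lie_G n. is_R_g n Om g V} \<subseteq> M}"


section \<open>The vector field D\<close>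

datatype construction = Option1 | Option2

definition chart ::
  "construction \<Rightarrow> nat \<Rightarrow> (complex \<Rightarrow> complex \<Rightarrow> complex mat) \<Rightarrow> nat \<Rightarrow> func" where
  "chart opt n Om j =
     (if opt = Option1 \<and> odd n \<and> n \<ge> 3 \<and> j = dim_T n then
        (if n = 3 then tcoord n Om 7 + tcoord n Om 2 * tcoord n Om 4
         else tcoord n Om j + tcoord n Om 2 * tcoord n Om (j - 2))
      else tcoord n Om j)"

text \<open>\<open>F\<close> is to be the vector field \<open>(1 + \<delta>) \<partial>/\<partial>t\<^sub>2\<close>.\<close>

definition D_field ::
  "construction \<Rightarrow> nat \<Rightarrow> (complex \<Rightarrow> complex \<Rightarrow> complex mat) \<Rightarrow>
     vfield \<Rightarrow> vfield \<Rightarrow> vfield \<Rightarrow> vfield" where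
  "D_field opt n Om R H F = (case opt of
       Option1 \<Rightarrow> R
     | Option2 \<Rightarrow> R + fscale (tcoord n Om 2) (lie_bracket R F - H))"


section \<open>Lie subalgebras and \<open>sl\<^sub>2\<close>\<close>

definition is_lie_subalgebra ::
  "nat \<Rightarrow> (complex \<Rightarrow> complex \<Rightarrow> complex mat) \<Rightarrow> vfield set \<Rightarrow> bool" where
  "is_lie_subalgebra n Om L \<longleftrightarrow> L \<subseteq> vector_fields n Om \<and> 0 \<in> L \<and>
     (\<forall>V\<in>L. \<forall>W\<in>L. V + W \<in> L \<and> lie_bracket V W \<in> L) \<and>
     (\<forall>a. \<forall>V\<in>L. cscale a V \<in> L)"

definition lie_generated ::
  "nat \<Rightarrow> (complex \<Rightarrow> complex \<Rightarrow> complex mat) \<Rightarrow> vfield set \<Rightarrow> vfield set" where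
  "lie_generated n Om X = \<Inter> {L. is_lie_subalgebra n Om L \<and> X \<subseteq> L}"

definition sl2 :: "complex mat set" where
  "sl2 = {A \<in> carrier_mat 2 2. A $$ (0, 0) + A $$ (1, 1) = 0}"

definition isomorphic_to_sl2 :: "vfield set \<Rightarrow> bool" where
  "isomorphic_to_sl2 L \<longleftrightarrow> (\<exists>\<phi>. bij_betw \<phi> sl2 L \<and>
     (\<forall>A\<in>sl2. \<forall>C\<in>sl2. \<phi> (A + C) = \<phi> A + \<phi> C) \<and>
     (\<forall>a. \<forall>A\<in>sl2. \<phi> (a \<cdot>\<^sub>m A) = cscale a (\<phi> A)) \<and>
     (\<forall>A\<in>sl2. \<forall>C\<in>sl2. \<phi> (A * C - C * A) = lie_bracket (\<phi> A) (\<phi> C)))"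

end

theory Submission
  imports Defs "Jordan_Normal_Form.Determinant"
begin

text \<open>
  The fields \<open>D\<close>, \<open>H\<close>, \<open>F\<close> satisfy \<open>[D, F] = H\<close>, \<open>[H, D] = 2 D\<close>, \<open>[H, F] = - 2 F\<close>, and \<open>F \<noteq> 0\<close>; by
  simplicity of \<open>sl\<^sub>2\<close> the Lie algebra that they generate is their three-dimensional span.

  The entries of \<open>S\<close> are regular, because \<open>S \<Omega> S\<^sup>t\<^sup>r = \<Phi>\<close> can be solved for them row by row, and a vector
  field is determined by its values on the chart.  Hence the relations can be checked on \<open>t\<^sub>1\<close>,
  \<open>t\<^sub>n\<^sub>+\<^sub>2\<close> and the entries of \<open>S\<close>, without using that \<open>B\<close> is flat: along any \<open>E\<close> the matrix \<open>B(E)\<close>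
  is a combination of \<open>B1\<close> and of \<open>diag(1,\<dots>,n+1)\<close> with coefficients read off from the first row of
  \<open>E(S) = A\<^sub>E S - S B(E)\<close>.  For \<open>H\<close> this makes every entry of \<open>S\<close> an eigenvector, for \<open>R\<close> it gives
  formulas that are homogeneous of degree 2 with respect to \<open>H\<close>.

  Up to a multiple of \<open>\<partial>/\<partial>s\<^sub>n\<^sub>+\<^sub>1\<^sub>,\<^sub>1\<close> in Option 2, \<open>F\<close> is a field \<open>R\<^sub>g\<close> with \<open>g\<close> nilpotent.  Such fields
  exist: they are the derivatives of the flows \<open>S \<mapsto> exp(r g\<^sup>t\<^sup>r) S\<close> on the moduli space.
\<close>

section \<open>Matrices with entries numbered from 1\<close>

text \<open>R, H and \<open>P\<close> are given, but F is shown to lie in the AMSY-Lie algebra by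
  building it from fields with constant Gauss--Manin matrix, and these have to be constructed; hence
  the flows. A strictly lower triangular matrix fixes the diagonal of S along its flow, so u and the
  inverted function are constant there and regularity of derivatives is easy to keep. The matrix is
  forced: row 1 of S is (1, 0, ..., 0), so adding a multiple of row 1 to row 2 moves nothing in row
  2 but \<open>s 2 1\<close>, and compatibility with Phi then subtracts the same multiple of row n
  from row n + 1. For odd n >= 3 this also moves the coordinate \<open>s (n + 1) 1\<close>. Option 1
  replaces that coordinate by one that is constant along the flow; Option 2 keeps it and corrects
  both F and R. H is normalised so that \<open>s 2 1\<close> has weight 2. For n = 2 this doubles
  the field of - \<open>g11\<close>, and the factor 2 in F then follows from [R, F] = H. Functions
  are genuine functions on the space T, so a point of T must be exhibited before F can be
  nonzero.\<close>

lemma mat1_carrier [simp]: "mat1 N f \<in> carrier_mat N N"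
  by (simp add: mat1_def)

lemma entry_mat1 [simp]:
  "i \<in> {1..N} \<Longrightarrow> j \<in> {1..N} \<Longrightarrow> entry (mat1 N f) i j = f i j"
  by (auto simp: mat1_def entry_def)

lemma mat_eqI_entry:
  assumes "A \<in> carrier_mat N N" "B \<in> carrier_mat N N"
    and "\<And>i j. i \<in> {1..N} \<Longrightarrow> j \<in> {1..N} \<Longrightarrow> entry A i j = entry B i j"
  shows "A = B"
proof (rule eq_matI)
  fix i j assume "i < dim_row B" "j < dim_col B"
  then show "A $$ (i, j) = B $$ (i, j)"
    using assms(1,2) assms(3)[of "i + 1" "j + 1"] by (auto simp: entry_def)
qed (use assms in auto)

lemma entry_mult:
  assumes "A \<in> carrier_mat N N" "B \<in> carrier_mat N N" "i \<in> {1..N}" "j \<in> {1..N}"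
  shows "entry (A * B) i j = (\<Sum>l = 1..N. entry A i l * entry B l j)"
proof -
  have "entry (A * B) i j = (\<Sum>l\<in>{0..<N}. A $$ (i - 1, l) * B $$ (l, j - 1))"
    using assms by (auto simp: entry_def scalar_prod_def)
  also have "\<dots> = (\<Sum>l = 1..N. entry A i l * entry B l j)"
    by (simp add: entry_def sum.atLeast1_atMost_eq atLeast0LessThan)
  finally show ?thesis .
qed

lemma entry_add:
  assumes "A \<in> carrier_mat N N" "B \<in> carrier_mat N N" "i \<in> {1..N}" "j \<in> {1..N}"
  shows "entry (A + B) i j = entry A i j + entry B i j"
  using assms by (auto simp: entry_def)

lemma entry_diff:
  assumes "A \<in> carrier_mat N N" "B \<in> carrier_mat N N" "i \<in> {1..N}" "j \<in> {1..N}"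
  shows "entry (A - B) i j = entry A i j - entry B i j"
  using assms by (auto simp: entry_def)

lemma entry_smult:
  assumes "A \<in> carrier_mat N N" "i \<in> {1..N}" "j \<in> {1..N}"
  shows "entry (a \<cdot>\<^sub>m A) i j = a * entry A i j"
  using assms by (auto simp: entry_def)

lemma entry_transpose:
  assumes "A \<in> carrier_mat N N" "i \<in> {1..N}" "j \<in> {1..N}"
  shows "entry A\<^sup>T i j = entry A j i"
  using assms by (auto simp: entry_def)

lemma entry_map_mat:
  assumes "A \<in> carrier_mat N N" "i \<in> {1..N}" "j \<in> {1..N}"
  shows "entry (map_mat f A) i j = f (entry A i j)"
  using assms by (auto simp: entry_def)

lemma entry_zero: "i \<in> {1..N} \<Longrightarrow> j \<in> {1..N} \<Longrightarrow> entry (0\<^sub>m N N) i j = 0"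
  by (auto simp: entry_def)

lemma elements_mat_subsetI:
  assumes "A \<in> carrier_mat N N" "\<And>i j. i \<in> {1..N} \<Longrightarrow> j \<in> {1..N} \<Longrightarrow> entry A i j \<in> M"
  shows "elements_mat A \<subseteq> M"
proof
  fix a assume "a \<in> elements_mat A"
  then obtain i j where "i < dim_row A" "j < dim_col A" "a = A $$ (i, j)"
    by blast
  then show "a \<in> M" using assms(1) assms(2)[of "i + 1" "j + 1"] by (auto simp: entry_def)
qed

section \<open>The form Phi entry by entry\<close>

definition phi_sign :: "nat \<Rightarrow> nat \<Rightarrow> complex" where
  "phi_sign n i = (if odd n \<and> 2 * i > n + 1 then - 1 else 1)"

lemma Phi_carrier [simp]: "Phi n \<in> carrier_mat (n + 1) (n + 1)"
  by (auto simp: Phi_def antidiag_def mat1_def half_dim_def Let_def elim!: oddE)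

lemmas Phi_carrier_Suc [simp] = Phi_carrier[unfolded Suc_eq_plus1[symmetric]]

lemma entry_Phi:
  assumes "i \<in> {1..n + 1}" "j \<in> {1..n + 1}"
  shows "entry (Phi n) i j = (if i + j = n + 2 then phi_sign n i else 0)"
proof (cases "odd n")
  case True
  then obtain k where k: "n = 2 * k + 1" by (auto elim: oddE)
  then have m: "half_dim n = k + 1" by (simp add: half_dim_def)
  have b: "i - 1 < 2 * (k + 1)" "j - 1 < 2 * (k + 1)" using assms k by auto
  let ?J = "antidiag (k + 1)"
  have "Phi n = four_block_mat (0\<^sub>m (k + 1) (k + 1)) ?J (- ?J) (0\<^sub>m (k + 1) (k + 1))"
    using True m by (simp add: Phi_def Let_def)
  then have "entry (Phi n) i j =
      (if i - 1 < k + 1 then if j - 1 < k + 1 then 0 else ?J $$ (i - 1, j - 1 - (k + 1))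
       else if j - 1 < k + 1 then - ?J $$ (i - 1 - (k + 1), j - 1) else 0)"
    using b by (auto simp: entry_def antidiag_def mat1_def)
  also have "\<dots> = (if i + j = n + 2 then if 2 * i > n + 1 then - 1 else 1 else 0)"
    using b assms k by (auto simp: antidiag_def mat1_def)
  finally show ?thesis using True by (simp add: phi_sign_def)
next
  case False
  then show ?thesis using assms
    by (auto simp: Phi_def Let_def antidiag_def phi_sign_def)
qed

lemma phi_sign_nz [simp]: "phi_sign n i \<noteq> 0"
  by (simp add: phi_sign_def)

text \<open>This is the symmetry of Phi up to (-1)^n: for odd n no index is its own mirror image, so
  reflection exchanges the two halves and with them the two signs.\<close>

lemma phi_sign_reflect:
  "i \<in> {1..n + 1} \<Longrightarrow> phi_sign n (n + 2 - i) = (- 1) ^ n * phi_sign n i"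
proof (cases "odd n")
  case True
  assume i: "i \<in> {1..n + 1}"
  obtain k where "n = 2 * k + 1" using True by (auto elim: oddE)
  then have "2 * (n + 2 - i) > n + 1 \<longleftrightarrow> \<not> 2 * i > n + 1"
    using i unfolding atLeastAtMost_iff by presburger
  then show ?thesis using True by (simp add: phi_sign_def)
qed (simp add: phi_sign_def)

lemma entry_mult_Phi:
  assumes "A \<in> carrier_mat (n + 1) (n + 1)" "i \<in> {1..n + 1}" "j \<in> {1..n + 1}"
  shows "entry (A * Phi n) i j = entry A i (n + 2 - j) * phi_sign n (n + 2 - j)"
proof -
  have "entry (A * Phi n) i j = (\<Sum>l = 1..n + 1. entry A i l * entry (Phi n) l j)"
    by (rule entry_mult) (use assms in auto)
  also have "\<dots> = (\<Sum>l = 1..n + 1. if l = n + 2 - j then entry A i l * phi_sign n l else 0)"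
    by (rule sum.cong) (use assms in \<open>auto simp: entry_Phi\<close>)
  also have "\<dots> = entry A i (n + 2 - j) * phi_sign n (n + 2 - j)"
    using assms by (subst sum.delta) auto
  finally show ?thesis .
qed

lemma entry_Phi_mult:
  assumes "A \<in> carrier_mat (n + 1) (n + 1)" "i \<in> {1..n + 1}" "j \<in> {1..n + 1}"
  shows "entry (Phi n * A) i j = phi_sign n i * entry A (n + 2 - i) j"
proof -
  have "entry (Phi n * A) i j = (\<Sum>l = 1..n + 1. entry (Phi n) i l * entry A l j)"
    by (rule entry_mult) (use assms in auto)
  also have "\<dots> = (\<Sum>l = 1..n + 1. if l = n + 2 - i then phi_sign n i * entry A l j else 0)"
    by (rule sum.cong) (use assms in \<open>auto simp: entry_Phi\<close>)
  also have "\<dots> = phi_sign n i * entry A (n + 2 - i) j"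
    using assms by (subst sum.delta) auto
  finally show ?thesis .
qed

text \<open>For \<open>A = g\<^sup>T\<close> this is the condition in \<open>lie_G\<close>.
  Multiplication by the antidiagonal Phi only permutes entries up to sign, so membership in the Lie
  algebra becomes a comparison of two mirrored entries.\<close>

lemma mult_Phi_transpose_eq_0_iff:
  assumes "A \<in> carrier_mat (n + 1) (n + 1)"
  shows "A * Phi n + Phi n * A\<^sup>T = 0\<^sub>m (n + 1) (n + 1) \<longleftrightarrow>
    (\<forall>i\<in>{1..n + 1}. \<forall>j\<in>{1..n + 1}.
      entry A i (n + 2 - j) * phi_sign n (n + 2 - j) + phi_sign n i * entry A j (n + 2 - i) = 0)"
proof -
  have e: "entry (A * Phi n + Phi n * A\<^sup>T) i j =
      entry A i (n + 2 - j) * phi_sign n (n + 2 - j) + phi_sign n i * entry A j (n + 2 - i)"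
    if "i \<in> {1..n + 1}" "j \<in> {1..n + 1}" for i j
  proof -
    have "entry (A * Phi n + Phi n * A\<^sup>T) i j = entry (A * Phi n) i j + entry (Phi n * A\<^sup>T) i j"
      by (rule entry_add[where N = "n + 1"]) (use assms that in \<open>auto intro!: mult_carrier_mat\<close>)
    moreover have "entry A\<^sup>T (n + 2 - i) j = entry A j (n + 2 - i)"
      by (rule entry_transpose) (use assms that in auto)
    ultimately show ?thesis using assms that
      by (simp add: entry_mult_Phi entry_Phi_mult)
  qed
  have c: "A * Phi n + Phi n * A\<^sup>T \<in> carrier_mat (n + 1) (n + 1)"
    using assms by (intro add_carrier_mat mult_carrier_mat[where n = "n + 1"]) auto
  show ?thesis
  proof
    assume "A * Phi n + Phi n * A\<^sup>T = 0\<^sub>m (n + 1) (n + 1)"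
    then show "\<forall>i\<in>{1..n + 1}. \<forall>j\<in>{1..n + 1}.
      entry A i (n + 2 - j) * phi_sign n (n + 2 - j) + phi_sign n i * entry A j (n + 2 - i) = 0"
      using e entry_zero[where ?'a = complex] by metis
  next
    assume "\<forall>i\<in>{1..n + 1}. \<forall>j\<in>{1..n + 1}.
      entry A i (n + 2 - j) * phi_sign n (n + 2 - j) + phi_sign n i * entry A j (n + 2 - i) = 0"
    then show "A * Phi n + Phi n * A\<^sup>T = 0\<^sub>m (n + 1) (n + 1)"
      using e c by (intro mat_eqI_entry[where N = "n + 1"]) (auto simp: entry_zero)
  qed
qed

section \<open>The chart\<close>

definition coord_row :: "nat \<Rightarrow> nat \<Rightarrow> (nat \<times> nat) list" where
  "coord_row n i = map (Pair i)
     [j \<leftarrow> [1..<i + 1]. (i, j) \<noteq> (1, 1) \<and> (if odd n then i + j \<le> n + 2 else i + j < n + 2)]"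

lemma coord_entries_eq: "coord_entries n = concat (map (coord_row n) [1..<n + 2])"
proof -
  have "concat (map (\<lambda>j. if P j then [f j] else []) xs) = map f (filter P xs)"
    for P :: "nat \<Rightarrow> bool" and f :: "nat \<Rightarrow> nat \<times> nat" and xs
    by (induction xs) auto
  then show ?thesis
    unfolding coord_entries_def coord_row_def by (simp del: upt_Suc)
qed

lemma in_coord_entries_iff:
  "(i, j) \<in> set (coord_entries n) \<longleftrightarrow>
     j \<in> {1..i} \<and> i \<le> n + 1 \<and> (i, j) \<noteq> (1, 1) \<and> (if odd n then i + j \<le> n + 2 else i + j < n + 2)"
proof -
  have "(i, j) \<in> set (coord_row n i') \<longleftrightarrow> i' = i \<and> j \<in> {1..i} \<and> (i, j) \<noteq> (1, 1) \<and>
      (if odd n then i + j \<le> n + 2 else i + j < n + 2)" for i'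
    unfolding coord_row_def set_map set_filter set_upt image_iff by fastforce
  then show ?thesis
    unfolding coord_entries_eq set_concat set_map set_upt by auto
qed

lemma distinct_coord_entries: "distinct (coord_entries n)"
proof -
  have "distinct (coord_row n i)" for i
    by (auto simp: coord_row_def distinct_map inj_on_def)
  moreover have "fst e = i" if "e \<in> set (coord_row n i)" for e i
    using that by (auto simp: coord_row_def)
  moreover have "distinct xs \<Longrightarrow> distinct (concat (map (coord_row n) xs))" for xs
  proof (induction xs)
    case (Cons i xs)
    have "e \<notin> set (coord_row n j)" if "e \<in> set (coord_row n i)" "j \<in> set xs" for e j
      using calculation(2) that Cons.prems by (metis distinct.simps(2))
    then have "set (coord_row n i) \<inter> (\<Union>j\<in>set xs. set (coord_row n j)) = {}"
      by blast
    then show ?case using Cons calculation(1) by simp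
  qed simp
  ultimately show ?thesis
    unfolding coord_entries_eq using distinct_upt by presburger
qed

text \<open>Passing from k to k + 1 adds the two antidiagonals i + j = 2k + 2 and i + j = 2k + 3,
  each of which has k + 1 pairs with j <= i. The bound 2k + 1 is the one that both parities of n
  share: n = 2k - 1 with i + j <= n + 2, and n = 2k with i + j < n + 2.\<close>

lemma card_pairs_sum_le:
  "card {(i, j). 1 \<le> j \<and> j \<le> i \<and> i + j \<le> 2 * k + 1} = k * (k + 1)"
proof (induction k)
  case 0
  have "{(i, j). 1 \<le> j \<and> j \<le> i \<and> i + j \<le> 2 * 0 + 1} = ({} :: (nat \<times> nat) set)" by auto
  then show ?case by (simp only: card.empty)
next
  case (Suc k)
  let ?A = "{(i, j). 1 \<le> j \<and> j \<le> i \<and> i + j \<le> 2 * k + 1} :: (nat \<times> nat) set"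
  let ?B = "(\<lambda>j. (2 * k + 2 - j, j)) ` {1..k + 1}"
  let ?C = "(\<lambda>j. (2 * k + 3 - j, j)) ` {1..k + 1}"
  have eq: "{(i, j). 1 \<le> j \<and> j \<le> i \<and> i + j \<le> 2 * Suc k + 1} = ?A \<union> (?B \<union> ?C)"
    by (auto simp: image_iff)
  have fin: "finite ?A"
    by (rule finite_subset[of _ "{..2 * k + 1} \<times> {..2 * k + 1}"]) auto
  have "card (?A \<union> (?B \<union> ?C)) = card ?A + card (?B \<union> ?C)"
    by (rule card_Un_disjoint) (use fin in auto)
  also have "card (?B \<union> ?C) = card ?B + card ?C"
    by (rule card_Un_disjoint) auto
  also have "card ?B = k + 1" by (subst card_image) (auto simp: inj_on_def)
  also have "card ?C = k + 1" by (subst card_image) (auto simp: inj_on_def)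
  finally show ?case using Suc eq by simp
qed

text \<open>The bound i <= n + 1 follows from i + j <= 2k + 1 and j >= 1, so the list enumerates the
  pairs just counted, without (1, 1). The summand 2 stands for the coordinates x and y.\<close>

lemma length_coord_entries:
  assumes "n \<ge> 1"
  shows "length (coord_entries n) + 2 = dim_T n"
proof -
  define k where "k = (if odd n then (n + 1) div 2 else n div 2)"
  let ?A = "{(i, j). 1 \<le> j \<and> j \<le> i \<and> i + j \<le> 2 * k + 1} :: (nat \<times> nat) set"
  have k: "k \<ge> 1" using assms by (auto simp: k_def elim!: oddE evenE)
  have nk: "n = (if odd n then 2 * k - 1 else 2 * k)" by (auto simp: k_def elim!: oddE evenE)
  have "set (coord_entries n) = ?A - {(1, 1)}"
    using nk k by (auto simp: in_coord_entries_iff split: if_splits)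
  moreover have "finite ?A"
    by (rule finite_subset[of _ "{..2 * k + 1} \<times> {..2 * k + 1}"]) auto
  moreover have "(1, 1) \<in> ?A" using k by simp
  ultimately have "card (set (coord_entries n)) = k * (k + 1) - 1"
    by (simp only: card_Diff_singleton card_pairs_sum_le)
  then have len: "length (coord_entries n) = k * (k + 1) - 1"
    using distinct_card[OF distinct_coord_entries] by metis
  have "dim_T n = k * (k + 1) + 1"
  proof (cases "odd n")
    case True
    then obtain l where "n = 2 * l + 1" by (auto elim: oddE)
    then show ?thesis
      by (simp add: dim_T_def k_def algebra_simps)
  next
    case False
    then obtain l where "n = 2 * l" by (auto elim: evenE)
    then show ?thesis
      by (simp add: dim_T_def k_def algebra_simps)
  qed
  moreover have "k * (k + 1) \<ge> 2" using k mult_le_mono[of 1 k 2 "k + 1"] by simp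
  ultimately show ?thesis using len by simp
qed

text \<open>This says that the skipped index n + 2 lies inside the range of the chart. For n = 2 one
  has d = 3 < 4, which is why that chart is the irregular set {1, 2, 4}.\<close>

lemma dim_T_ge:
  assumes "n \<ge> 1" "n \<noteq> 2"
  shows "n + 2 \<le> dim_T n"
proof (cases "odd n")
  case True
  then obtain l where l: "n = 2 * l + 1" by (auto elim: oddE)
  have "(n + 1) * (n + 3) div 4 = (l + 1) * (l + 2)"
    unfolding l by (simp add: algebra_simps)
  then show ?thesis using True l by (simp add: dim_T_def algebra_simps)
next
  case False
  then obtain l where l: "n = 2 * l" by (auto elim: evenE)
  have "n * (n + 2) div 4 = l * (l + 1)"
    unfolding l by (simp add: algebra_simps)
  moreover have "l \<ge> 2" using l assms by auto
  then have "2 * l \<le> l * l" by (rule mult_le_mono1)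
  ultimately have "n * (n + 2) div 4 \<ge> n + l"
    using l by simp
  then show ?thesis using False \<open>l \<ge> 2\<close> by (simp add: dim_T_def)
qed

definition coord_index :: "nat \<Rightarrow> nat \<Rightarrow> nat" where
  "coord_index n j = (if j < n + 2 then j - 2 else j - 3)"

lemma chart_idx_1 [simp]: "1 \<in> chart_idx n"
  by (simp add: chart_idx_def dim_T_def)

lemma chart_idx_n2: "n \<ge> 1 \<Longrightarrow> n + 2 \<in> chart_idx n"
  using dim_T_ge[of n] by (auto simp: chart_idx_def)

lemma coord_index_bij:
  assumes "n \<ge> 1"
  shows "bij_betw (coord_index n) (chart_idx n - {1, n + 2}) {..<length (coord_entries n)}"
proof (cases "n = 2")
  case True
  have "length (coord_entries n) = 1"
    using length_coord_entries[OF assms] True by (simp add: dim_T_def)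
  moreover have "chart_idx n - {1, n + 2} = {2}" using True by (auto simp: chart_idx_def)
  ultimately show ?thesis using True by (auto simp: bij_betw_def coord_index_def)
next
  case False
  have d: "n + 2 \<le> dim_T n" using dim_T_ge assms False by blast
  have len: "length (coord_entries n) = dim_T n - 2"
    using length_coord_entries[OF assms] by simp
  show ?thesis unfolding len
    by (rule bij_betw_byWitness[where f' = "\<lambda>k. if k + 2 < n + 2 then k + 2 else k + 3"])
      (use d assms False in \<open>auto simp: coord_index_def chart_idx_def\<close>)
qed

lemma two_in_chart_idx:
  assumes "n \<ge> 1" shows "2 \<in> chart_idx n"
proof (cases "n = 2")
  case False
  then show ?thesis using dim_T_ge[OF assms False] assms by (auto simp: chart_idx_def)
qed (simp add: chart_idx_def)

lemma coord_entries_0: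
  assumes "n \<ge> 1"
  shows "coord_entries n ! 0 = (2, 1)" "coord_entries n \<noteq> []"
proof -
  have *: "[1..<n + 2] = 1 # 2 # [3..<n + 2]"
    using assms by (simp add: upt_conv_Cons numeral_eq_Suc del: upt_Suc)
  have "[1..<2 + 1] = [1, 2::nat]" by (simp add: numeral_eq_Suc)
  then have "\<exists>xs. coord_row n 2 = (2, 1) # xs"
    using assms by (auto simp: coord_row_def)
  moreover have "coord_row n 1 = []" by (simp add: coord_row_def)
  ultimately show "coord_entries n ! 0 = (2, 1)" "coord_entries n \<noteq> []"
    unfolding coord_entries_eq * by auto
qed

lemma tcoord_1: "tcoord n Om 1 = on_T n Om pt_x"
  and tcoord_n2: "tcoord n Om (n + 2) = on_T n Om pt_y"
  by (simp_all add: tcoord_def)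

lemma tcoord_other:
  assumes "j \<noteq> 1" "j \<noteq> n + 2" "coord_entries n ! coord_index n j = (i, k)"
  shows "tcoord n Om j = S_entry n Om i k"
  using assms by (simp add: tcoord_def coord_index_def)

lemma tcoord_2: "n \<ge> 1 \<Longrightarrow> tcoord n Om 2 = S_entry n Om 2 1"
  using coord_entries_0[of n] by (intro tcoord_other) (auto simp: coord_index_def)

lemma tcoord_cases:
  assumes "n \<ge> 1" "j \<in> chart_idx n"
  obtains "j = 1" "tcoord n Om j = on_T n Om pt_x"
  | "j = n + 2" "tcoord n Om j = on_T n Om pt_y"
  | i k where "(i, k) \<in> set (coord_entries n)" "tcoord n Om j = S_entry n Om i k"
      "j = 2 \<longleftrightarrow> (i, k) = (2, 1)"
proof (cases "j \<in> {1, n + 2}")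
  case True
  then show ?thesis using that(1,2) tcoord_1 tcoord_n2 by blast
next
  case False
  obtain i k where ik: "coord_entries n ! coord_index n j = (i, k)" by fastforce
  have bij: "bij_betw (coord_index n) (chart_idx n - {1, n + 2}) {..<length (coord_entries n)}"
    by (rule coord_index_bij[OF assms(1)])
  then have lt: "coord_index n j < length (coord_entries n)"
    using assms False by (auto dest: bij_betwE)
  have "j = 2 \<longleftrightarrow> coord_index n j = coord_index n 2"
    using inj_on_eq_iff[of "coord_index n" "chart_idx n - {1, n + 2}" j 2]
      bij_betw_imp_inj_on[OF bij] two_in_chart_idx[OF assms(1)] assms False by auto
  also have "coord_index n 2 = 0" by (simp add: coord_index_def)
  also have "coord_index n j = 0 \<longleftrightarrow> coord_entries n ! coord_index n j = coord_entries n ! 0"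
    using lt by (intro nth_eq_iff_index_eq[OF distinct_coord_entries, symmetric]) auto
  finally have "j = 2 \<longleftrightarrow> (i, k) = (2, 1)" using ik coord_entries_0[OF assms(1)] by simp
  moreover have "(i, k) \<in> set (coord_entries n)" using lt ik by (metis nth_mem)
  ultimately show ?thesis using that(3) tcoord_other False ik by blast
qed

lemma coord_entry_inj:
  assumes "n \<ge> 1" "j \<in> chart_idx n - {1, n + 2}" "j' \<in> chart_idx n - {1, n + 2}"
    and "coord_entries n ! coord_index n j = coord_entries n ! coord_index n j'"
  shows "j = j'"
proof -
  note bij = coord_index_bij[OF assms(1)]
  have "coord_index n j < length (coord_entries n)" "coord_index n j' < length (coord_entries n)"
    using bij assms(2,3) by (auto dest: bij_betwE)
  then have "coord_index n j = coord_index n j'"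
    using assms(4) nth_eq_iff_index_eq[OF distinct_coord_entries] by blast
  then show ?thesis using inj_onD[OF bij_betw_imp_inj_on[OF bij]] assms(2,3) by blast
qed

lemma S_entry_is_tcoord:
  assumes "n \<ge> 1" "(i, k) \<in> set (coord_entries n)"
  obtains j where "j \<in> chart_idx n" "tcoord n Om j = S_entry n Om i k"
proof -
  obtain l where l: "l < length (coord_entries n)" "coord_entries n ! l = (i, k)"
    using assms(2) by (auto simp: in_set_conv_nth)
  have "l \<in> coord_index n ` (chart_idx n - {1, n + 2})"
    using coord_index_bij[OF assms(1)] l(1) by (simp add: bij_betw_def)
  then obtain j where "j \<in> chart_idx n - {1, n + 2}" "coord_index n j = l" by blast
  then show ?thesis using that[of j] tcoord_other[of j] l by auto
qed

text \<open>
  For odd \<open>n \<ge> 3\<close> the last coordinate is \<open>s\<^sub>n\<^sub>+\<^sub>1\<^sub>,\<^sub>1\<close> and \<open>t\<^sub>d\<^sub>-\<^sub>2\<close> (\<open>t\<^sub>4\<close> if \<open>n = 3\<close>, because of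
  the gap in the numbering) is \<open>s\<^sub>n\<^sub>1\<close>.
\<close>

lemma chart_modified:
  assumes "odd n" "n \<ge> 3"
  shows "chart Option1 n Om (dim_T n) =
    S_entry n Om (n + 1) 1 + S_entry n Om 2 1 * S_entry n Om n 1"
    and "tcoord n Om (dim_T n) = S_entry n Om (n + 1) 1"
    and "\<exists>j\<in>chart_idx n - {dim_T n}. tcoord n Om j = S_entry n Om n 1"
    and "dim_T n \<noteq> 2" "dim_T n \<in> chart_idx n - {1, n + 2}"
    and "coord_entries n ! coord_index n (dim_T n) = (n + 1, 1)"
proof -
  obtain xs where xs: "coord_entries n = xs @ [(n, 1), (n, 2), (n + 1, 1)]"
  proof -
    have "[1..<n + 2] = [1..<n] @ [n, n + 1]" using assms
      by (simp add: upt_Suc_append)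
    moreover have "[1..<n + 1] = 1 # 2 # [3..<n + 1]" "[1..<n + 1 + 1] = 1 # 2 # [3..<n + 1 + 1]"
      using assms by (simp_all add: upt_conv_Cons numeral_eq_Suc del: upt_Suc)
    then have "coord_row n n = [(n, 1), (n, 2)]" "coord_row n (n + 1) = [(n + 1, 1)]"
      using assms by (auto simp: coord_row_def filter_empty_conv simp del: upt_Suc)
    ultimately show ?thesis using that by (simp add: coord_entries_eq)
  qed
  define d where "d = dim_T n"
  have len: "length xs + 5 = d"
    using length_coord_entries[of n] xs assms by (simp add: d_def)
  \<comment> \<open>The entry \<open>s n 1\<close> is the third from the end of the list. For n >= 5
    the gap n + 2 lies before it, so its index is d - 2; for n = 3 the gap 5 lies between it and the
    end, so its index is 4.\<close>
  have d: "d = 7 \<and> n = 3 \<or> d \<ge> n + 5 \<and> n \<ge> 5"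
  proof (cases "n = 3")
    case False
    obtain l where l: "n = 2 * l + 1" using assms by (auto elim: oddE)
    then have "(n + 1) * (n + 3) div 4 = (l + 1) * (l + 2)"
      by (simp add: algebra_simps)
    moreover have l2: "l \<ge> 2" using l assms False by auto
    then have "2 * l \<le> l * l" by (rule mult_le_mono1)
    ultimately have "(n + 1) * (n + 3) div 4 \<ge> 5 * l + 2"
      by simp
    then show ?thesis using l l2 assms by (simp add: d_def dim_T_def)
  qed (simp add: d_def dim_T_def)
  have nth: "coord_entries n ! coord_index n d = (n + 1, 1)"
    using xs len d by (auto simp: coord_index_def nth_append)
  have td: "tcoord n Om d = S_entry n Om (n + 1) 1"
    by (rule tcoord_other[OF _ _ nth]) (use d in auto)
  moreover have sn: "tcoord n Om (if n = 3 then 4 else d - 2) = S_entry n Om n 1"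
  proof (rule tcoord_other)
    show "coord_entries n ! coord_index n (if n = 3 then 4 else d - 2) = (n, 1)"
      using xs len d by (auto simp: coord_index_def nth_append)
  qed (use d in auto)
  moreover have "tcoord n Om 2 = S_entry n Om 2 1" by (rule tcoord_2) (use assms in simp)
  ultimately show "chart Option1 n Om (dim_T n) =
    S_entry n Om (n + 1) 1 + S_entry n Om 2 1 * S_entry n Om n 1"
    "tcoord n Om (dim_T n) = S_entry n Om (n + 1) 1"
    using assms d by (auto simp: chart_def d_def split: if_splits)
  show "\<exists>j\<in>chart_idx n - {dim_T n}. tcoord n Om j = S_entry n Om n 1"
    using sn d assms
    by (intro bexI[of _ "if n = 3 then 4 else d - 2"]) (auto simp: chart_idx_def d_def)
  show "dim_T n \<noteq> 2" using d by (auto simp: d_def)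
  show "dim_T n \<in> chart_idx n - {1, n + 2}" using d assms by (auto simp: d_def chart_idx_def)
  show "coord_entries n ! coord_index n (dim_T n) = (n + 1, 1)" using nth by (simp add: d_def)
qed

section \<open>The moduli space is not empty\<close>

text \<open>
  A Gram--Schmidt process that peels off the first and the last vector of the flag: the first one
  stays, the inner ones are made orthogonal to the last one by adding multiples of the first one,
  and so is the last one itself.  Taking the \<open>W i\<close> arbitrary saves the bookkeeping of
  coefficients in the induction.
\<close>

lemma antitriangular_form_normal_basis:
  fixes b :: "'v \<Rightarrow> 'v \<Rightarrow> complex" and comb :: "complex \<Rightarrow> 'v \<Rightarrow> complex \<Rightarrow> 'v \<Rightarrow> 'v"
    and \<epsilon> :: complex and e :: "nat \<Rightarrow> 'v" and P :: "nat \<Rightarrow> nat \<Rightarrow> complex" and W :: "nat \<Rightarrow> 'v set"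
  assumes lin: "\<And>p u q w v. b (comb p u q w) v = p * b u v + q * b w v"
    and sym: "\<And>u v. b u v = \<epsilon> * b v u"
    and \<epsilon>: "\<epsilon> = 1 \<or> \<epsilon> = - 1"
    and "\<And>i. i < N \<Longrightarrow> e i \<in> W i"
    and "\<And>i. W i \<subseteq> W (Suc i)"
    and "\<And>i p u q w. u \<in> W i \<Longrightarrow> w \<in> W i \<Longrightarrow> comb p u q w \<in> W i"
    and "\<And>i j. i + j + 1 < N \<Longrightarrow> b (e i) (e j) = 0"
    and "\<And>i j. i + j + 1 = N \<Longrightarrow> b (e i) (e j) \<noteq> 0"
    and "\<And>i j. i < N \<Longrightarrow> j < N \<Longrightarrow> i + j + 1 \<noteq> N \<Longrightarrow> P i j = 0"
    and "\<And>i j. P i j = \<epsilon> * P j i"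
  shows "\<exists>v. (\<forall>i<N. v i \<in> W i) \<and> (\<forall>i<N. \<forall>j<N. b (v i) (v j) = P i j) \<and> (N \<ge> 2 \<longrightarrow> v 0 = e 0)"
proof -
  have linr: "b v (comb p u q w) = p * b v u + q * b v w" for p u q w v
  proof -
    have "b v (comb p u q w) = \<epsilon> * b (comb p u q w) v" by (rule sym)
    also have "\<dots> = p * (\<epsilon> * b u v) + q * (\<epsilon> * b w v)" by (simp add: lin algebra_simps)
    also have "\<dots> = p * b v u + q * b v w" by (simp only: sym[symmetric])
    finally show ?thesis .
  qed
  show ?thesis using assms(4-)
  \<comment> \<open>Each step removes two vectors, hence the induction in steps of two with
    one-dimensional and empty base cases.\<close>
  proof (induction N arbitrary: e P W rule: induct_nat_012)
    case 0
    show ?case by simp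
  next
    case 1
    \<comment> \<open>A single vector can only be rescaled, so here the first vector is not kept;
      over the complex numbers the square root exists.\<close>
    define r where "r = csqrt (P 0 0 / b (e 0) (e 0))"
    have "r * r = P 0 0 / b (e 0) (e 0)" unfolding r_def by (metis power2_csqrt power2_eq_square)
    then have "b (comb r (e 0) 0 (e 0)) (comb r (e 0) 0 (e 0)) = P 0 0"
      using 1(5)[of 0 0] by (simp add: lin linr field_simps)
    moreover have "comb r (e 0) 0 (e 0) \<in> W 0" by (intro 1(1,3)) auto
    ultimately show ?case by (intro exI[of _ "\<lambda>_. comb r (e 0) 0 (e 0)"]) simp
  next
    case (ge2 N)
    note eW = ge2.prems(1) and Wmono = ge2.prems(2) and Wcl = ge2.prems(3) and z = ge2.prems(4)
      and nz = ge2.prems(5) and P0 = ge2.prems(6) and Psym = ge2.prems(7)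
    have W0: "W 0 \<subseteq> W i" for i
      by (induction i) (use Wmono in blast)+
    define a where "a = b (e 0) (e (Suc N))"
    have a: "a \<noteq> 0" "b (e (Suc N)) (e 0) \<noteq> 0" unfolding a_def by (rule nz; simp)+
    \<comment> \<open>The first vector is isotropic and orthogonal to all inner ones, so adding
      multiples of it changes neither the products among inner vectors nor their orthogonality to
      it.\<close>
    define e' where "e' i = comb 1 (e (Suc i)) (- b (e (Suc i)) (e (Suc N)) / a) (e 0)" for i
    \<comment> \<open>Orthogonality to both removed vectors is made part of the subspaces, so that
      the induction hypothesis returns an inner basis that is still orthogonal to them.\<close>
    define W' where "W' i = {u \<in> W (Suc i). b u (e 0) = 0 \<and> b u (e (Suc N)) = 0}" for i
    have e0: "b (e 0) (e 0) = 0" "\<And>i. i < N \<Longrightarrow> b (e 0) (e (Suc i)) = 0"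
      "\<And>i. i < N \<Longrightarrow> b (e (Suc i)) (e 0) = 0"
      by (rule z; simp)+
    have e'W: "e' i \<in> W' i" if "i < N" for i
    proof -
      have "e' i \<in> W (Suc i)"
        unfolding e'_def using that W0 eW[of 0] eW[of "Suc i"] by (intro Wcl) auto
      then show ?thesis using a that e0 by (simp add: W'_def e'_def lin a_def)
    qed
    have e'b: "b (e' i) (e' j) = b (e (Suc i)) (e (Suc j))" if "i < N" "j < N" for i j
      using that e0 by (simp add: e'_def lin linr)
    have "\<exists>v. (\<forall>i<N. v i \<in> W' i) \<and> (\<forall>i<N. \<forall>j<N. b (v i) (v j) = P (Suc i) (Suc j)) \<and>
        (N \<ge> 2 \<longrightarrow> v 0 = e' 0)"
    proof (rule ge2.IH(1))
      show "W' i \<subseteq> W' (Suc i)" for i using Wmono by (auto simp: W'_def)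
      show "comb p u q w \<in> W' i" if "u \<in> W' i" "w \<in> W' i" for i p u q w
        using that Wcl by (auto simp: W'_def lin)
      show "b (e' i) (e' j) = 0" if "i + j + 1 < N" for i j
        using that e'b[of i j] z[of "Suc i" "Suc j"] by simp
      show "b (e' i) (e' j) \<noteq> 0" if "i + j + 1 = N" for i j
        using that e'b[of i j] nz[of "Suc i" "Suc j"] by simp
      show "P (Suc i) (Suc j) = 0" if "i < N" "j < N" "i + j + 1 \<noteq> N" for i j
        using that P0[of "Suc i" "Suc j"] by simp
      show "P (Suc i) (Suc j) = \<epsilon> * P (Suc j) (Suc i)" for i j by (rule Psym)
    qed (use e'W in auto)
    then obtain v' where v'W: "\<And>i. i < N \<Longrightarrow> v' i \<in> W' i"
      and v'b: "\<And>i j. i < N \<Longrightarrow> j < N \<Longrightarrow> b (v' i) (v' j) = P (Suc i) (Suc j)"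
      by blast
    \<comment> \<open>The coefficient \<alpha> normalises the product with the first vector. The
      coefficient \<beta> makes the new last vector isotropic in the symmetric case; in the
      alternating case isotropy is automatic and \<beta> is 0.\<close>
    define \<alpha> where "\<alpha> = P 0 (Suc N) / a"
    define \<beta> where "\<beta> = - \<alpha> * b (e (Suc N)) (e (Suc N)) / (2 * a)"
    define l where "l = comb \<alpha> (e (Suc N)) \<beta> (e 0)"
    define v where "v i = (if i = 0 then e 0 else if i = Suc N then l else v' (i - 1))" for i
    have v0: "v 0 = e 0" and vl: "v (Suc N) = l" and vm: "\<And>i. i < N \<Longrightarrow> v (Suc i) = v' i"
      by (auto simp: v_def)
    have lW: "l \<in> W (Suc N)" unfolding l_def using W0 eW[of 0] eW[of "Suc N"] by (intro Wcl) auto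
    have m0: "b (v' i) (e 0) = 0" "b (v' i) (e (Suc N)) = 0" if "i < N" for i
      using v'W[OF that] by (auto simp: W'_def)
    have b00: "b (e 0) (e 0) = P 0 0" using e0(1) P0[of 0 0] by simp
    have b0m: "b (e 0) (v' i) = P 0 (Suc i)" if "i < N" for i
      using sym[of "e 0" "v' i"] m0[OF that] P0[of 0 "Suc i"] that by simp
    have b0l: "b (e 0) l = P 0 (Suc N)"
      using a e0 by (simp add: l_def linr \<alpha>_def a_def[symmetric])
    have bml: "b (v' i) l = P (Suc i) (Suc N)" if "i < N" for i
      using m0[OF that] P0[of "Suc i" "Suc N"] that by (simp add: l_def linr)
    have bll: "b l l = P (Suc N) (Suc N)"
    proof -
      have "b l l = \<alpha> * (\<alpha> * b (e (Suc N)) (e (Suc N)) + \<beta> * a * (1 + \<epsilon>))"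
        using e0(1) sym[of "e (Suc N)" "e 0"] by (simp add: l_def lin linr a_def algebra_simps)
      moreover have "\<alpha> * b (e (Suc N)) (e (Suc N)) + \<beta> * a * (1 + \<epsilon>) = 0"
        using \<epsilon>
      proof
        assume "\<epsilon> = 1"
        then show ?thesis using a by (simp add: \<beta>_def field_simps)
      next
        assume "\<epsilon> = - 1"
        then have "b (e (Suc N)) (e (Suc N)) = 0"
          using sym[of "e (Suc N)" "e (Suc N)"] by simp
        then show ?thesis by (simp add: \<beta>_def)
      qed
      ultimately show ?thesis using P0[of "Suc N" "Suc N"] by simp
    qed
    have *: "b (v i) (v j) = P i j" if ij: "i \<le> j" "j < Suc (Suc N)" for i j
    proof -
      consider "i = 0" "j = 0" | "i = 0" "j = Suc N" | j' where "i = 0" "j = Suc j'" "j' < N"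
        | i' j' where "i = Suc i'" "i' < N" "j = Suc j'" "j' < N"
        | i' where "i = Suc i'" "i' < N" "j = Suc N" | "i = Suc N" "j = Suc N"
        using ij by (cases i; cases j) (auto simp: less_Suc_eq le_less)
      then show ?thesis
        by cases (simp_all add: v0 vl vm b00 b0l b0m v'b bml bll)
    qed
    have "b (v i) (v j) = P i j" if "i < Suc (Suc N)" "j < Suc (Suc N)" for i j
    proof (cases "i \<le> j")
      case False
      then have "b (v j) (v i) = P j i" using that by (intro *) auto
      then show ?thesis by (subst sym, subst Psym) (rule arg_cong)
    qed (use that * in blast)
    moreover have "v i \<in> W i" if i: "i < Suc (Suc N)" for i
    proof -
      consider "i = 0" | i' where "i = Suc i'" "i' < N" | "i = Suc N"
        using i by (cases i) (auto simp: less_Suc_eq)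
      then show ?thesis
        by cases (use eW[of 0] lW v'W in \<open>auto simp: v0 vl vm W'_def\<close>)
    qed
    ultimately show ?case using v0 by blast
  qed
qed

lemma entry_congruence:
  assumes "S \<in> carrier_mat N N" "A \<in> carrier_mat N N" "i \<in> {1..N}" "j \<in> {1..N}"
  shows "entry (S * A * S\<^sup>T) i j =
    (\<Sum>k = 1..N. \<Sum>l = 1..N. entry S i k * entry A k l * entry S j l)"
proof -
  have "entry (S * A * S\<^sup>T) i j = (\<Sum>l = 1..N. entry (S * A) i l * entry S j l)"
    using assms by (subst entry_mult[where N = N]) (auto simp: entry_transpose intro!: sum.cong)
  also have "\<dots> = (\<Sum>l = 1..N. \<Sum>k = 1..N. entry S i k * entry A k l * entry S j l)"
    using assms by (intro sum.cong) (auto simp: entry_mult sum_distrib_right)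
  finally show ?thesis by (subst sum.swap)
qed

lemma Phi_mult_Phi: "Phi n * Phi n = (- 1) ^ n \<cdot>\<^sub>m 1\<^sub>m (n + 1)"
proof (rule mat_eqI_entry[where N = "n + 1"])
  show "Phi n * Phi n \<in> carrier_mat (n + 1) (n + 1)"
    by (intro mult_carrier_mat[where n = "n + 1"]) auto
  fix i j assume ij: "i \<in> {1..n + 1}" "j \<in> {1..n + 1}"
  have s: "phi_sign n k * phi_sign n k = 1" for k by (simp add: phi_sign_def)
  have "entry (1\<^sub>m (n + 1)) i j = (if i = j then 1 else 0 :: complex)"
    using ij by (auto simp: entry_def)
  moreover have "entry (Phi n) i (n + 2 - j) = (if i = j then phi_sign n i else 0)"
    using ij by (subst entry_Phi) auto
  ultimately show "entry (Phi n * Phi n) i j = entry ((- 1) ^ n \<cdot>\<^sub>m 1\<^sub>m (n + 1)) i j"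
    using ij s phi_sign_reflect[of j n]
    by (simp add: entry_mult_Phi entry_smult[where N = "n + 1"])
qed auto

text \<open>The congruence exhibits \<open>A * S\<^sup>T\<close> as a right inverse of S up to Phi,
  and Phi is its own inverse up to sign. So invertibility never has to be tracked separately when
  points of T are built.\<close>

lemma congruent_Phi_invertible:
  assumes S: "S \<in> carrier_mat (n + 1) (n + 1)" and A: "A \<in> carrier_mat (n + 1) (n + 1)"
    and eq: "S * A * S\<^sup>T = Phi n"
  shows "invertible_mat S"
proof -
  define B where "B = (- 1) ^ n \<cdot>\<^sub>m ((A * S\<^sup>T) * Phi n)"
  have AS: "A * S\<^sup>T \<in> carrier_mat (n + 1) (n + 1)"
    using S A by (intro mult_carrier_mat[where n = "n + 1"]) auto
  have B: "B \<in> carrier_mat (n + 1) (n + 1)"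
    unfolding B_def by (intro smult_carrier_mat mult_carrier_mat[OF AS Phi_carrier])
  have "S * B = (- 1) ^ n \<cdot>\<^sub>m (S * ((A * S\<^sup>T) * Phi n))"
    unfolding B_def by (rule mult_smult_distrib[OF S]) (rule mult_carrier_mat[OF AS Phi_carrier])
  also have "S * ((A * S\<^sup>T) * Phi n) = (S * (A * S\<^sup>T)) * Phi n"
    by (rule assoc_mult_mat[symmetric, OF S AS Phi_carrier])
  also have "S * (A * S\<^sup>T) = Phi n"
    unfolding eq[symmetric] using S A
    by (intro assoc_mult_mat[symmetric, where ?n\<^sub>1 = "n + 1" and ?n\<^sub>2 = "n + 1" and ?n\<^sub>3 = "n + 1"]) auto
  also have "(- 1) ^ n \<cdot>\<^sub>m (Phi n * Phi n) = 1\<^sub>m (n + 1)"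
    unfolding Phi_mult_Phi by (rule eq_matI) (auto simp flip: power_mult_distrib)
  finally have "S * B = 1\<^sub>m (n + 1)" .
  moreover from this have "B * S = 1\<^sub>m (n + 1)"
    by (rule mat_mult_left_right_inverse[OF S B])
  ultimately show ?thesis
    using S B by (auto simp: invertible_mat_def inverts_mat_def)
qed

locale dwork_family =
  fixes n :: nat and c :: complex and Om :: "complex \<Rightarrow> complex \<Rightarrow> complex mat"
  assumes n_pos: "n \<ge> 1" and c_nz: "c \<noteq> 0" and intersection: "is_intersection_matrix n c Om"
begin

context
  fixes x y :: complex
  assumes xy: "(x, y) \<in> base n"
begin

lemma Om_carrier: "Om x y \<in> carrier_mat (n + 1) (n + 1)"
  using intersection xy by (auto simp: is_intersection_matrix_def)

lemma Om_sym:
  assumes "i \<in> {1..n + 1}" "j \<in> {1..n + 1}"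
  shows "entry (Om x y) i j = (- 1) ^ n * entry (Om x y) j i"
proof -
  have "(Om x y)\<^sup>T = (- 1) ^ n \<cdot>\<^sub>m Om x y"
    using intersection xy by (auto simp: is_intersection_matrix_def)
  then have "entry (Om x y)\<^sup>T j i = entry ((- 1) ^ n \<cdot>\<^sub>m Om x y) j i" by simp
  then show ?thesis using assms Om_carrier
    by (simp add: entry_transpose[where N = "n + 1"] entry_smult[where N = "n + 1"])
qed

lemma Om_zero:
  assumes "i \<in> {1..n + 1}" "j \<in> {1..n + 1}" "i + j \<le> n + 1"
  shows "entry (Om x y) i j = 0"
  using intersection xy assms by (auto simp: is_intersection_matrix_def)

lemma Om_antidiag:
  assumes "j \<in> {1..n + 1}"
  shows "entry (Om x y) j (n + 2 - j) =
    (- 1) ^ (j - 1) * ((- of_nat (n + 2)) ^ n * (c / (x ^ (n + 2) - y)))"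
  using intersection xy assms by (auto simp: is_intersection_matrix_def)

lemma Om_antidiag_nz:
  assumes "j \<in> {1..n + 1}"
  shows "entry (Om x y) j (n + 2 - j) \<noteq> 0"
proof -
  have "x ^ (n + 2) - y \<noteq> 0" using xy by (auto simp: base_def)
  moreover have "(of_nat (n + 2) :: complex) \<noteq> 0" by (simp only: of_nat_eq_0_iff)
  ultimately show ?thesis unfolding Om_antidiag[OF assms] using c_nz
    by (simp del: of_nat_add of_nat_Suc power_Suc)
qed

text \<open>The rows of S are vectors for the bilinear form with matrix Omega. Keeping them in the
  standard flag makes S lower triangular, and keeping the first one, possible because n + 1 >= 2,
  gives S the upper left entry 1.\<close>

lemma ex_point_over: "\<exists>S. Point x y S \<in> T n Om"
proof -
  define N where "N = n + 1"
  define b where "b u v = (\<Sum>k = 1..N. \<Sum>l = 1..N. u k * entry (Om x y) k l * v l)"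
    for u v :: "nat \<Rightarrow> complex"
  define e :: "nat \<Rightarrow> nat \<Rightarrow> complex" where "e i k = (if k = i + 1 then 1 else 0)" for i k
  define P where "P i j = (if i < N \<and> j < N then entry (Phi n) (i + 1) (j + 1) else 0)" for i j
  have be: "b (e i) (e j) = entry (Om x y) (i + 1) (j + 1)" if "i < N" "j < N" for i j
  proof -
    have "b (e i) (e j) =
        (\<Sum>k = 1..N. \<Sum>l = 1..N. if k = i + 1 then if l = j + 1 then entry (Om x y) k l else 0 else 0)"
      unfolding b_def e_def by (intro sum.cong refl) simp
    also have "\<dots> =
        (\<Sum>k = 1..N. if k = i + 1 then (\<Sum>l = 1..N. if l = j + 1 then entry (Om x y) k l else 0) else 0)"
      by (intro sum.cong refl) simp
    also have "\<dots> = entry (Om x y) (i + 1) (j + 1)"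
      using that by (subst sum.delta, simp, subst sum.delta) auto
    finally show ?thesis .
  qed
  have "\<exists>v. (\<forall>i<N. v i \<in> {u. \<forall>k>i + 1. u k = 0}) \<and> (\<forall>i<N. \<forall>j<N. b (v i) (v j) = P i j) \<and>
      (N \<ge> 2 \<longrightarrow> v 0 = e 0)"
  proof (rule antitriangular_form_normal_basis[where \<epsilon> = "(- 1) ^ n" and
        comb = "\<lambda>p u q w k. p * u k + q * w k"])
    show "b (\<lambda>k. p * u k + q * w k) v = p * b u v + q * b w v" for p u q w v
      by (simp add: b_def sum_distrib_left sum.distrib[symmetric] algebra_simps)
    show "b u v = (- 1) ^ n * b v u" for u v
    proof -
      have "b u v = (\<Sum>l = 1..N. \<Sum>k = 1..N. u k * entry (Om x y) k l * v l)"
        unfolding b_def by (rule sum.swap)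
      also have "\<dots> = (\<Sum>l = 1..N. \<Sum>k = 1..N. (- 1) ^ n * (v l * entry (Om x y) l k * u k))"
      proof (intro sum.cong refl)
        fix l k assume "l \<in> {1..N}" "k \<in> {1..N}"
        then show "u k * entry (Om x y) k l * v l = (- 1) ^ n * (v l * entry (Om x y) l k * u k)"
          by (subst Om_sym) (auto simp: N_def)
      qed
      finally show ?thesis by (simp add: b_def sum_distrib_left)
    qed
    show "(- 1) ^ n = (1::complex) \<or> (- 1) ^ n = (- 1::complex)" by (cases "odd n") auto
    show "b (e i) (e j) = 0" if "i + j + 1 < N" for i j
      using that by (simp add: be) (rule Om_zero, auto simp: N_def)
    show "b (e i) (e j) \<noteq> 0" if "i + j + 1 = N" for i j
    proof -
      have "j + 1 = n + 2 - (i + 1)" using that by (simp add: N_def)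
      then have "entry (Om x y) (i + 1) (j + 1) = entry (Om x y) (i + 1) (n + 2 - (i + 1))"
        by (rule arg_cong)
      moreover have "entry (Om x y) (i + 1) (n + 2 - (i + 1)) \<noteq> 0"
        by (rule Om_antidiag_nz) (use that in \<open>auto simp: N_def\<close>)
      ultimately show ?thesis using that by (simp add: be)
    qed
    show "P i j = 0" if "i < N" "j < N" "i + j + 1 \<noteq> N" for i j
      using that by (simp add: P_def entry_Phi N_def)
    show "P i j = (- 1) ^ n * P j i" for i j
    proof (cases "i < N \<and> j < N \<and> i + j = n")
      case True
      then have "n + 2 - (j + 1) = i + 1" by linarith
      with True show ?thesis using True phi_sign_reflect[of "j + 1" n]
        by (simp add: P_def entry_Phi N_def)
    qed (auto simp: P_def entry_Phi N_def)
  qed (auto simp: e_def)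
  then obtain v where v': "\<forall>i<N. v i \<in> {u. \<forall>k>i + 1. u k = 0}"
      "\<forall>i<N. \<forall>j<N. b (v i) (v j) = P i j" "N \<ge> 2 \<longrightarrow> v 0 = e 0"
    by blast
  have v: "\<And>i k. i < N \<Longrightarrow> k > i + 1 \<Longrightarrow> v i k = 0"
      "\<And>i j. i < N \<Longrightarrow> j < N \<Longrightarrow> b (v i) (v j) = P i j" "v 0 = e 0"
    using v' n_pos by (auto simp: N_def)
  define S where "S = mat1 N (\<lambda>i k. v (i - 1) k)"
  have S: "S \<in> carrier_mat (n + 1) (n + 1)" by (simp add: S_def N_def)
  have "S * Om x y * S\<^sup>T = Phi n"
  proof (rule mat_eqI_entry[where N = "n + 1"])
    show "S * Om x y * S\<^sup>T \<in> carrier_mat (n + 1) (n + 1)"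
      using S Om_carrier by (intro mult_carrier_mat[where n = "n + 1"]) auto
    fix i j assume ij: "i \<in> {1..n + 1}" "j \<in> {1..n + 1}"
    have "entry (S * Om x y * S\<^sup>T) i j = b (v (i - 1)) (v (j - 1))"
      using ij S Om_carrier unfolding b_def N_def
      by (subst entry_congruence) (auto intro!: sum.cong simp: S_def N_def)
    then show "entry (S * Om x y * S\<^sup>T) i j = entry (Phi n) i j"
      using ij v(2)[of "i - 1" "j - 1"] by (auto simp: P_def N_def)
  qed auto
  moreover from this have "invertible_mat S"
    by (rule congruent_Phi_invertible[OF S Om_carrier])
  moreover have "upper_triangular S\<^sup>T"
    using v(1) by (intro upper_triangularI) (auto simp: S_def mat1_def)
  moreover have "entry S 1 1 = 1"
    using v(3) by (simp add: S_def N_def e_def)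
  ultimately show ?thesis using xy S by (auto simp: T_def)
qed

end

lemma T_nonempty: "T n Om \<noteq> {}"
  using ex_point_over[of 0 1] by (auto simp: base_def)

end

section \<open>Regular functions\<close>

text \<open>The ring C[x, y, 1/(x^(n+2) - y)]. It contains the entries of \<open>B1\<close> and is
  stable under d/dx, which is what the recursion for the rows of Omega asks for.\<close>

inductive_set base_functions :: "nat \<Rightarrow> (complex \<Rightarrow> complex \<Rightarrow> complex) set" for n where
  const: "(\<lambda>x y. a) \<in> base_functions n"
| fst: "(\<lambda>x y. x) \<in> base_functions n"
| snd: "(\<lambda>x y. y) \<in> base_functions n"
| inv: "(\<lambda>x y. 1 / (x ^ (n + 2) - y)) \<in> base_functions n"
| add: "f \<in> base_functions n \<Longrightarrow> g \<in> base_functions n \<Longrightarrow> (\<lambda>x y. f x y + g x y) \<in> base_functions n"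
| mult: "f \<in> base_functions n \<Longrightarrow> g \<in> base_functions n \<Longrightarrow> (\<lambda>x y. f x y * g x y) \<in> base_functions n"

lemma base_functions_power:
  "f \<in> base_functions n \<Longrightarrow> (\<lambda>x y. f x y ^ k) \<in> base_functions n"
  by (induction k) (auto intro: base_functions.intros)

lemma base_functions_cmult: "f \<in> base_functions n \<Longrightarrow> (\<lambda>x y. a * f x y) \<in> base_functions n"
  by (intro base_functions.intros)

lemma base_functions_diff:
  assumes "f \<in> base_functions n" "g \<in> base_functions n"
  shows "(\<lambda>x y. f x y - g x y) \<in> base_functions n"
  using base_functions.add[OF assms(1) base_functions_cmult[OF assms(2), of "- 1"]] by simp

lemma base_functions_sum:
  assumes "\<And>l. l \<in> A \<Longrightarrow> f l \<in> base_functions n"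
  shows "(\<lambda>x y. \<Sum>l\<in>A. f l x y) \<in> base_functions n"
  using assms by (induction A rule: infinite_finite_induct) (auto intro: base_functions.intros)

lemma base_functions_deriv:
  assumes "f \<in> base_functions n"
  shows "\<exists>g\<in>base_functions n. \<forall>(x, y)\<in>base n. ((\<lambda>x'. f x' y) has_field_derivative g x y) (at x)"
  using assms
proof induction
  case (const a)
  show ?case by (rule bexI[of _ "\<lambda>x y. 0"]) (auto intro: base_functions.const)
next
  case fst
  show ?case by (rule bexI[of _ "\<lambda>x y. 1"]) (auto intro: base_functions.const)
next
  case snd
  show ?case by (rule bexI[of _ "\<lambda>x y. 0"]) (auto intro: base_functions.const)
next
  case inv
  let ?q = "\<lambda>x y. 1 / (x ^ (n + 2) - y) :: complex"
  let ?g = "\<lambda>x y. - of_nat (n + 2) * (x ^ (n + 1) * (?q x y * ?q x y))"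
  have "?g \<in> base_functions n"
    by (intro base_functions_cmult base_functions.mult base_functions_power base_functions.fst
        base_functions.inv)
  moreover have "((\<lambda>x'. ?q x' y) has_field_derivative ?g x y) (at x)" if "(x, y) \<in> base n" for x y
  proof -
    have nz: "x ^ (n + 2) - y \<noteq> 0" using that by (auto simp: base_def)
    have "((\<lambda>x'. x' ^ (n + 2) - y) has_field_derivative of_nat (n + 2) * x ^ (n + 1)) (at x)"
      by (auto intro!: derivative_eq_intros simp del: power_Suc)
    from DERIV_inverse'[OF this nz] show ?thesis
      by (simp add: divide_inverse algebra_simps del: power_Suc)
  qed
  ultimately show ?case by (intro bexI[of _ ?g]) fast+
next
  case (add f1 f2)
  then obtain g1 g2 where g: "g1 \<in> base_functions n" "g2 \<in> base_functions n"
    "\<forall>(x, y)\<in>base n. ((\<lambda>x'. f1 x' y) has_field_derivative g1 x y) (at x)"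
    "\<forall>(x, y)\<in>base n. ((\<lambda>x'. f2 x' y) has_field_derivative g2 x y) (at x)" by blast
  show ?case
    by (rule bexI[OF _ base_functions.add[OF g(1,2)]]) (use g(3,4) in \<open>fast intro: DERIV_add\<close>)
next
  case (mult f1 f2)
  then obtain g1 g2 where g: "g1 \<in> base_functions n" "g2 \<in> base_functions n"
    "\<forall>(x, y)\<in>base n. ((\<lambda>x'. f1 x' y) has_field_derivative g1 x y) (at x)"
    "\<forall>(x, y)\<in>base n. ((\<lambda>x'. f2 x' y) has_field_derivative g2 x y) (at x)" by blast
  have "(\<lambda>x y. g1 x y * f2 x y + g2 x y * f1 x y) \<in> base_functions n"
    using g(1,2) mult.hyps by (intro base_functions.intros)
  moreover have "((\<lambda>x'. f1 x' y * f2 x' y) has_field_derivative g1 x y * f2 x y + g2 x y * f1 x y) (at x)"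
    if "(x, y) \<in> base n" for x y
    using g(3,4) that by (intro DERIV_mult) auto
  ultimately show ?case
    by (intro bexI[of _ "\<lambda>x y. g1 x y * f2 x y + g2 x y * f1 x y"]) fast+
qed

lemma B1_base_function:
  assumes "i \<in> {1..n + 1}" "j \<in> {1..n + 1}"
  shows "(\<lambda>x y. entry (B1 n x y) i j) \<in> base_functions n"
proof (cases "i \<le> n")
  case True
  then show ?thesis using assms by (auto simp: B1_def intro: base_functions.const)
next
  case False
  have "(\<lambda>x y. - of_nat (Stirling (n + 2) j) * (x ^ j * (1 / (x ^ (n + 2) - y)))) \<in> base_functions n"
    by (intro base_functions_cmult base_functions.mult base_functions_power base_functions.fst
        base_functions.inv)
  then show ?thesis using False assms by (simp add: B1_def)
qed

lemma eventually_base: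
  assumes "(x, y) \<in> base n"
  shows "\<forall>\<^sub>F x' in nhds x. (x', y) \<in> base n"
proof -
  have "open {x'. x' ^ (n + 2) - y \<noteq> 0}"
    by (intro open_Collect_neq continuous_intros)
  moreover have "x \<in> {x'. x' ^ (n + 2) - y \<noteq> 0}" using assms by (auto simp: base_def)
  ultimately have "\<forall>\<^sub>F x' in nhds x. x' \<in> {x'. x' ^ (n + 2) - y \<noteq> 0}"
    by (rule eventually_nhds_in_open)
  then show ?thesis by eventually_elim (use assms in \<open>auto simp: base_def\<close>)
qed

context dwork_family
begin

text \<open>
  Row \<open>i\<close> of the \<open>dt\<^sub>1\<close>-component of \<open>d\<Omega> = B \<Omega> + \<Omega> B\<^sup>t\<^sup>r\<close> expresses row \<open>i + 1\<close> of \<open>\<Omega>\<close> by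
  row \<open>i\<close> and its derivative.
\<close>

lemma Om_base_function:
  assumes "i \<in> {1..n + 1}" "j \<in> {1..n + 1}"
  shows "\<exists>f\<in>base_functions n. \<forall>(x, y)\<in>base n. entry (Om x y) i j = f x y"
  using assms
proof (induction i arbitrary: j rule: nat_induct)
  case 0
  then show ?case by simp
next
  case (Suc i)
  show ?case
  proof (cases "i = 0")
    case True
    show ?thesis
    proof (cases "j = n + 1")
      case j: True
      have "(\<lambda>x y. (- of_nat (n + 2)) ^ n * c * (1 / (x ^ (n + 2) - y))) \<in> base_functions n"
        by (intro base_functions_cmult base_functions.inv)
      moreover have "entry (Om x y) 1 (n + 1) = (- of_nat (n + 2)) ^ n * c * (1 / (x ^ (n + 2) - y))"
        if "(x, y) \<in> base n" for x y
        using Om_antidiag[OF that, of 1] by simp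
      ultimately show ?thesis using True j by auto
    next
      case False
      then have "entry (Om x y) 1 j = 0" if "(x, y) \<in> base n" for x y
        using that Suc.prems by (intro Om_zero) auto
      then show ?thesis using True
        by (intro bexI[of _ "\<lambda>x y. 0"]) (auto intro: base_functions.const)
    qed
  next
    case False
    then have i: "i \<in> {1..n + 1}" "i \<le> n" using Suc.prems by auto
    have "\<forall>l\<in>{1..n + 1}. \<exists>f\<in>base_functions n. \<forall>(x, y)\<in>base n. entry (Om x y) i l = f x y"
      using Suc.IH i by blast
    then obtain f where f: "\<And>l. l \<in> {1..n + 1} \<Longrightarrow> f l \<in> base_functions n"
      and feq: "\<And>l x y. l \<in> {1..n + 1} \<Longrightarrow> (x, y) \<in> base n \<Longrightarrow> entry (Om x y) i l = f l x y"
      by (fastforce simp: Bex_def dest!: bchoice)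
    obtain g where g: "g \<in> base_functions n"
      "\<And>x y. (x, y) \<in> base n \<Longrightarrow> ((\<lambda>x'. f j x' y) has_field_derivative g x y) (at x)"
      using base_functions_deriv[OF f[OF Suc.prems(2)]] by blast
    define h where "h x y = g x y - (\<Sum>l = 1..n + 1. f l x y * entry (B1 n x y) j l)" for x y
    have "h \<in> base_functions n" unfolding h_def
      using g(1) f B1_base_function Suc.prems(2)
      by (intro base_functions_diff base_functions_sum base_functions.mult) auto
    moreover have "entry (Om x y) (Suc i) j = h x y" if xy: "(x, y) \<in> base n" for x y
    proof -
      have O: "Om x y \<in> carrier_mat (n + 1) (n + 1)" by (rule Om_carrier[OF xy])
      have B: "B1 n x y \<in> carrier_mat (n + 1) (n + 1)" by (simp add: B1_def)
      have "((\<lambda>x'. entry (Om x' y) i j) has_field_derivative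
          entry (B1 n x y * Om x y + Om x y * (B1 n x y)\<^sup>T) i j) (at x)"
        using intersection xy i Suc.prems by (auto simp: is_intersection_matrix_def)
      moreover have "((\<lambda>x'. entry (Om x' y) i j) has_field_derivative g x y) (at x)"
      \<comment> \<open>The entry of Omega agrees with the base function only on the base; this set
        is open in the x-direction, so the derivatives agree as well.\<close>
      proof (subst DERIV_cong_ev[OF refl _ refl])
        show "\<forall>\<^sub>F x' in nhds x. entry (Om x' y) i j = f j x' y"
          using eventually_base[OF xy] by eventually_elim (use feq Suc.prems in auto)
      qed (rule g(2)[OF xy])
      ultimately have "g x y = entry (B1 n x y * Om x y + Om x y * (B1 n x y)\<^sup>T) i j"
        by (rule DERIV_unique[symmetric])
      also have "\<dots> = entry (B1 n x y * Om x y) i j + entry (Om x y * (B1 n x y)\<^sup>T) i j"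
        by (rule entry_add[where N = "n + 1"])
          (use O B i Suc.prems in \<open>auto intro!: mult_carrier_mat[where n = "n + 1"]\<close>)
      also have "entry (B1 n x y * Om x y) i j = (\<Sum>l = 1..n + 1. entry (B1 n x y) i l * entry (Om x y) l j)"
        using O B i Suc.prems by (intro entry_mult) auto
      also have "\<dots> = (\<Sum>l = 1..n + 1. if l = Suc i then entry (Om x y) l j else 0)"
        using i by (intro sum.cong) (auto simp: B1_def)
      also have "\<dots> = entry (Om x y) (Suc i) j" using i by (subst sum.delta) auto
      also have "entry (Om x y * (B1 n x y)\<^sup>T) i j =
          (\<Sum>l = 1..n + 1. entry (Om x y) i l * entry (B1 n x y)\<^sup>T l j)"
        using O B i Suc.prems by (intro entry_mult) auto
      also have "\<dots> = (\<Sum>l = 1..n + 1. f l x y * entry (B1 n x y) j l)"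
        using B i Suc.prems by (intro sum.cong refl) (simp add: feq xy entry_transpose[where N = "n + 1"])
      finally show ?thesis by (simp add: h_def)
    qed
    ultimately show ?thesis by blast
  qed
qed

end

lemma sum_fun_apply: "sum f A p = (\<Sum>l\<in>A. f l p)"
  for f :: "'a \<Rightarrow> 'b \<Rightarrow> 'c :: comm_monoid_add"
  by (induction A rule: infinite_finite_induct) auto

section \<open>Regularity of the entries of Omega and S\<close>

context dwork_family
begin

abbreviation "OT \<equiv> O_T n Om"
abbreviation "cst a \<equiv> on_T n Om (\<lambda>_. a)"
abbreviation "tx \<equiv> on_T n Om pt_x"
abbreviation "ty \<equiv> on_T n Om pt_y"
abbreviation "s i j \<equiv> S_entry n Om i j"

definition om :: "nat \<Rightarrow> nat \<Rightarrow> func" where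
  "om i j = on_T n Om (\<lambda>p. entry (Om (pt_x p) (pt_y p)) i j)"

lemma on_T_in [simp]: "p \<in> T n Om \<Longrightarrow> on_T n Om f p = f p"
  and on_T_out [simp]: "p \<notin> T n Om \<Longrightarrow> on_T n Om f p = 0"
  by (simp_all add: on_T_def)

lemma on_T_cong: "(\<And>p. p \<in> T n Om \<Longrightarrow> f p = g p) \<Longrightarrow> on_T n Om f = on_T n Om g"
  by (auto simp: on_T_def)

lemma s_in: "p \<in> T n Om \<Longrightarrow> s i j p = entry (pt_S p) i j"
  and s_out [simp]: "p \<notin> T n Om \<Longrightarrow> s i j p = 0"
  by (simp_all add: S_entry_def)

lemma O_T_vanish: "f \<in> OT \<Longrightarrow> p \<notin> T n Om \<Longrightarrow> f p = 0"
proof (induction rule: O_T.induct)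
  case (coord j)
  show ?case by (rule tcoord_cases[OF n_pos coord.hyps, where Om = Om]) (use coord.prems in auto)
qed (auto simp: u_coord_def)

lemma O_T_uminus: "f \<in> OT \<Longrightarrow> - f \<in> OT"
proof -
  assume f: "f \<in> OT"
  have "cst (- 1) * f \<in> OT" using f by (intro O_T.mult O_T.const)
  moreover have "cst (- 1) * f = - f" using O_T_vanish[OF f] by (fastforce simp: on_T_def)
  ultimately show ?thesis by simp
qed

lemma O_T_diff: "f \<in> OT \<Longrightarrow> g \<in> OT \<Longrightarrow> f - g \<in> OT"
  using O_T.add[OF _ O_T_uminus, of f g] by simp

text \<open>For a \<noteq> 0 the function \<open>\<lambda>_. a\<close> does not vanish off T and so
  is not regular itself, but on a regular factor it acts like the regular function
  \<open>cst a\<close>.\<close>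

lemma O_T_cmult:
  assumes "f \<in> OT" shows "(\<lambda>_. a) * f \<in> OT"
proof -
  have "cst a * f \<in> OT" using assms by (intro O_T.mult O_T.const)
  moreover have "cst a * f = (\<lambda>_. a) * f" using O_T_vanish[OF assms] by (fastforce simp: on_T_def)
  ultimately show ?thesis by simp
qed

lemma O_T_zero: "0 \<in> OT"
  using O_T.const[of n Om 0] by (simp add: on_T_def zero_fun_def)

lemma O_T_sum: "(\<And>l. l \<in> A \<Longrightarrow> f l \<in> OT) \<Longrightarrow> sum f A \<in> OT"
  by (induction A rule: infinite_finite_induct) (auto intro: O_T_zero O_T.add)

lemma O_T_prod:
  "finite A \<Longrightarrow> (\<And>l. l \<in> A \<Longrightarrow> f l \<in> OT) \<Longrightarrow> on_T n Om (\<lambda>p. \<Prod>l\<in>A. f l p) \<in> OT"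
proof (induction A rule: finite_induct)
  case (insert a A)
  then have "f a * on_T n Om (\<lambda>p. \<Prod>l\<in>A. f l p) \<in> OT" by (intro O_T.mult) auto
  moreover have "f a * on_T n Om (\<lambda>p. \<Prod>l\<in>A. f l p) = on_T n Om (\<lambda>p. \<Prod>l\<in>insert a A. f l p)"
    using insert.hyps by (auto simp: on_T_def)
  ultimately show ?case by simp
qed (simp add: O_T.const)

lemma O_T_quotient:
  assumes "on_T n Om (\<lambda>p. 1 / g p) \<in> OT" "f * g \<in> OT"
    and "\<And>p. p \<in> T n Om \<Longrightarrow> g p \<noteq> 0" "\<And>p. p \<notin> T n Om \<Longrightarrow> f p = 0"
  shows "f \<in> OT"
proof -
  have "(f * g) * on_T n Om (\<lambda>p. 1 / g p) = f"
    using assms(3,4) by (fastforce simp: on_T_def)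
  then show ?thesis using O_T.mult[OF assms(2,1)] by simp
qed

lemma tx_regular: "tx \<in> OT" and ty_regular: "ty \<in> OT"
  using O_T.coord[OF chart_idx_1, of n Om] O_T.coord[OF chart_idx_n2[OF n_pos], of Om]
  by (simp_all only: tcoord_1 tcoord_n2)

lemma coord_regular: "(i, j) \<in> set (coord_entries n) \<Longrightarrow> s i j \<in> OT"
  using S_entry_is_tcoord[OF n_pos, of i j Om] O_T.coord by metis

lemma T_base: "p \<in> T n Om \<Longrightarrow> (pt_x p, pt_y p) \<in> base n"
  and T_carrier: "p \<in> T n Om \<Longrightarrow> pt_S p \<in> carrier_mat (n + 1) (n + 1)"
  and T_congruence: "p \<in> T n Om \<Longrightarrow> pt_S p * Om (pt_x p) (pt_y p) * (pt_S p)\<^sup>T = Phi n"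
  by (auto simp: T_def)

lemma T_nz: "p \<in> T n Om \<Longrightarrow> pt_y p \<noteq> 0" "p \<in> T n Om \<Longrightarrow> pt_x p ^ (n + 2) - pt_y p \<noteq> 0"
  using T_base by (fastforce simp: base_def)+

lemma s_upper:
  assumes "i < j" "i \<in> {1..n + 1}" "j \<in> {1..n + 1}"
  shows "s i j = 0"
proof
  fix p
  show "s i j p = 0 p"
  proof (cases "p \<in> T n Om")
    case True
    then have "(pt_S p)\<^sup>T $$ (j - 1, i - 1) = 0"
      using assms by (intro upper_triangularD) (auto simp: T_def)
    then show ?thesis using assms True T_carrier[OF True] by (simp add: s_in entry_def)
  qed simp
qed

lemma s_11: "s 1 1 = cst 1"
  by (rule ext) (auto simp: S_entry_def on_T_def T_def)


lemma om_sym: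
  assumes "i \<in> {1..n + 1}" "j \<in> {1..n + 1}" "p \<in> T n Om"
  shows "om i j p = (- 1) ^ n * om j i p"
  unfolding om_def on_T_in[OF assms(3)] by (rule Om_sym[OF T_base[OF assms(3)] assms(1,2)])

lemma om_zero:
  assumes "i \<in> {1..n + 1}" "j \<in> {1..n + 1}" "i + j < n + 2"
  shows "om i j p = 0"
  using Om_zero[OF T_base, of p i j] assms by (cases "p \<in> T n Om") (auto simp: om_def)

lemma om_antidiag_nz:
  assumes "i \<in> {1..n + 1}" "p \<in> T n Om"
  shows "om i (n + 2 - i) p \<noteq> 0"
  using Om_antidiag_nz[OF T_base[OF assms(2)] assms(1)] assms by (simp add: om_def)

lemma om_antidiag:
  assumes "j \<in> {1..n + 1}"
  obtains a where "a \<noteq> 0"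
    "\<And>p. p \<in> T n Om \<Longrightarrow> om j (n + 2 - j) p * (pt_x p ^ (n + 2) - pt_y p) = a"
proof
  show "(- 1) ^ (j - 1) * ((- of_nat (n + 2)) ^ n * c) \<noteq> 0"
  proof -
    have "(of_nat (n + 2) :: complex) \<noteq> 0" by (simp only: of_nat_eq_0_iff)
    then show ?thesis using c_nz by (simp del: of_nat_add of_nat_Suc power_Suc)
  qed
  show "om j (n + 2 - j) p * (pt_x p ^ (n + 2) - pt_y p) = (- 1) ^ (j - 1) * ((- of_nat (n + 2)) ^ n * c)"
    if "p \<in> T n Om" for p
    using T_nz[OF that] unfolding om_def on_T_in[OF that] Om_antidiag[OF T_base[OF that] assms]
    by (simp del: of_nat_add of_nat_Suc power_Suc)
qed

lemma congruence_entry: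
  assumes p: "p \<in> T n Om" and "i \<in> {1..n + 1}" "j \<in> {1..n + 1}"
  shows "(\<Sum>k = 1..n + 1. \<Sum>l = 1..n + 1. s i k p * om k l p * s j l p) = entry (Phi n) i j"
proof -
  have "entry (Phi n) i j = entry (pt_S p * Om (pt_x p) (pt_y p) * (pt_S p)\<^sup>T) i j"
    by (simp add: T_congruence[OF p])
  then show ?thesis
    using assms entry_congruence[OF T_carrier[OF p] Om_carrier[OF T_base[OF p]] assms(2,3)]
    by (simp add: om_def s_in)
qed

text \<open>In the congruence \<open>S \<Omega> S\<^sup>t\<^sup>r = \<Phi>\<close> the entry \<open>s\<^sub>i\<^sub>k\<close> meets \<open>s\<^sub>j\<^sub>j\<close>, \<open>k + j = n + 2\<close>, and all
  other terms involve entries of row \<open>i\<close> further to the right.\<close>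

lemma congruence_leading_term:
  assumes p: "p \<in> T n Om" and i: "i \<in> {1..n + 1}" and j: "j \<in> {1..n + 1}" and k0: "k0 = n + 2 - j"
  shows "s i k0 p * om k0 j p * s j j p +
    (\<Sum>k\<in>{k0<..n + 1}. \<Sum>l = 1..n + 1. s i k p * om k l p * s j l p) = entry (Phi n) i j"
proof -
  let ?g = "\<lambda>k. \<Sum>l = 1..n + 1. s i k p * om k l p * s j l p"
  have "{1..n + 1} = {1..<k0} \<union> {k0} \<union> {k0<..n + 1}" using j k0 by auto
  then have "sum ?g {1..n + 1} = sum ?g ({1..<k0} \<union> {k0} \<union> {k0<..n + 1})" by (rule arg_cong)
  also have "\<dots> = sum ?g ({1..<k0} \<union> {k0}) + sum ?g {k0<..n + 1}"
    by (rule sum.union_disjoint) auto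
  also have "sum ?g ({1..<k0} \<union> {k0}) = sum ?g {1..<k0} + ?g k0"
    by (subst sum.union_disjoint) auto
  \<comment> \<open>For l <= j the entry of Omega lies strictly above the antidiagonal; for l > j
    the entry of S lies above the diagonal.\<close>
  also have "sum ?g {1..<k0} = 0"
  proof (intro sum.neutral ballI)
    fix k l assume "k \<in> {1..<k0}" "l \<in> {1..n + 1}"
    then show "s i k p * om k l p * s j l p = 0"
      using j k0 by (cases "l \<le> j") (auto simp: om_zero s_upper)
  qed
  also have "?g k0 = (\<Sum>l\<in>{j}. s i k0 p * om k0 l p * s j l p)"
  proof (rule sum.mono_neutral_right)
    show "\<forall>l\<in>{1..n + 1} - {j}. s i k0 p * om k0 l p * s j l p = 0"
    proof
      fix l assume "l \<in> {1..n + 1} - {j}"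
      then show "s i k0 p * om k0 l p * s j l p = 0"
        using j k0 om_zero[of k0 l p] by (cases "l < j") (auto simp: s_upper)
    qed
  qed (use j in auto)
  finally show ?thesis using congruence_entry[OF p i j] by simp
qed

text \<open>All entries of row i = n + 2 - j to the right of the leading one lie above the diagonal
  of S, so only the leading term of the congruence is left. It ties each diagonal entry to its
  mirror image and shows that none of them vanishes.\<close>

lemma diag_product:
  assumes p: "p \<in> T n Om" and j: "j \<in> {1..n + 1}"
  shows "s (n + 2 - j) (n + 2 - j) p * om (n + 2 - j) j p * s j j p = phi_sign n (n + 2 - j)"
proof -
  define i where "i = n + 2 - j"
  have i: "i \<in> {1..n + 1}" "i + j = n + 2" using j by (auto simp: i_def)
  have "(\<Sum>k\<in>{i<..n + 1}. \<Sum>l = 1..n + 1. s i k p * om k l p * s j l p) = 0"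
    by (intro sum.neutral ballI) (use i in \<open>auto simp: s_upper\<close>)
  then have "s i i p * om i j p * s j j p = phi_sign n i"
    using congruence_leading_term[OF p i(1) j i_def] i j by (simp only: entry_Phi add_0_right simp_thms if_True)
  then show ?thesis by (simp only: i_def)
qed

lemma s_diag_nz: "p \<in> T n Om \<Longrightarrow> j \<in> {1..n + 1} \<Longrightarrow> s j j p \<noteq> 0"
  using diag_product[of p j] phi_sign_nz[of n "n + 2 - j"] by force

definition diag_coords :: "(nat \<times> nat) set" where
  "diag_coords = {e \<in> set (coord_entries n). fst e = snd e}"

lemma in_diag_coords_iff: "(i, j) \<in> diag_coords \<longleftrightarrow> i = j \<and> 2 \<le> j \<and> 2 * j \<le> n + 1"
proof (cases "odd n")
  case True
  then have "j + j \<le> n + 2 \<longleftrightarrow> 2 * j \<le> n + 1" by presburger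
  then show ?thesis using True by (auto simp: diag_coords_def in_coord_entries_iff)
qed (auto simp: diag_coords_def in_coord_entries_iff)

lemma finite_diag_coords: "finite diag_coords"
  by (simp add: diag_coords_def)

lemma t_check_eq: "t_check n Om = (\<lambda>p. \<Prod>e\<in>diag_coords. s (fst e) (snd e) p)"
  by (simp add: t_check_def diag_coords_def case_prod_unfold)

lemma diag_coords_prod:
  assumes "A \<subseteq> diag_coords"
  shows "on_T n Om (\<lambda>p. \<Prod>e\<in>A. s (fst e) (snd e) p) \<in> OT"
proof (rule O_T_prod)
  show "finite A" using assms finite_diag_coords by (rule finite_subset)
  show "s (fst e) (snd e) \<in> OT" if "e \<in> A" for e
    using assms that by (intro coord_regular) (auto simp: diag_coords_def)
qed

lemma t_check_nz: "p \<in> T n Om \<Longrightarrow> t_check n Om p \<noteq> 0"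
  unfolding t_check_eq prod_zero_iff[OF finite_diag_coords]
  using in_diag_coords_iff s_diag_nz by fastforce

lemma base_function_regular:
  "f \<in> base_functions n \<Longrightarrow> on_T n Om (\<lambda>p. f (pt_x p) (pt_y p)) \<in> OT"
proof (induction rule: base_functions.induct)
  case (const a)
  show ?case by (rule O_T.const)
next
  case fst
  show ?case by (rule tx_regular)
next
  case snd
  show ?case by (rule ty_regular)
next
  case inv
  let ?d = "\<lambda>p. pt_y p * (pt_y p - pt_x p ^ (n + 2)) * t_check n Om p"
  \<comment> \<open>The only inverse among the generators is that of y (y - x^(n+2)) times
    \<open>t_check\<close>; the other factors are cancelled by multiplication, and -1 reverses the
    difference.\<close>
  have "cst (- 1) * (on_T n Om (\<lambda>p. 1 / ?d p) * (ty * on_T n Om (t_check n Om))) \<in> OT"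
    using diag_coords_prod[OF order_refl] ty_regular
    by (intro O_T.mult O_T.const O_T.inv) (simp_all add: t_check_eq)
  also have "cst (- 1) * (on_T n Om (\<lambda>p. 1 / ?d p) * (ty * on_T n Om (t_check n Om))) =
      on_T n Om (\<lambda>p. 1 / (pt_x p ^ (n + 2) - pt_y p))"
  proof
    fix p
    show "(cst (- 1) * (on_T n Om (\<lambda>p. 1 / ?d p) * (ty * on_T n Om (t_check n Om)))) p =
      on_T n Om (\<lambda>p. 1 / (pt_x p ^ (n + 2) - pt_y p)) p"
    proof (cases "p \<in> T n Om")
      case True
      then show ?thesis
        using T_nz[OF True] t_check_nz[OF True] by (simp add: field_simps del: power_Suc)
    qed simp
  qed
  finally show ?case .
next
  case (add f g)
  have "on_T n Om (\<lambda>p. f (pt_x p) (pt_y p) + g (pt_x p) (pt_y p)) =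
    on_T n Om (\<lambda>p. f (pt_x p) (pt_y p)) + on_T n Om (\<lambda>p. g (pt_x p) (pt_y p))"
    by (auto simp: on_T_def)
  then show ?case using O_T.add[OF add.IH] by (simp only:)
next
  case (mult f g)
  have "on_T n Om (\<lambda>p. f (pt_x p) (pt_y p) * g (pt_x p) (pt_y p)) =
    on_T n Om (\<lambda>p. f (pt_x p) (pt_y p)) * on_T n Om (\<lambda>p. g (pt_x p) (pt_y p))"
    by (auto simp: on_T_def)
  then show ?case using O_T.mult[OF mult.IH] by (simp only:)
qed

lemma om_regular:
  assumes "i \<in> {1..n + 1}" "j \<in> {1..n + 1}"
  shows "om i j \<in> OT"
proof -
  obtain f where f: "f \<in> base_functions n"
    "\<And>x y. (x, y) \<in> base n \<Longrightarrow> entry (Om x y) i j = f x y"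
    using Om_base_function[OF assms] by blast
  have "om i j = on_T n Om (\<lambda>p. f (pt_x p) (pt_y p))"
    unfolding om_def by (rule on_T_cong) (use f(2) T_base in blast)
  then show ?thesis using base_function_regular[OF f(1)] by simp
qed


lemma diag_regular:
  assumes "j \<ge> 1" "2 * j \<le> n + 2"
  shows "s j j \<in> OT"
proof -
  consider "j = 1" | "(j, j) \<in> set (coord_entries n)" | "even n" "j = (n + 2) div 2"
  proof (cases "2 * j = n + 2")
    case True
    then have "even n" "j = (n + 2) div 2" by presburger+
    then show ?thesis using that(3) by blast
  next
    case False
    then show ?thesis using assms that(1,2)
      by (cases "odd n"; cases "j = 1") (auto simp: in_coord_entries_iff)
  qed
  then show ?thesis
  proof cases
    case 1
    then show ?thesis by (simp only: s_11 O_T.const)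
  next
    case 2
    then show ?thesis by (rule coord_regular)
  next
    case 3
    then show ?thesis using O_T.u[of n Om] by (simp add: u_coord_def)
  qed
qed

text \<open>In the upper half the diagonal entry is 1 or a factor of \<open>t_check\<close>, which
  is inverted by construction. In the lower half \<open>diag_product\<close> writes the inverse as a
  multiple of the mirrored diagonal entry and an entry of Omega.\<close>

lemma inverse_diag_regular:
  assumes j: "j \<in> {1..n + 1}"
  shows "on_T n Om (\<lambda>p. 1 / s j j p) \<in> OT"
proof (cases "2 * j \<le> n + 1")
  case True
  show ?thesis
  proof (cases "j = 1")
    case True
    have "on_T n Om (\<lambda>p. 1 / s 1 1 p) = cst 1" by (rule on_T_cong) (simp only: s_11 on_T_in div_by_1)
    then show ?thesis using True O_T.const by simp
  next
    case False
    then have jd: "(j, j) \<in> diag_coords" using True j by (simp add: in_diag_coords_iff)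
    let ?d = "\<lambda>p. pt_y p * (pt_y p - pt_x p ^ (n + 2)) * t_check n Om p"
    let ?r = "\<lambda>p. \<Prod>e\<in>diag_coords - {(j, j)}. s (fst e) (snd e) p"
    let ?q = "on_T n Om (\<lambda>p. (\<lambda>x y. y * (y - x ^ (n + 2))) (pt_x p) (pt_y p))"
    have "on_T n Om (\<lambda>p. 1 / ?d p) * (?q * on_T n Om ?r) \<in> OT"
      by (intro O_T.mult O_T.inv base_function_regular base_functions.mult base_functions_diff
          base_functions_power base_functions.fst base_functions.snd diag_coords_prod) auto
    also have "on_T n Om (\<lambda>p. 1 / ?d p) * (?q * on_T n Om ?r) = on_T n Om (\<lambda>p. 1 / s j j p)"
    proof
      fix p
      show "(on_T n Om (\<lambda>p. 1 / ?d p) * (?q * on_T n Om ?r)) p = on_T n Om (\<lambda>p. 1 / s j j p) p"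
      proof (cases "p \<in> T n Om")
        case True
        have "t_check n Om p = s j j p * ?r p"
          unfolding t_check_eq by (subst prod.remove[OF finite_diag_coords jd]) simp
        moreover have "pt_y p - pt_x p ^ (n + 2) \<noteq> 0" using T_nz[OF True] by simp
        ultimately show ?thesis
          using True T_nz(1)[OF True] t_check_nz[OF True] by (simp add: divide_simps del: power_Suc)
      qed simp
    qed
    finally show ?thesis .
  qed
next
  case False
  define i where "i = n + 2 - j"
  have i: "i \<in> {1..n + 1}" using j by (auto simp: i_def)
  have "cst (1 / phi_sign n i) * (s i i * om i j) \<in> OT"
    using False i j by (intro O_T.mult O_T.const om_regular diag_regular) (auto simp: i_def)
  also have "cst (1 / phi_sign n i) * (s i i * om i j) = on_T n Om (\<lambda>p. 1 / s j j p)"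
  proof
    fix p
    show "(cst (1 / phi_sign n i) * (s i i * om i j)) p = on_T n Om (\<lambda>p. 1 / s j j p) p"
    proof (cases "p \<in> T n Om")
      case True
      have "s i i p * om i j p * s j j p = phi_sign n i"
        using diag_product[OF True j] by (simp only: i_def)
      then show ?thesis using True s_diag_nz[OF True j] phi_sign_nz[of n i] by (simp add: divide_simps)
    qed simp
  qed
  finally show ?thesis .
qed

text \<open>An antidiagonal entry of Omega is a nonzero constant divided by x^(n+2) - y, so its
  inverse is a polynomial.\<close>

lemma inverse_om_antidiag_regular:
  assumes j: "j \<in> {1..n + 1}"
  shows "on_T n Om (\<lambda>p. 1 / om j (n + 2 - j) p) \<in> OT"
proof -
  obtain a where a: "a \<noteq> 0"
    "\<And>p. p \<in> T n Om \<Longrightarrow> om j (n + 2 - j) p * (pt_x p ^ (n + 2) - pt_y p) = a"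
    using om_antidiag[OF j] by blast
  have "on_T n Om (\<lambda>p. (\<lambda>x y. 1 / a * (x ^ (n + 2) - y)) (pt_x p) (pt_y p)) \<in> OT"
    by (intro base_function_regular base_functions_cmult base_functions_diff
        base_functions_power base_functions.fst base_functions.snd)
  also have "on_T n Om (\<lambda>p. (\<lambda>x y. 1 / a * (x ^ (n + 2) - y)) (pt_x p) (pt_y p)) =
      on_T n Om (\<lambda>p. 1 / om j (n + 2 - j) p)"
  proof (rule on_T_cong)
    fix p assume p: "p \<in> T n Om"
    show "1 / a * (pt_x p ^ (n + 2) - pt_y p) = 1 / om j (n + 2 - j) p"
      using a(1) a(2)[OF p] om_antidiag_nz[OF j p] by (simp add: divide_simps mult.commute)
  qed
  finally show ?thesis .
qed

text \<open>
  Row by row and from right to left, the entries of \<open>S\<close> that are not coordinates are computed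
  from \<open>S \<Omega> S\<^sup>t\<^sup>r = \<Phi>\<close>.
\<close>

lemma s_regular_step:
  assumes ik: "i \<in> {1..n + 1}" "k \<in> {1..n + 1}" "j = n + 2 - k" "a \<noteq> 0"
    and f: "f \<in> OT"
    and eq: "\<And>p. p \<in> T n Om \<Longrightarrow> a * (s i k p * om k j p * s j j p) = f p"
  shows "s i k \<in> OT"
proof (rule O_T_quotient)
  have j: "j \<in> {1..n + 1}" using ik by auto
  let ?g = "\<lambda>p. om k j p * s j j p"
  have "on_T n Om (\<lambda>p. 1 / om k j p) * on_T n Om (\<lambda>p. 1 / s j j p) \<in> OT"
    using inverse_om_antidiag_regular[OF ik(2)] inverse_diag_regular[OF j] ik(3)
    by (intro O_T.mult) simp_all
  also have "on_T n Om (\<lambda>p. 1 / om k j p) * on_T n Om (\<lambda>p. 1 / s j j p) = on_T n Om (\<lambda>p. 1 / ?g p)"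
    by (auto simp: on_T_def)
  finally show "on_T n Om (\<lambda>p. 1 / ?g p) \<in> OT" .
  have "s i k * ?g = cst (1 / a) * f"
  proof
    fix p
    show "(s i k * ?g) p = (cst (1 / a) * f) p"
      using eq[of p] ik(4) by (cases "p \<in> T n Om") (auto simp: field_simps)
  qed
  then show "s i k * ?g \<in> OT" using f by (simp add: O_T.mult O_T.const)
  show "?g p \<noteq> 0" if "p \<in> T n Om" for p
    using om_antidiag_nz[OF ik(2) that] s_diag_nz[OF that j] ik(3) by simp
qed simp

lemma s_regular:
  assumes "i \<in> {1..n + 1}" "k \<in> {1..n + 1}"
  shows "s i k \<in> OT"
  using assms
proof (induction i arbitrary: k rule: less_induct)
  case (less i)
  note rows = less.IH and i = less.prems(1)
  show ?case using less.prems(2)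
  proof (induction "n + 1 - k" arbitrary: k rule: less_induct)
    case less
    note k = less.prems
    have right: "s i l \<in> OT" if "l \<in> {k<..n + 1}" for l
      using that k by (intro less.hyps) auto
    define j where "j = n + 2 - k"
    have j: "j \<in> {1..n + 1}" "k = n + 2 - j" using k by (auto simp: j_def)
    \<comment> \<open>Besides entries that are zero, diagonal or coordinates there remain two kinds:
      j < i, where the congruence pairs row i with an earlier row, and, for even n only, j = i,
      where it pairs row i with itself.\<close>
    consider "i < k" | "i = k" "2 * k \<le> n + 2" | "(i, k) \<in> set (coord_entries n)"
      | "j < i" | "even n" "j = i" "k < i"
      using i k unfolding in_coord_entries_iff j_def
      by (cases "odd n"; cases "i < k"; cases "i = k"; cases "n + 2 - k < i") (force+)
    then show ?case
    proof cases
      case 1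
      then show ?thesis using i k by (simp only: s_upper O_T_zero)
    next
      case 2
      then show ?thesis using i by (auto intro: diag_regular)
    next
      case 3
      then show ?thesis by (rule coord_regular)
    next
      case 4
      let ?f = "cst (entry (Phi n) i j) - (\<Sum>k'\<in>{k<..n + 1}. \<Sum>l = 1..n + 1. s i k' * om k' l * s j l)"
      show ?thesis
      proof (rule s_regular_step[OF i k j_def, of 1])
        show "?f \<in> OT"
          using k j 4 by (intro O_T_diff O_T_sum O_T.mult O_T.const right om_regular rows) auto
        fix p assume p: "p \<in> T n Om"
        have fp: "?f p = entry (Phi n) i j - (\<Sum>k'\<in>{k<..n + 1}. \<Sum>l = 1..n + 1. s i k' p * om k' l p * s j l p)"
          using p by (simp add: sum_fun_apply)
        show "1 * (s i k p * om k j p * s j j p) = ?f p"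
          unfolding fp mult_1 eq_diff_eq by (rule congruence_leading_term[OF p i j])
      qed simp
    next
      case 5
      let ?f = "cst (entry (Phi n) i i) - (\<Sum>k'\<in>{k<..n + 1}. \<Sum>l\<in>{k<..n + 1}. s i k' * om k' l * s i l)"
      show ?thesis
      \<comment> \<open>The factor 2 arises because \<open>s i k\<close> occurs in the diagonal
        entry (i, i) of the congruence once on the left and once on the right; the two terms are
        equal since Omega is symmetric for even n.\<close>
      proof (rule s_regular_step[OF i k j_def, of 2])
        show "?f \<in> OT"
          using k by (intro O_T_diff O_T_sum O_T.mult O_T.const right om_regular) auto
        fix p assume p: "p \<in> T n Om"
        have split: "(\<Sum>l = 1..n + 1. s i k' p * om k' l p * s i l p) =
            (if k' = i then s i k p * om k i p * s i i p else 0) +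
            (\<Sum>l\<in>{k<..n + 1}. s i k' p * om k' l p * s i l p)" if k': "k' \<in> {k<..n + 1}" for k'
        proof -
          let ?h = "\<lambda>l. s i k' p * om k' l p * s i l p"
          have z: "?h l = 0" if "l \<le> k" "l \<ge> 1" "(k', l) \<noteq> (i, k)" for l
          proof (cases "k' \<le> i")
            case True
            then have "k' + l < n + 2" using that 5 j k' by auto
            then show ?thesis using om_zero[of k' l p] k' that k by simp
          qed (use k' i in \<open>simp add: s_upper\<close>)
          have "{1..n + 1} = {1..<k} \<union> {k} \<union> {k<..n + 1}" using k by auto
          then have "sum ?h {1..n + 1} = sum ?h ({1..<k} \<union> {k} \<union> {k<..n + 1})" by (rule arg_cong)
          also have "\<dots> = sum ?h ({1..<k} \<union> {k}) + sum ?h {k<..n + 1}"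
            by (rule sum.union_disjoint) auto
          also have "sum ?h ({1..<k} \<union> {k}) = sum ?h {1..<k} + ?h k"
            by (subst sum.union_disjoint) auto
          also have "sum ?h {1..<k} = 0" by (intro sum.neutral ballI z) auto
          also have "?h k = (if k' = i then s i k p * om k i p * s i i p else 0)"
            using z[of k] k om_sym[OF k i p] 5(1) by auto
          finally show ?thesis by simp
        qed
        have "(\<Sum>k'\<in>{k<..n + 1}. \<Sum>l = 1..n + 1. s i k' p * om k' l p * s i l p) =
            (\<Sum>k'\<in>{k<..n + 1}. if k' = i then s i k p * om k i p * s i i p else 0) +
            (\<Sum>k'\<in>{k<..n + 1}. \<Sum>l\<in>{k<..n + 1}. s i k' p * om k' l p * s i l p)"
          unfolding sum.distrib[symmetric] by (intro sum.cong refl split)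
        also have "(\<Sum>k'\<in>{k<..n + 1}. if k' = i then s i k p * om k i p * s i i p else 0) =
            s i k p * om k i p * s i i p"
          using 5 i by (subst sum.delta) auto
        finally have tail: "(\<Sum>k'\<in>{k<..n + 1}. \<Sum>l = 1..n + 1. s i k' p * om k' l p * s i l p) =
            s i k p * om k i p * s i i p +
            (\<Sum>k'\<in>{k<..n + 1}. \<Sum>l\<in>{k<..n + 1}. s i k' p * om k' l p * s i l p)" .
        have fp: "?f p = entry (Phi n) i i - (\<Sum>k'\<in>{k<..n + 1}. \<Sum>l\<in>{k<..n + 1}. s i k' p * om k' l p * s i l p)"
          using p by (simp add: sum_fun_apply)
        show "2 * (s i k p * om k j p * s j j p) = ?f p"
          using congruence_leading_term[OF p i j] unfolding 5(2) tail fp eq_diff_eq mult_2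
          by (simp only: add.assoc)
      qed simp
    qed
  qed
qed

end

section \<open>Vector fields\<close>

lemma fscale_apply [simp]: "fscale f V g p = f p * V g p"
  by (simp add: fscale_def)

lemma cscale_apply [simp]: "cscale a V g p = a * V g p"
  by (simp add: cscale_def)

lemma lie_bracket_apply: "lie_bracket V W f p = V (W f) p - W (V f) p"
  by (simp add: lie_bracket_def)

context dwork_family
begin

abbreviation "VF \<equiv> vector_fields n Om"

lemma VF_regular: "V \<in> VF \<Longrightarrow> f \<in> OT \<Longrightarrow> V f \<in> OT"
  and VF_not_regular: "V \<in> VF \<Longrightarrow> f \<notin> OT \<Longrightarrow> V f = 0"
  and VF_add: "V \<in> VF \<Longrightarrow> f \<in> OT \<Longrightarrow> g \<in> OT \<Longrightarrow> V (f + g) = V f + V g"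
  and VF_cmult: "V \<in> VF \<Longrightarrow> f \<in> OT \<Longrightarrow> V ((\<lambda>_. a) * f) = (\<lambda>_. a) * V f"
  and VF_mult: "V \<in> VF \<Longrightarrow> f \<in> OT \<Longrightarrow> g \<in> OT \<Longrightarrow> V (f * g) = V f * g + f * V g"
  by (simp_all add: vector_fields_def)

lemma VF_out: "V \<in> VF \<Longrightarrow> p \<notin> T n Om \<Longrightarrow> V f p = 0"
  using O_T_vanish[OF VF_regular] VF_not_regular by (cases "f \<in> OT") auto

lemma VF_zero: "V \<in> VF \<Longrightarrow> V 0 = 0"
  using VF_add[of V 0 0] O_T_zero by simp

lemma VF_uminus:
  assumes "V \<in> VF" "f \<in> OT" shows "V (- f) = - V f"
proof -
  have "- f = (\<lambda>_. - 1) * f" "- V f = (\<lambda>_. - 1) * V f" by auto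
  then show ?thesis using VF_cmult[OF assms] by simp
qed

lemma VF_diff: "V \<in> VF \<Longrightarrow> f \<in> OT \<Longrightarrow> g \<in> OT \<Longrightarrow> V (f - g) = V f - V g"
  using VF_add[of V f "- g"] VF_uminus[of V g] O_T_uminus[of g] by simp

lemma VF_cst:
  assumes "V \<in> VF" shows "V (cst a) = 0"
proof -
  have "V (cst 1 * cst 1) = V (cst 1) * cst 1 + cst 1 * V (cst 1)"
    using assms by (intro VF_mult O_T.const)
  moreover have "cst 1 * cst 1 = cst 1" by (auto simp: on_T_def)
  moreover have "V (cst 1) * cst 1 = V (cst 1)" "cst 1 * V (cst 1) = V (cst 1)"
    using VF_out[OF assms] by (fastforce simp: on_T_def)+
  ultimately have "V (cst 1) = 0" by simp
  moreover have "cst a = (\<lambda>_. a) * cst 1" by (auto simp: on_T_def)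
  ultimately show ?thesis using VF_cmult[OF assms O_T.const[of n Om 1], of a] by auto
qed

lemma VF_I:
  assumes "\<And>f. f \<in> OT \<Longrightarrow> V f \<in> OT" "\<And>f. f \<notin> OT \<Longrightarrow> V f = 0"
    and "\<And>f g. f \<in> OT \<Longrightarrow> g \<in> OT \<Longrightarrow> V (f + g) = V f + V g"
    and "\<And>a f. f \<in> OT \<Longrightarrow> V ((\<lambda>_. a) * f) = (\<lambda>_. a) * V f"
    and "\<And>f g. f \<in> OT \<Longrightarrow> g \<in> OT \<Longrightarrow> V (f * g) = V f * g + f * V g"
  shows "V \<in> VF"
  using assms by (simp add: vector_fields_def)

lemma zero_in_VF: "0 \<in> VF"
  by (rule VF_I) (auto simp: O_T_zero)

lemma add_in_VF:
  assumes V: "V \<in> VF" and W: "W \<in> VF" shows "V + W \<in> VF"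
proof (rule VF_I)
  show "(V + W) f \<in> OT" if "f \<in> OT" for f
    by (subst plus_fun_apply) (intro O_T.add VF_regular[OF V] VF_regular[OF W] that)
  show "(V + W) f = 0" if "f \<notin> OT" for f
    by (simp add: VF_not_regular[OF V that] VF_not_regular[OF W that])
  show "(V + W) (f + g) = (V + W) f + (V + W) g" if "f \<in> OT" "g \<in> OT" for f g
    unfolding plus_fun_apply VF_add[OF V that] VF_add[OF W that] by (simp add: fun_eq_iff)
  show "(V + W) ((\<lambda>_. a) * f) = (\<lambda>_. a) * (V + W) f" if "f \<in> OT" for a f
    unfolding plus_fun_apply VF_cmult[OF V that] VF_cmult[OF W that]
    by (simp add: fun_eq_iff algebra_simps)
  show "(V + W) (f * g) = (V + W) f * g + f * (V + W) g" if "f \<in> OT" "g \<in> OT" for f g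
    unfolding plus_fun_apply VF_mult[OF V that] VF_mult[OF W that]
    by (simp add: fun_eq_iff algebra_simps)
qed

lemma fscale_in_VF:
  assumes V: "V \<in> VF" and h: "h \<in> OT" shows "fscale h V \<in> VF"
proof (rule VF_I)
  show "fscale h V f \<in> OT" if "f \<in> OT" for f
    unfolding fscale_def by (intro O_T.mult h VF_regular[OF V] that)
  show "fscale h V ((\<lambda>_. a) * f) = (\<lambda>_. a) * fscale h V f" if "f \<in> OT" for a f
    unfolding fscale_def VF_cmult[OF V that] by (simp add: fun_eq_iff algebra_simps)
qed (auto simp: fun_eq_iff VF_not_regular[OF V] VF_add[OF V] VF_mult[OF V] algebra_simps)

lemma cscale_eq_fscale: "V \<in> VF \<Longrightarrow> cscale a V = fscale (cst a) V"
proof (intro ext)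
  fix f p assume "V \<in> VF"
  then show "cscale a V f p = fscale (cst a) V f p" using VF_out[of V p f] by (cases "p \<in> T n Om") auto
qed

lemma cscale_in_VF: "V \<in> VF \<Longrightarrow> cscale a V \<in> VF"
  unfolding cscale_eq_fscale by (intro fscale_in_VF O_T.const)

lemma diff_in_VF:
  assumes "V \<in> VF" "W \<in> VF" shows "V - W \<in> VF"
proof -
  have "V - W = V + cscale (- 1) W" by (auto simp: fun_eq_iff)
  then show ?thesis using assms by (simp only: add_in_VF cscale_in_VF)
qed

lemma lie_bracket_in_VF:
  assumes V: "V \<in> VF" and W: "W \<in> VF" shows "lie_bracket V W \<in> VF"
proof (rule VF_I)
  note r = VF_regular[OF V] VF_regular[OF W]
  show "lie_bracket V W f \<in> OT" if "f \<in> OT" for f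
    unfolding lie_bracket_def by (intro O_T_diff r that)
  show "lie_bracket V W f = 0" if "f \<notin> OT" for f
    by (simp add: lie_bracket_def VF_not_regular[OF V that] VF_not_regular[OF W that]
        VF_zero[OF V] VF_zero[OF W])
  show "lie_bracket V W (f + g) = lie_bracket V W f + lie_bracket V W g" if "f \<in> OT" "g \<in> OT" for f g
    by (simp add: lie_bracket_def that r VF_add[OF V] VF_add[OF W])
  show "lie_bracket V W ((\<lambda>_. a) * f) = (\<lambda>_. a) * lie_bracket V W f" if "f \<in> OT" for a f
    unfolding lie_bracket_def VF_cmult[OF V that] VF_cmult[OF W that]
      VF_cmult[OF V r(2)[OF that]] VF_cmult[OF W r(1)[OF that]]
    by (auto simp: fun_eq_iff algebra_simps)
  show "lie_bracket V W (f * g) = lie_bracket V W f * g + f * lie_bracket V W g"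
    if "f \<in> OT" "g \<in> OT" for f g
    unfolding lie_bracket_def
    by (simp add: that r O_T.mult VF_mult[OF V] VF_mult[OF W] VF_add[OF V] VF_add[OF W])
      (auto simp: fun_eq_iff algebra_simps)
qed

text \<open>Regular eigenfunctions of V. For V = H this is homogeneity; weight 0 means being
  constant along V. One calculus thus serves the grading, the fields that fix the diagonal of S, and
  the proof that a field is determined by the chart.\<close>

definition weight :: "vfield \<Rightarrow> complex \<Rightarrow> func \<Rightarrow> bool" where
  "weight V w f \<longleftrightarrow> f \<in> OT \<and> V f = (\<lambda>_. w) * f"

lemma weightD: "weight V w f \<Longrightarrow> f \<in> OT" "weight V w f \<Longrightarrow> V f = (\<lambda>_. w) * f"
  "weight V w f \<Longrightarrow> V f p = w * f p"
  by (simp_all add: weight_def)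

lemma weight_0_iff: "weight V 0 f \<longleftrightarrow> f \<in> OT \<and> V f = 0"
  by (auto simp: weight_def fun_eq_iff)

context
  fixes V assumes V: "V \<in> VF"
begin

lemma weight_cst: "weight V 0 (cst a)"
  by (simp add: weight_0_iff O_T.const VF_cst[OF V])

lemma weight_add: "weight V w f \<Longrightarrow> weight V w g \<Longrightarrow> weight V w (f + g)"
  by (simp add: weight_def O_T.add VF_add[OF V] fun_eq_iff algebra_simps)

lemma weight_cmult: "weight V w f \<Longrightarrow> weight V w ((\<lambda>_. a) * f)"
  unfolding weight_def using O_T_cmult[of f a] VF_cmult[OF V, of f a]
  by (auto simp: fun_eq_iff algebra_simps)

lemma weight_uminus: "weight V w f \<Longrightarrow> weight V w (- f)"
  by (simp add: weight_def O_T_uminus VF_uminus[OF V] fun_eq_iff)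

lemma weight_diff: "weight V w f \<Longrightarrow> weight V w g \<Longrightarrow> weight V w (f - g)"
  using weight_add[of w f "- g"] weight_uminus[of w g] by simp

lemma weight_mult: "weight V w f \<Longrightarrow> weight V v g \<Longrightarrow> weight V (w + v) (f * g)"
  unfolding weight_def using O_T.mult[of f n Om g] VF_mult[OF V, of f g]
  by (auto simp: fun_eq_iff algebra_simps)

lemma weight_power:
  assumes "weight V w (on_T n Om f)"
  shows "weight V (of_nat k * w) (on_T n Om (\<lambda>p. f p ^ k))"
proof (induction k)
  case (Suc k)
  have "on_T n Om (\<lambda>p. f p ^ Suc k) = on_T n Om f * on_T n Om (\<lambda>p. f p ^ k)"
    by (auto simp: on_T_def)
  moreover have "of_nat (Suc k) * w = w + of_nat k * w" by (simp add: algebra_simps)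
  ultimately show ?case using weight_mult[OF assms Suc] by (simp only:)
qed (simp add: weight_cst)

text \<open>The Leibniz rule for f g can be solved for V f at every point of T, because g has no
  zeros there. In this way functions known only through an equation for f g receive a
  weight.\<close>

lemma weight_quotient:
  assumes f: "f \<in> OT" and g: "weight V v g" and fg: "weight V w (f * g)"
    and nz: "\<And>p. p \<in> T n Om \<Longrightarrow> g p \<noteq> 0"
  shows "weight V (w - v) f"
proof -
  have "V f p = (w - v) * f p" for p
  proof (cases "p \<in> T n Om")
    case True
    have "V (f * g) p = V f p * g p + f p * (v * g p)"
      using VF_mult[OF V f weightD(1)[OF g]] weightD(3)[OF g] by simp
    also have "V (f * g) p = w * (f p * g p)" using weightD(3)[OF fg] by simp
    finally have "(V f p - (w - v) * f p) * g p = 0" by (simp add: algebra_simps)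
    then show ?thesis using nz[OF True] by simp
  qed (simp add: VF_out[OF V] O_T_vanish[OF f])
  then show ?thesis using f by (auto simp: weight_def fun_eq_iff)
qed

lemma weight_0_prod:
  "finite A \<Longrightarrow> (\<And>l. l \<in> A \<Longrightarrow> weight V 0 (f l)) \<Longrightarrow> weight V 0 (on_T n Om (\<lambda>p. \<Prod>l\<in>A. f l p))"
proof (induction A rule: finite_induct)
  case (insert a A)
  then have "weight V (0 + 0) (f a * on_T n Om (\<lambda>p. \<Prod>l\<in>A. f l p))" by (intro weight_mult) auto
  moreover have "f a * on_T n Om (\<lambda>p. \<Prod>l\<in>A. f l p) = on_T n Om (\<lambda>p. \<Prod>l\<in>insert a A. f l p)"
    using insert.hyps by (auto simp: on_T_def)
  ultimately show ?case by simp
qed (simp add: weight_cst)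

lemma weight_discriminant:
  assumes "weight V w tx" "weight V (of_nat (n + 2) * w) ty"
  shows "weight V (of_nat (n + 2) * w) (on_T n Om (\<lambda>p. pt_x p ^ (n + 2) - pt_y p))"
proof -
  have "on_T n Om (\<lambda>p. pt_x p ^ (n + 2) - pt_y p) = on_T n Om (\<lambda>p. pt_x p ^ (n + 2)) - ty"
    by (auto simp: on_T_def)
  then show ?thesis using weight_diff[OF weight_power[OF assms(1)] assms(2)] by (simp only:)
qed

text \<open>The annihilated regular functions form a ring. The generators that are not coordinates,
  u and the inverted function, are reached by cancelling factors that have no zeros on T.\<close>

lemma vanishes_if_vanishes_on_coordinates:
  assumes "\<And>j. j \<in> chart_idx n \<Longrightarrow> V (tcoord n Om j) = 0"
  shows "V = 0"
proof -
  have xy: "weight V 0 tx" "weight V 0 ty"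
    using assms[OF chart_idx_1] assms[OF chart_idx_n2[OF n_pos]] tx_regular ty_regular
    by (simp_all only: tcoord_1 tcoord_n2 weight_0_iff)
  have s0: "weight V 0 (s i j)" if "(i, j) \<in> set (coord_entries n)" for i j
    using S_entry_is_tcoord[OF n_pos that, of Om] assms coord_regular[OF that]
    by (metis weight_0_iff)
  let ?D = "on_T n Om (\<lambda>p. pt_x p ^ (n + 2) - pt_y p)"
  have D: "weight V 0 ?D" using weight_discriminant[of 0] xy by simp
  have "V f = 0" if "f \<in> OT" for f
    using that
  proof induction
    case (const a)
    show ?case by (rule VF_cst[OF V])
  next
    case (coord j)
    then show ?case by (rule assms)
  next
    case u
    \<comment> \<open>The middle index is its own mirror image, so \<open>diag_product\<close>
      becomes a quadratic equation for u with constant right-hand side; differentiating it gives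
      twice V(u) times a function without zeros.\<close>
    define m where "m = (n + 2) div 2"
    have m: "m \<in> {1..n + 1}" "n + 2 - m = m" using u n_pos by (auto simp: m_def elim!: evenE)
    have sm: "s m m \<in> OT" using m by (intro s_regular)
    obtain a where a: "\<And>p. p \<in> T n Om \<Longrightarrow> om m m p * (pt_x p ^ (n + 2) - pt_y p) = a"
      using om_antidiag[OF m(1)] unfolding m(2) by metis
    have "weight V (0 - 0) (om m m)"
    proof (rule weight_quotient[where g = ?D])
      have "om m m * ?D = cst a"
      proof
        fix p show "(om m m * ?D) p = cst a p" using a[of p] by (cases "p \<in> T n Om") auto
      qed
      then show "weight V 0 (om m m * ?D)" by (simp only: weight_cst)
    qed (use D m om_regular T_nz(2) in auto)
    then have om: "V (om m m) = 0" "om m m \<in> OT" by (simp_all add: weight_0_iff)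
    have "s m m * om m m * s m m = cst (phi_sign n m)"
    proof
      fix p
      show "(s m m * om m m * s m m) p = cst (phi_sign n m) p"
        using diag_product[of p m] m by (cases "p \<in> T n Om") simp_all
    qed
    then have "V (s m m * om m m * s m m) = 0" using VF_cst[OF V] by simp
    then have z: "V (s m m) * (om m m * s m m) + V (s m m) * (om m m * s m m) = 0"
      by (simp add: VF_mult[OF V] O_T.mult sm om algebra_simps)
    show ?case unfolding u_coord_def m_def[symmetric]
    proof
      fix p
      show "V (s m m) p = 0 p"
      proof (cases "p \<in> T n Om")
        case True
        have "om m m p \<noteq> 0" "s m m p \<noteq> 0"
          using om_antidiag_nz[OF m(1) True] s_diag_nz[OF True m(1)] m(2) by auto
        then show ?thesis using fun_cong[OF z, of p] by (simp add: mult_2[symmetric])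
      qed (simp add: VF_out[OF V])
    qed
  next
    case inv
    let ?tc = "on_T n Om (t_check n Om)"
    let ?I = "on_T n Om (\<lambda>p. 1 / (pt_y p * (pt_y p - pt_x p ^ (n + 2)) * t_check n Om p))"
    have "weight V 0 ?tc" unfolding t_check_eq
      by (rule weight_0_prod[OF finite_diag_coords]) (auto simp: diag_coords_def intro: s0)
    then have "weight V (0 + (0 + 0)) (ty * (?D * ?tc))" by (intro weight_mult xy D)
    then have w: "weight V 0 (ty * (?D * ?tc))" by simp
    have "weight V (0 - 0) ?I"
    proof (rule weight_quotient[OF O_T.inv w])
      have "?I * (ty * (?D * ?tc)) = cst (- 1)"
      proof
        fix p
        show "(?I * (ty * (?D * ?tc))) p = cst (- 1) p"
        proof (cases "p \<in> T n Om")
          case True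
          then show ?thesis using T_nz[OF True] t_check_nz[OF True]
            by (simp add: field_simps del: power_Suc)
        qed simp
      qed
      then show "weight V 0 (?I * (ty * (?D * ?tc)))" by (simp only: weight_cst)
    qed (use T_nz t_check_nz in auto)
    then show ?case by (simp add: weight_0_iff)
  next
    case (add f g)
    then show ?case using VF_add[OF V, of f g] by (simp only: add_0_left)
  next
    case (mult f g)
    then show ?case using VF_mult[OF V, of f g]
      by (simp only: mult_zero_left mult_zero_right add_0_left)
  qed
  then show ?thesis using VF_not_regular[OF V] by (metis zero_fun_apply ext)
qed

end

lemma tcoord_in_OT: "j \<in> chart_idx n \<Longrightarrow> tcoord n Om j \<in> OT"
  by (rule O_T.coord)

lemma vf_eqI_tcoord:
  assumes V: "V \<in> VF" and W: "W \<in> VF"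
    and eq: "\<And>j. j \<in> chart_idx n \<Longrightarrow> V (tcoord n Om j) = W (tcoord n Om j)"
  shows "V = W"
proof -
  have "V - W = 0"
    by (rule vanishes_if_vanishes_on_coordinates) (auto simp: diff_in_VF V W eq)
  then show ?thesis by simp
qed

lemma vf_eqI_entries:
  assumes V: "V \<in> VF" and W: "W \<in> VF"
    and "V tx = W tx" "V ty = W ty"
    and "\<And>i k. (i, k) \<in> set (coord_entries n) \<Longrightarrow> V (s i k) = W (s i k)"
  shows "V = W"
proof (rule vf_eqI_tcoord[OF V W])
  fix j assume "j \<in> chart_idx n"
  then show "V (tcoord n Om j) = W (tcoord n Om j)"
    by (rule tcoord_cases[OF n_pos, where Om = Om]) (simp_all only: assms)
qed

end

section \<open>Gauss--Manin matrices\<close>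

text \<open>These Stirling numbers are binomial coefficients. The value at k = n + 1 makes the
  exceptional entry (n + 1, n + 1) of \<open>B2\<close> follow the pattern of all the
  others.\<close>

lemma Stirling_Suc_self: "2 * Stirling (Suc k) k = k * Suc k"
proof (induction k)
  case (Suc k)
  have "2 * Stirling (Suc (Suc k)) (Suc k) = 2 * Suc k + 2 * Stirling (Suc k) k" by simp
  then show ?case using Suc by simp
qed simp

text \<open>
  For \<open>a = V(t\<^sub>1)\<close> and \<open>b = V(t\<^sub>n\<^sub>+\<^sub>2)\<close> the left-hand side is the entry \<open>(i, j)\<close> of \<open>B(V)\<close>.
\<close>

lemma B1_B2_combination:
  assumes xy: "(x, y) \<in> base n" and ij: "i \<in> {1..n + 1}" "j \<in> {1..n + 1}"
  shows "a * entry (B1 n x y) i j + b * entry (B2 n x y) i j =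
    (a - x * (b / (of_nat (n + 2) * y))) * entry (B1 n x y) i j
    - (if i = j then of_nat i * (b / (of_nat (n + 2) * y)) else 0)"
proof -
  define N :: complex where "N = of_nat (n + 2)"
  define D where "D = x ^ (n + 2) - y"
  have y: "y \<noteq> 0" "D \<noteq> 0" using xy by (auto simp: base_def D_def)
  have N: "N \<noteq> 0" unfolding N_def by (simp only: of_nat_eq_0_iff)
  have "N = of_nat n + 2" by (simp add: N_def)
  have xD: "x ^ (n + 2) = D + y" by (simp add: D_def)
  consider "i \<le> n" | "i = n + 1" "j \<le> n" | "i = n + 1" "j = n + 1" using ij by force
  \<comment> \<open>Homogeneity of the Gauss--Manin connection: along the Euler field x d/dx + (n +
    2) y d/dy its matrix is - diag(1, ..., n + 1). Solved for \<open>B2\<close>, this leaves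
    \<open>B1\<close> as the only nontrivial matrix.\<close>
  then have "entry (B2 n x y) i j =
    - (x * entry (B1 n x y) i j + (if i = j then of_nat i else 0)) / (N * y)"
  proof cases
    case 1
    then have "entry (B2 n x y) i j =
        (if j = i then - of_nat i / (N * y) else if j = i + 1 then - x / (N * y) else 0)"
      by (simp only: B2_def entry_mat1[OF ij] N_def if_True)
    then show ?thesis using 1 ij by (auto simp: B1_def)
  next
    case 2
    have e2: "entry (B2 n x y) i j = of_nat (Stirling (n + 2) j) * x ^ (j + 1) / (N * y * D)"
      unfolding B2_def entry_mat1[OF ij] N_def D_def using 2 by simp
    have e1: "entry (B1 n x y) i j = - of_nat (Stirling (n + 2) j) * x ^ j / D"
      unfolding B1_def entry_mat1[OF ij] D_def using 2 by simp
    show ?thesis unfolding e1 e2 using 2 y N by (simp add: field_simps)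
  next
    case 3
    define S :: complex where "S = of_nat (Stirling (n + 2) (n + 1))"
    have "2 * Stirling (n + 2) (n + 1) = (n + 1) * (n + 2)"
      using Stirling_Suc_self[of "n + 1"] by simp
    then have "2 * S = of_nat (n + 1) * of_nat (n + 2)"
      unfolding S_def by (metis of_nat_mult of_nat_numeral)
    then have S: "S = of_nat (n + 1) * of_nat (n + 2) / 2"
      by (metis nonzero_mult_div_cancel_left zero_neq_numeral)
    have e2: "entry (B2 n x y) i j =
        (of_nat n * of_nat (n + 1) / 2 * (D + y) + of_nat (n + 1) * y) / (N * y * D)"
      unfolding B2_def entry_mat1[OF ij] N_def D_def using 3 by simp
    have "entry (B1 n x y) i j = - S * x ^ (n + 1) / D"
      unfolding B1_def entry_mat1[OF ij] S_def D_def using 3 by simp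
    then have "x * entry (B1 n x y) i j = - S * x ^ (n + 2) / D" by simp
    then have e1: "x * entry (B1 n x y) i j = - S * (D + y) / D" by (simp only: xD)
    have d: "(if i = j then of_nat i else 0) = (of_nat n + 1 :: complex)" using 3 by simp
    show ?thesis unfolding e1 e2 d S using y N by (simp add: field_simps)
  qed
  then show ?thesis unfolding N_def[symmetric]
    by (simp only:) (simp add: algebra_simps add_divide_distrib diff_divide_distrib)
qed

context dwork_family
begin

lemma s_upper_apply:
  "i < j \<Longrightarrow> i \<in> {1..n + 1} \<Longrightarrow> j \<in> {1..n + 1} \<Longrightarrow> s i j p = 0"
  by (simp add: s_upper)

lemma S_mat_carrier: "S_mat n Om \<in> carrier_mat (n + 1) (n + 1)"
  unfolding S_mat_def by (rule mat1_carrier)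

lemma entry_S_mat: "i \<in> {1..n + 1} \<Longrightarrow> j \<in> {1..n + 1} \<Longrightarrow> entry (S_mat n Om) i j = s i j"
  by (simp add: S_mat_def)

lemma B_along_carrier: "B_along n Om V \<in> carrier_mat (n + 1) (n + 1)"
  unfolding B_along_def by (intro add_carrier_mat smult_carrier_mat mat1_carrier)

lemma gauss_manin_iff:
  assumes A: "A \<in> carrier_mat (n + 1) (n + 1)"
  shows "map_mat V (S_mat n Om) = A * S_mat n Om - S_mat n Om * B_along n Om V \<longleftrightarrow>
    (\<forall>i\<in>{1..n + 1}. \<forall>j\<in>{1..n + 1}. \<forall>p. V (s i j) p =
      (\<Sum>l = 1..n + 1. entry A i l p * s l j p) - (\<Sum>l = 1..n + 1. s i l p * entry (B_along n Om V) l j p))"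
    (is "?L = ?M \<longleftrightarrow> _")
proof -
  note C = S_mat_carrier B_along_carrier[of V]
  have c: "A * S_mat n Om \<in> carrier_mat (n + 1) (n + 1)"
    "S_mat n Om * B_along n Om V \<in> carrier_mat (n + 1) (n + 1)"
    using A C by (auto intro: mult_carrier_mat)
  have L: "entry ?L i j = V (s i j)" if "i \<in> {1..n + 1}" "j \<in> {1..n + 1}" for i j
    using that C(1) by (simp add: entry_map_mat[where N = "n + 1"] entry_S_mat)
  have R: "entry ?M i j p =
      (\<Sum>l = 1..n + 1. entry A i l p * s l j p) - (\<Sum>l = 1..n + 1. s i l p * entry (B_along n Om V) l j p)"
    if ij: "i \<in> {1..n + 1}" "j \<in> {1..n + 1}" for i j p
  proof -
    have "entry (A * S_mat n Om) i j p = (\<Sum>l = 1..n + 1. entry A i l p * s l j p)"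
      unfolding entry_mult[OF A C(1) ij] sum_fun_apply
      by (intro sum.cong refl) (use ij in \<open>simp add: entry_S_mat\<close>)
    moreover have "entry (S_mat n Om * B_along n Om V) i j p =
        (\<Sum>l = 1..n + 1. s i l p * entry (B_along n Om V) l j p)"
      unfolding entry_mult[OF C ij] sum_fun_apply
      by (intro sum.cong refl) (use ij in \<open>simp add: entry_S_mat\<close>)
    ultimately show ?thesis unfolding entry_diff[OF c ij] by simp
  qed
  show ?thesis
  proof
    assume eq: "?L = ?M"
    show "\<forall>i\<in>{1..n + 1}. \<forall>j\<in>{1..n + 1}. \<forall>p. V (s i j) p =
      (\<Sum>l = 1..n + 1. entry A i l p * s l j p) - (\<Sum>l = 1..n + 1. s i l p * entry (B_along n Om V) l j p)"
    proof (intro ballI allI)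
      fix i j p assume ij: "i \<in> {1..n + 1}" "j \<in> {1..n + 1}"
      show "V (s i j) p =
        (\<Sum>l = 1..n + 1. entry A i l p * s l j p) - (\<Sum>l = 1..n + 1. s i l p * entry (B_along n Om V) l j p)"
        unfolding L[OF ij, symmetric] R[OF ij, symmetric] eq ..
    qed
  next
    assume eq: "\<forall>i\<in>{1..n + 1}. \<forall>j\<in>{1..n + 1}. \<forall>p. V (s i j) p =
      (\<Sum>l = 1..n + 1. entry A i l p * s l j p) - (\<Sum>l = 1..n + 1. s i l p * entry (B_along n Om V) l j p)"
    show "?L = ?M"
    proof (rule mat_eqI_entry)
      show "?L \<in> carrier_mat (n + 1) (n + 1)" using C(1) by simp
      show "?M \<in> carrier_mat (n + 1) (n + 1)" using c by (intro minus_carrier_mat)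
      show "entry ?L i j = entry ?M i j" if ij: "i \<in> {1..n + 1}" "j \<in> {1..n + 1}" for i j
      proof
        fix p show "entry ?L i j p = entry ?M i j p"
          unfolding L[OF ij] R[OF ij] using eq ij by blast
      qed
    qed
  qed
qed

lemma entry_B_along:
  assumes ij: "i \<in> {1..n + 1}" "j \<in> {1..n + 1}"
  shows "entry (B_along n Om V) i j p =
    V tx p * on_T n Om (\<lambda>p. entry (B1 n (pt_x p) (pt_y p)) i j) p +
    V ty p * on_T n Om (\<lambda>p. entry (B2 n (pt_x p) (pt_y p)) i j) p"
  unfolding B_along_def
  by (subst entry_add[where N = "n + 1"], simp_all only: ij smult_carrier_mat mat1_carrier)
    (subst entry_smult[where N = "n + 1"], simp_all only: ij mat1_carrier entry_mat1 times_fun_apply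
      plus_fun_apply, subst entry_smult[where N = "n + 1"],
      simp_all only: ij mat1_carrier entry_mat1 times_fun_apply)

definition b_last :: "nat \<Rightarrow> func" where
  "b_last j = on_T n Om (\<lambda>p. entry (B1 n (pt_x p) (pt_y p)) (n + 1) j)"

lemma b_last_regular: "j \<in> {1..n + 1} \<Longrightarrow> b_last j \<in> OT"
  unfolding b_last_def by (rule base_function_regular[OF B1_base_function]) auto

text \<open>\<open>B1\<close> is a companion matrix, so multiplying S by it shifts the columns by
  one and adds multiples of the last column.\<close>

lemma S_mult_B1:
  assumes p: "p \<in> T n Om" and ij: "i \<in> {1..n + 1}" "j \<in> {1..n + 1}"
  shows "(\<Sum>l = 1..n + 1. s i l p * entry (B1 n (pt_x p) (pt_y p)) l j) =
    (if 2 \<le> j then s i (j - 1) p else 0) + s i (n + 1) p * b_last j p"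
proof -
  have "(\<Sum>l = 1..n. s i l p * entry (B1 n (pt_x p) (pt_y p)) l j) =
      (\<Sum>l = 1..n. if l = j - 1 then s i l p else 0)"
    by (intro sum.cong refl) (use ij in \<open>auto simp: B1_def\<close>)
  also have "\<dots> = (if 2 \<le> j then s i (j - 1) p else 0)"
    using ij by (subst sum.delta) auto
  finally show ?thesis using p by (simp add: b_last_def)
qed

end

locale gauss_manin = dwork_family +
  fixes V :: vfield and A :: "func mat"
  assumes V: "V \<in> VF" and gm: "is_gauss_manin_matrix n Om V A"
begin

text \<open>With \<open>mu\<close> and \<open>ka\<close> one has B(V) = ka B1 - mu diag(1, ..., n +
  1) on T. They are treated as the two unknowns that describe the motion of V on the base.\<close>

definition mu :: func where
  "mu = on_T n Om (\<lambda>p. V ty p / (of_nat (n + 2) * pt_y p))"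

definition ka :: func where
  "ka = on_T n Om (\<lambda>p. V tx p - pt_x p * mu p)"

lemma A_carrier: "A \<in> carrier_mat (n + 1) (n + 1)"
  using gm by (simp add: is_gauss_manin_matrix_def)

lemma derivative_of_entry:
  assumes p: "p \<in> T n Om" and ij: "i \<in> {1..n + 1}" "j \<in> {1..n + 1}"
  shows "V (s i j) p = (\<Sum>l = 1..n + 1. entry A i l p * s l j p)
    - ka p * ((if 2 \<le> j then s i (j - 1) p else 0) + s i (n + 1) p * b_last j p)
    + of_nat j * mu p * s i j p"
proof -
  have B: "entry (B_along n Om V) l j p =
      ka p * entry (B1 n (pt_x p) (pt_y p)) l j - (if l = j then of_nat j * mu p else 0)"
    if l: "l \<in> {1..n + 1}" for l
    unfolding entry_B_along[OF l ij(2)] on_T_in[OF p] ka_def mu_def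
    by (subst B1_B2_combination[OF T_base[OF p] l ij(2)]) auto
  have "(\<Sum>l = 1..n + 1. s i l p * entry (B_along n Om V) l j p) =
      (\<Sum>l = 1..n + 1. ka p * (s i l p * entry (B1 n (pt_x p) (pt_y p)) l j) -
        (if l = j then of_nat j * mu p * s i l p else 0))"
    by (intro sum.cong refl, subst B) (simp_all add: algebra_simps)
  also have "\<dots> = ka p * (\<Sum>l = 1..n + 1. s i l p * entry (B1 n (pt_x p) (pt_y p)) l j) -
      of_nat j * mu p * s i j p"
    unfolding sum_subtractf sum_distrib_left[symmetric] using ij by (subst sum.delta) auto
  also have "(\<Sum>l = 1..n + 1. s i l p * entry (B1 n (pt_x p) (pt_y p)) l j) =
      (if 2 \<le> j then s i (j - 1) p else 0) + s i (n + 1) p * b_last j p"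
    by (rule S_mult_B1[OF p ij])
  finally have "(\<Sum>l = 1..n + 1. s i l p * entry (B_along n Om V) l j p) =
      ka p * ((if 2 \<le> j then s i (j - 1) p else 0) + s i (n + 1) p * b_last j p) -
      of_nat j * mu p * s i j p" .
  moreover have "V (s i j) p =
      (\<Sum>l = 1..n + 1. entry A i l p * s l j p) - (\<Sum>l = 1..n + 1. s i l p * entry (B_along n Om V) l j p)"
    using gm gauss_manin_iff[OF A_carrier, of V] ij by (auto simp: is_gauss_manin_matrix_def)
  ultimately show ?thesis by simp
qed

text \<open>The entry \<open>s 1 1\<close> is constantly 1, so the entry (1, 1) of the Gauss--Manin
  equation has left-hand side 0 and its diagonal part is \<open>mu\<close> itself.\<close>

lemma mu_eq:
  assumes p: "p \<in> T n Om"
  shows "mu p = - (\<Sum>l = 1..n + 1. entry A 1 l p * s l 1 p)"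
proof -
  have "V (s 1 1) p = 0" unfolding s_11 VF_cst[OF V] by simp
  moreover have "s 1 (n + 1) p = 0" by (rule s_upper_apply) (use n_pos in auto)
  moreover have "s 1 1 p = 1" using p by (simp only: s_11 on_T_in)
  ultimately show ?thesis
    using derivative_of_entry[OF p, of 1 1] by (simp add: add_eq_0_iff)
qed

text \<open>The entry \<open>s 1 2\<close> is constantly 0, while the column shift brings
  \<open>s 1 1\<close> = 1 into column 2 with coefficient \<open>ka\<close>.\<close>

lemma ka_eq:
  assumes p: "p \<in> T n Om"
  shows "ka p = (\<Sum>l = 1..n + 1. entry A 1 l p * s l 2 p)"
proof -
  have 2: "2 \<in> {1..n + 1}" "1 \<in> {1..n + 1}" using n_pos by auto
  have "s 1 2 = 0" by (rule s_upper) (use 2 in auto)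
  then have "V (s 1 2) p = 0" "s 1 2 p = 0" by (simp_all add: VF_zero[OF V])
  moreover have "s 1 (n + 1) p = 0" by (rule s_upper_apply) (use n_pos in auto)
  moreover have "s 1 1 p = 1" using p by (simp only: s_11 on_T_in)
  ultimately show ?thesis
    using derivative_of_entry[OF p 2(2) 2(1)] by (simp add: numeral_2_eq_2)
qed

lemma derivative_of_y: "p \<in> T n Om \<Longrightarrow> V ty p = of_nat (n + 2) * pt_y p * mu p"
proof -
  assume p: "p \<in> T n Om"
  have "(of_nat (n + 2) :: complex) \<noteq> 0" by (simp only: of_nat_eq_0_iff)
  then have "of_nat (n + 2) * pt_y p \<noteq> 0" using T_nz(1)[OF p] by (simp only: mult_eq_0_iff simp_thms)
  then show ?thesis using p unfolding mu_def by simp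
qed

lemma derivative_of_x: "p \<in> T n Om \<Longrightarrow> V tx p = ka p + pt_x p * mu p"
  by (simp add: ka_def)

end

section \<open>Vector fields of nilpotent matrices\<close>

text \<open>The exponential of r A when the cube of A is zero. The quadratic term is nonzero for the
  matrix \<open>F_mat\<close> used below when n = 2.\<close>

definition nil_exp :: "nat \<Rightarrow> complex mat \<Rightarrow> complex \<Rightarrow> complex mat" where
  "nil_exp N A r = 1\<^sub>m N + r \<cdot>\<^sub>m A + (r\<^sup>2 / 2) \<cdot>\<^sub>m (A * A)"

lemma nil_exp_carrier [simp]:
  "A \<in> carrier_mat N N \<Longrightarrow> nil_exp N A r \<in> carrier_mat N N"
  by (simp add: nil_exp_def)

lemma nil_exp_mult:
  assumes A: "A \<in> carrier_mat N N" and X: "X \<in> carrier_mat N N"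
  shows "nil_exp N A r * X = X + r \<cdot>\<^sub>m (A * X) + (r\<^sup>2 / 2) \<cdot>\<^sub>m (A * (A * X))"
proof -
  have "nil_exp N A r * X = (1\<^sub>m N + r \<cdot>\<^sub>m A) * X + ((r\<^sup>2 / 2) \<cdot>\<^sub>m (A * A)) * X"
    unfolding nil_exp_def by (rule add_mult_distrib_mat[where nr = N and n = N and nc = N]) (use A X in auto)
  also have "(1\<^sub>m N + r \<cdot>\<^sub>m A) * X = 1\<^sub>m N * X + (r \<cdot>\<^sub>m A) * X"
    by (rule add_mult_distrib_mat[where nr = N and n = N and nc = N]) (use A X in auto)
  also have "1\<^sub>m N * X = X" using X by simp
  also have "(r \<cdot>\<^sub>m A) * X = r \<cdot>\<^sub>m (A * X)" by (rule mult_smult_assoc_mat[OF A X])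
  also have "((r\<^sup>2 / 2) \<cdot>\<^sub>m (A * A)) * X = (r\<^sup>2 / 2) \<cdot>\<^sub>m ((A * A) * X)"
    by (rule mult_smult_assoc_mat[OF mult_carrier_mat[OF A A] X])
  also have "(A * A) * X = A * (A * X)" by (rule assoc_mult_mat[OF A A X])
  finally show ?thesis .
qed

lemma mult_transpose_nil_exp:
  assumes A: "A \<in> carrier_mat N N" and P: "P \<in> carrier_mat N N"
  shows "P * (nil_exp N A r)\<^sup>T = P + r \<cdot>\<^sub>m (P * A\<^sup>T) + (r\<^sup>2 / 2) \<cdot>\<^sub>m ((P * A\<^sup>T) * A\<^sup>T)"
proof -
  have "(P * (nil_exp N A r)\<^sup>T)\<^sup>T = nil_exp N A r * P\<^sup>T"
    using A P by (subst transpose_mult[where nr = N and n = N and nc = N]) auto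
  also have "\<dots> = P\<^sup>T + r \<cdot>\<^sub>m (A * P\<^sup>T) + (r\<^sup>2 / 2) \<cdot>\<^sub>m (A * (A * P\<^sup>T))"
    by (rule nil_exp_mult) (use A P in auto)
  also have "A * P\<^sup>T = (P * A\<^sup>T)\<^sup>T"
    using A P by (subst transpose_mult[where nr = N and n = N and nc = N]) auto
  also have "A * (P * A\<^sup>T)\<^sup>T = ((P * A\<^sup>T) * A\<^sup>T)\<^sup>T"
    using A P by (subst (2) transpose_mult[where nr = N and n = N and nc = N]) auto
  also have "P\<^sup>T + r \<cdot>\<^sub>m (P * A\<^sup>T)\<^sup>T + (r\<^sup>2 / 2) \<cdot>\<^sub>m ((P * A\<^sup>T) * A\<^sup>T)\<^sup>T =
      (P + r \<cdot>\<^sub>m (P * A\<^sup>T) + (r\<^sup>2 / 2) \<cdot>\<^sub>m ((P * A\<^sup>T) * A\<^sup>T))\<^sup>T"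
    by (rule eq_matI) (use A P in auto)
  finally show ?thesis by (metis transpose_transpose)
qed

text \<open>Because \<open>P * A\<^sup>T\<close> is - A P, the right factor passes across P as the
  exponential of - r A, and the cube of A being zero makes the two truncated exponentials cancel
  exactly.\<close>

lemma nil_exp_congruence:
  assumes A: "A \<in> carrier_mat N N" and P: "P \<in> carrier_mat N N"
    and lie: "A * P + P * A\<^sup>T = 0\<^sub>m N N" and nil: "A * (A * A) = 0\<^sub>m N N"
  shows "nil_exp N A r * P * (nil_exp N A r)\<^sup>T = P"
proof -
  have AP: "A * P \<in> carrier_mat N N" and AAP: "A * (A * P) \<in> carrier_mat N N"
    using A P by auto
  have 1: "P * A\<^sup>T = - (A * P)"
  proof (rule eq_matI)
    fix i j assume ij: "i < dim_row (- (A * P))" "j < dim_col (- (A * P))"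
    then have "(A * P + P * A\<^sup>T) $$ (i, j) = 0" unfolding lie using A P by simp
    then have "(A * P) $$ (i, j) + (P * A\<^sup>T) $$ (i, j) = 0"
      using ij A P by (subst (asm) index_add_mat) auto
    moreover have "(- (A * P)) $$ (i, j) = - (A * P) $$ (i, j)"
      using ij by (intro index_uminus_mat) auto
    ultimately show "(P * A\<^sup>T) $$ (i, j) = (- (A * P)) $$ (i, j)"
      by (simp only: add_eq_0_iff)
  qed (use A P in auto)
  have "(P * A\<^sup>T) * A\<^sup>T = - ((A * P) * A\<^sup>T)"
    unfolding 1 by (rule uminus_mult_left_mat) (use A P in auto)
  also have "(A * P) * A\<^sup>T = A * (P * A\<^sup>T)"
    by (rule assoc_mult_mat[OF A P]) (use A in auto)
  also have "\<dots> = - (A * (A * P))"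
    unfolding 1 by (rule uminus_mult_right_mat) (use A P in auto)
  finally have 2: "(P * A\<^sup>T) * A\<^sup>T = A * (A * P)" by simp
  \<comment> \<open>This is the truncated exponential of - r A applied to P.\<close>
  define Z where "Z = P + (- r) \<cdot>\<^sub>m (A * P) + (r\<^sup>2 / 2) \<cdot>\<^sub>m (A * (A * P))"
  have Z: "Z \<in> carrier_mat N N" using P AP AAP by (simp add: Z_def)
  have "P * (nil_exp N A r)\<^sup>T = Z"
    unfolding mult_transpose_nil_exp[OF A P] 2 unfolding 1 Z_def
    by (rule eq_matI) (use A P in \<open>auto simp del: index_mult_mat(1)\<close>)
  moreover have "nil_exp N A r * P * (nil_exp N A r)\<^sup>T = nil_exp N A r * (P * (nil_exp N A r)\<^sup>T)"
    by (rule assoc_mult_mat[where ?n\<^sub>1 = N and ?n\<^sub>2 = N and ?n\<^sub>3 = N and ?n\<^sub>4 = N]) (use A P in auto)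
  moreover have "nil_exp N A r * Z = Z + r \<cdot>\<^sub>m (A * Z) + (r\<^sup>2 / 2) \<cdot>\<^sub>m (A * (A * Z))"
    by (rule nil_exp_mult[OF A Z])
  moreover have AZ: "A * Z = A * P + (- r) \<cdot>\<^sub>m (A * (A * P))"
  proof -
    have "A * Z = A * (P + (- r) \<cdot>\<^sub>m (A * P)) + A * ((r\<^sup>2 / 2) \<cdot>\<^sub>m (A * (A * P)))"
      unfolding Z_def by (rule mult_add_distrib_mat) (use A P AP AAP in auto)
    also have "A * (P + (- r) \<cdot>\<^sub>m (A * P)) = A * P + A * ((- r) \<cdot>\<^sub>m (A * P))"
      by (rule mult_add_distrib_mat) (use A P AP in auto)
    also have "A * ((- r) \<cdot>\<^sub>m (A * P)) = (- r) \<cdot>\<^sub>m (A * (A * P))"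
      by (rule mult_smult_distrib[OF A AP])
    also have "A * ((r\<^sup>2 / 2) \<cdot>\<^sub>m (A * (A * P))) = (r\<^sup>2 / 2) \<cdot>\<^sub>m (A * (A * (A * P)))"
      by (rule mult_smult_distrib[OF A AAP])
    also have "A * (A * (A * P)) = (A * (A * A)) * P"
      using A P by (simp add: assoc_mult_mat[where ?n\<^sub>1 = N and ?n\<^sub>2 = N and ?n\<^sub>3 = N and ?n\<^sub>4 = N])
    also have "\<dots> = 0\<^sub>m N N" unfolding nil using P by simp
    finally show ?thesis using A P AAP by simp
  qed
  moreover have "A * (A * Z) = A * (A * P)"
  proof -
    have "A * (A * Z) = A * (A * P) + A * ((- r) \<cdot>\<^sub>m (A * (A * P)))"
      unfolding AZ by (rule mult_add_distrib_mat) (use A AP AAP in auto)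
    also have "A * ((- r) \<cdot>\<^sub>m (A * (A * P))) = (- r) \<cdot>\<^sub>m (A * (A * (A * P)))"
      by (rule mult_smult_distrib[OF A AAP])
    also have "A * (A * (A * P)) = (A * (A * A)) * P"
      using A P by (simp add: assoc_mult_mat[where ?n\<^sub>1 = N and ?n\<^sub>2 = N and ?n\<^sub>3 = N and ?n\<^sub>4 = N])
    also have "\<dots> = 0\<^sub>m N N" unfolding nil using P by simp
    finally show ?thesis using A P AAP by simp
  qed
  moreover have "Z + r \<cdot>\<^sub>m (A * P + (- r) \<cdot>\<^sub>m (A * (A * P))) + (r\<^sup>2 / 2) \<cdot>\<^sub>m (A * (A * P)) = P"
  proof (rule eq_matI)
    fix i j assume "i < dim_row P" "j < dim_col P"
    then show "(Z + r \<cdot>\<^sub>m (A * P + (- r) \<cdot>\<^sub>m (A * (A * P))) + (r\<^sup>2 / 2) \<cdot>\<^sub>m (A * (A * P))) $$ (i, j) =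
        P $$ (i, j)"
      using A P unfolding Z_def
      by (simp add: power2_eq_square field_simps del: index_mult_mat(1))
  qed (use A P in \<open>auto simp: Z_def\<close>)
  ultimately show ?thesis by (simp only:)
qed

section \<open>Flows on the moduli space and their derivatives\<close>

context dwork_family
begin

definition flow :: "complex mat \<Rightarrow> complex \<Rightarrow> point \<Rightarrow> point" where
  "flow A r p = Point (pt_x p) (pt_y p) (nil_exp (n + 1) A r * pt_S p)"

lemma flow_base [simp]: "pt_x (flow A r p) = pt_x p" "pt_y (flow A r p) = pt_y p"
  by (simp_all add: flow_def)

lemma lower_mult_strictly_lower:
  fixes A X :: "complex mat"
  assumes A: "A \<in> carrier_mat N N" and X: "X \<in> carrier_mat N N"
    and Alow: "\<And>i j. i \<in> {1..N} \<Longrightarrow> j \<in> {1..N} \<Longrightarrow> i \<le> j \<Longrightarrow> entry A i j = 0"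
    and Xlow: "\<And>i j. i \<in> {1..N} \<Longrightarrow> j \<in> {1..N} \<Longrightarrow> i < j \<Longrightarrow> entry X i j = 0"
    and ij: "i \<in> {1..N}" "j \<in> {1..N}" "i \<le> j"
  shows "entry (A * X) i j = 0"
  unfolding entry_mult[OF A X ij(1,2)]
proof (intro sum.neutral ballI)
  fix l assume "l \<in> {1..N}"
  then show "entry A i l * entry X l j = 0"
    using ij Alow[of i l] Xlow[of l j] by (cases "i \<le> l") auto
qed

context
  fixes A :: "complex mat"
  assumes A: "A \<in> carrier_mat (n + 1) (n + 1)"
    and low: "\<And>i j. i \<in> {1..n + 1} \<Longrightarrow> j \<in> {1..n + 1} \<Longrightarrow> i \<le> j \<Longrightarrow> entry A i j = 0"
    and nil: "A * (A * A) = 0\<^sub>m (n + 1) (n + 1)"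
    and lie: "A * Phi n + Phi n * A\<^sup>T = 0\<^sub>m (n + 1) (n + 1)"
begin

lemma flow_entry:
  assumes p: "p \<in> T n Om" and ij: "i \<in> {1..n + 1}" "j \<in> {1..n + 1}"
  shows "entry (nil_exp (n + 1) A r * pt_S p) i j =
    entry (pt_S p) i j + r * entry (A * pt_S p) i j + r\<^sup>2 / 2 * entry (A * (A * pt_S p)) i j"
proof -
  have S: "pt_S p \<in> carrier_mat (n + 1) (n + 1)" by (rule T_carrier[OF p])
  have c: "A * pt_S p \<in> carrier_mat (n + 1) (n + 1)" "A * (A * pt_S p) \<in> carrier_mat (n + 1) (n + 1)"
    using A S by (meson mult_carrier_mat)+
  show ?thesis unfolding nil_exp_mult[OF A S]
    by (subst entry_add[OF _ _ ij], simp_all only: c S add_carrier_mat smult_carrier_mat)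
      (subst entry_add[OF _ _ ij], simp_all only: c S smult_carrier_mat entry_smult[OF _ ij])
qed

lemma strictly_lower_translates:
  assumes p: "p \<in> T n Om" and ij: "i \<in> {1..n + 1}" "j \<in> {1..n + 1}" "i \<le> j"
  shows "entry (A * pt_S p) i j = 0" "entry (A * (A * pt_S p)) i j = 0"
proof -
  have S: "pt_S p \<in> carrier_mat (n + 1) (n + 1)" by (rule T_carrier[OF p])
  have AS: "A * pt_S p \<in> carrier_mat (n + 1) (n + 1)" using A S by (meson mult_carrier_mat)
  have Slow: "entry (pt_S p) i j = 0" if "i \<in> {1..n + 1}" "j \<in> {1..n + 1}" "i < j" for i j
    using s_upper_apply[of i j p] that p by (simp add: s_in)
  have 1: "entry (A * pt_S p) i j = 0" if "i \<in> {1..n + 1}" "j \<in> {1..n + 1}" "i \<le> j" for i j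
    by (rule lower_mult_strictly_lower[OF A S low Slow that])
  show "entry (A * pt_S p) i j = 0" by (rule 1[OF ij])
  show "entry (A * (A * pt_S p)) i j = 0"
    by (rule lower_mult_strictly_lower[OF A AS low 1 ij]) auto
qed

lemma flow_in_T:
  assumes p: "p \<in> T n Om"
  shows "flow A r p \<in> T n Om"
proof -
  let ?E = "nil_exp (n + 1) A r" and ?S = "pt_S p" and ?O = "Om (pt_x p) (pt_y p)"
  have S: "?S \<in> carrier_mat (n + 1) (n + 1)" by (rule T_carrier[OF p])
  have O: "?O \<in> carrier_mat (n + 1) (n + 1)" by (rule Om_carrier[OF T_base[OF p]])
  have E: "?E \<in> carrier_mat (n + 1) (n + 1)" using A by (rule nil_exp_carrier)
  have ES: "?E * ?S \<in> carrier_mat (n + 1) (n + 1)" by (rule mult_carrier_mat[OF E S])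
  have SO: "?S * ?O \<in> carrier_mat (n + 1) (n + 1)" by (rule mult_carrier_mat[OF S O])
  have t: "?S\<^sup>T \<in> carrier_mat (n + 1) (n + 1)" "?E\<^sup>T \<in> carrier_mat (n + 1) (n + 1)"
    using S E by auto
  have "(?E * ?S) * ?O * (?E * ?S)\<^sup>T = (?E * (?S * ?O)) * (?S\<^sup>T * ?E\<^sup>T)"
    by (simp only: assoc_mult_mat[OF E S O] transpose_mult[OF E S])
  also have "\<dots> = ?E * ((?S * ?O) * (?S\<^sup>T * ?E\<^sup>T))"
    by (rule assoc_mult_mat[OF E SO mult_carrier_mat[OF t]])
  also have "(?S * ?O) * (?S\<^sup>T * ?E\<^sup>T) = (?S * ?O * ?S\<^sup>T) * ?E\<^sup>T"
    by (rule assoc_mult_mat[OF SO t, symmetric])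
  also have "?S * ?O * ?S\<^sup>T = Phi n" by (rule T_congruence[OF p])
  also have "?E * (Phi n * ?E\<^sup>T) = ?E * Phi n * ?E\<^sup>T"
    by (rule assoc_mult_mat[OF E Phi_carrier t(2), symmetric])
  also have "\<dots> = Phi n" by (rule nil_exp_congruence[OF A Phi_carrier lie nil])
  finally have cong: "(?E * ?S) * ?O * (?E * ?S)\<^sup>T = Phi n" .
  have low': "entry (?E * ?S) i j = entry ?S i j" if "i \<in> {1..n + 1}" "j \<in> {1..n + 1}" "i \<le> j" for i j
    unfolding flow_entry[OF p that(1,2)] strictly_lower_translates[OF p that] by simp
  have "upper_triangular (?E * ?S)\<^sup>T"
  proof (rule upper_triangularI)
    fix i j assume ij: "j < i" "i < dim_row (?E * ?S)\<^sup>T"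
    then have r: "i + 1 \<in> {1..n + 1}" "j + 1 \<in> {1..n + 1}" "j + 1 < i + 1" using ES by auto
    have "entry (?E * ?S) (j + 1) (i + 1) = entry ?S (j + 1) (i + 1)" by (rule low') (use r in auto)
    also have "\<dots> = 0" using s_upper_apply[OF r(3) r(2) r(1), of p] p by (simp only: s_in)
    finally have "(?E * ?S) $$ (j, i) = 0" by (simp add: entry_def)
    moreover have "(?E * ?S)\<^sup>T $$ (i, j) = (?E * ?S) $$ (j, i)"
      using r ES by (intro index_transpose_mat) auto
    ultimately show "(?E * ?S)\<^sup>T $$ (i, j) = 0" by (simp only:)
  qed
  moreover have "entry (?E * ?S) 1 1 = 1"
  proof -
    have "entry (?E * ?S) 1 1 = entry ?S 1 1" by (rule low') auto
    then show ?thesis using p by (auto simp: T_def)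
  qed
  moreover have "invertible_mat (?E * ?S)" by (rule congruent_Phi_invertible[OF ES O cong])
  ultimately show ?thesis
    unfolding T_def flow_def using T_base[OF p] ES cong by blast
qed

lemma s_flow:
  assumes p: "p \<in> T n Om" and ij: "i \<in> {1..n + 1}" "j \<in> {1..n + 1}"
  shows "s i j (flow A r p) =
    s i j p + r * entry (A * pt_S p) i j + r\<^sup>2 / 2 * entry (A * (A * pt_S p)) i j"
  unfolding s_in[OF flow_in_T[OF p]] s_in[OF p] flow_entry[OF p ij, symmetric] by (simp add: flow_def)

lemma s_flow_diag:
  assumes p: "p \<in> T n Om" and i: "i \<in> {1..n + 1}"
  shows "s i i (flow A r p) = s i i p"
  unfolding s_flow[OF p i i] strictly_lower_translates[OF p i i order_refl] by simp

definition translate :: "nat \<Rightarrow> nat \<Rightarrow> func" where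
  "translate i j = (\<Sum>l = 1..n + 1. cst (entry A i l) * s l j)"

lemma translate_apply:
  assumes p: "p \<in> T n Om" and ij: "i \<in> {1..n + 1}" "j \<in> {1..n + 1}"
  shows "translate i j p = entry (A * pt_S p) i j"
  unfolding translate_def sum_fun_apply entry_mult[OF A T_carrier[OF p] ij]
  using p by (simp add: s_in)

lemma translate_regular: "j \<in> {1..n + 1} \<Longrightarrow> translate i j \<in> OT"
  unfolding translate_def by (intro O_T_sum O_T.mult O_T.const s_regular)

lemma s_flow_derivative:
  assumes p: "p \<in> T n Om" and ij: "i \<in> {1..n + 1}" "j \<in> {1..n + 1}"
  shows "((\<lambda>r. s i j (flow A r p)) has_field_derivative translate i j p) (at 0)"
  unfolding s_flow[OF p ij] translate_apply[OF p ij]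
  by (auto intro!: derivative_eq_intros)

text \<open>Regularity of g is included so that one induction over \<open>O_T\<close> yields both
  that the derivative exists and that it is regular. As regular functions vanish off T, g is also
  unique.\<close>

definition is_flow_derivative :: "func \<Rightarrow> func \<Rightarrow> bool" where
  "is_flow_derivative f g \<longleftrightarrow> g \<in> OT \<and>
     (\<forall>p\<in>T n Om. ((\<lambda>r. f (flow A r p)) has_field_derivative g p) (at 0))"

lemma is_flow_derivative_unique:
  assumes "is_flow_derivative f g" "is_flow_derivative f h"
  shows "g = h"
proof
  fix p
  show "g p = h p"
    using assms O_T_vanish[of g p] O_T_vanish[of h p]
      DERIV_unique[of "\<lambda>r. f (flow A r p)" "g p" 0 "h p"]
    by (cases "p \<in> T n Om") (auto simp: is_flow_derivative_def)
qed

lemma is_flow_derivative_invariant: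
  assumes "\<And>p r. p \<in> T n Om \<Longrightarrow> f (flow A r p) = f p"
  shows "is_flow_derivative f 0"
  using assms O_T_zero by (auto simp: is_flow_derivative_def)

lemma is_flow_derivative_add:
  assumes "is_flow_derivative f f'" "is_flow_derivative g g'"
  shows "is_flow_derivative (f + g) (f' + g')"
  unfolding is_flow_derivative_def
proof (intro conjI ballI)
  show "f' + g' \<in> OT" using assms by (intro O_T.add) (auto simp: is_flow_derivative_def)
  fix p assume "p \<in> T n Om"
  then have "((\<lambda>r. f (flow A r p) + g (flow A r p)) has_field_derivative f' p + g' p) (at 0)"
    using assms by (intro DERIV_add) (auto simp: is_flow_derivative_def)
  then show "((\<lambda>r. (f + g) (flow A r p)) has_field_derivative (f' + g') p) (at 0)" by simp
qed

lemma is_flow_derivative_mult: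
  assumes f: "is_flow_derivative f f'" "f \<in> OT" and g: "is_flow_derivative g g'" "g \<in> OT"
  shows "is_flow_derivative (f * g) (f' * g + f * g')"
  unfolding is_flow_derivative_def
proof (intro conjI ballI)
  show "f' * g + f * g' \<in> OT"
    using assms by (intro O_T.add O_T.mult) (auto simp: is_flow_derivative_def)
  fix p assume p: "p \<in> T n Om"
  have S: "pt_S p \<in> carrier_mat (n + 1) (n + 1)" by (rule T_carrier[OF p])
  have 0: "flow A 0 p = p"
  proof -
    have "nil_exp (n + 1) A 0 * pt_S p = pt_S p"
      unfolding nil_exp_mult[OF A S] by (rule eq_matI) (use A S in auto)
    then show ?thesis by (cases p) (simp add: flow_def)
  qed
  have "((\<lambda>r. f (flow A r p) * g (flow A r p)) has_field_derivative
      f' p * g (flow A 0 p) + g' p * f (flow A 0 p)) (at 0)"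
    using f g p by (intro DERIV_mult) (auto simp: is_flow_derivative_def)
  then show "((\<lambda>r. (f * g) (flow A r p)) has_field_derivative (f' * g + f * g') p) (at 0)"
    by (simp add: 0 mult.commute)
qed

text \<open>A strictly lower triangular A fixes x, y and the diagonal of S, hence u,
  \<open>t_check\<close> and the inverted function. So no quotient ever has to be differentiated;
  entries of S are quadratic polynomials in r.\<close>

lemma ex_flow_derivative: "f \<in> OT \<Longrightarrow> \<exists>g. is_flow_derivative f g"
proof (induction rule: O_T.induct)
  case (const a)
  show ?case by (rule exI, rule is_flow_derivative_invariant) (simp add: flow_in_T)
next
  case (coord j)
  consider "tcoord n Om j = tx" | "tcoord n Om j = ty"
    | i k where "(i, k) \<in> set (coord_entries n)" "tcoord n Om j = s i k"
    by (rule tcoord_cases[OF n_pos coord.hyps, where Om = Om])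
  then show ?case
  proof cases
    case 1
    show ?thesis unfolding 1 by (rule exI, rule is_flow_derivative_invariant) (simp add: flow_in_T)
  next
    case 2
    show ?thesis unfolding 2 by (rule exI, rule is_flow_derivative_invariant) (simp add: flow_in_T)
  next
    case (3 i k)
    then have "i \<in> {1..n + 1}" "k \<in> {1..n + 1}" by (auto simp: in_coord_entries_iff)
    then have "is_flow_derivative (s i k) (translate i k)"
      using s_flow_derivative translate_regular by (auto simp: is_flow_derivative_def)
    then show ?thesis using 3(2) by auto
  qed
next
  case u
  show ?case unfolding u_coord_def
    by (rule exI, rule is_flow_derivative_invariant, rule s_flow_diag) (use n_pos in auto)
next
  case inv
  have "t_check n Om (flow A r p) = t_check n Om p" if p: "p \<in> T n Om" for p r
    unfolding t_check_eq
  proof (rule prod.cong[OF refl])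
    fix e assume "e \<in> diag_coords"
    then show "s (fst e) (snd e) (flow A r p) = s (fst e) (snd e) p"
      using s_flow_diag[OF p] by (cases e) (auto simp: in_diag_coords_iff)
  qed
  then show ?case
    by (intro exI[of _ 0] is_flow_derivative_invariant) (simp add: flow_in_T)
next
  case (add f g)
  then show ?case using is_flow_derivative_add by blast
next
  case (mult f g)
  then show ?case using is_flow_derivative_mult by blast
qed

definition flow_field :: vfield where
  "flow_field f = (if f \<in> OT then (SOME g. is_flow_derivative f g) else 0)"

lemma flow_field_eqI: "f \<in> OT \<Longrightarrow> is_flow_derivative f g \<Longrightarrow> flow_field f = g"
  unfolding flow_field_def using is_flow_derivative_unique someI[of "is_flow_derivative f" g] by auto

lemma is_flow_derivative_flow_field: "f \<in> OT \<Longrightarrow> is_flow_derivative f (flow_field f)"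
  using ex_flow_derivative[of f] someI_ex[of "is_flow_derivative f"] by (simp add: flow_field_def)

lemma flow_field_VF: "flow_field \<in> VF"
proof (rule VF_I)
  note D = is_flow_derivative_flow_field
  show "flow_field f \<in> OT" if "f \<in> OT" for f
    using D[OF that] by (simp add: is_flow_derivative_def)
  show "flow_field f = 0" if "f \<notin> OT" for f using that by (simp add: flow_field_def)
  show "flow_field (f + g) = flow_field f + flow_field g" if "f \<in> OT" "g \<in> OT" for f g
    by (intro flow_field_eqI O_T.add is_flow_derivative_add D that)
  show mult: "flow_field (f * g) = flow_field f * g + f * flow_field g" if "f \<in> OT" "g \<in> OT" for f g
    by (intro flow_field_eqI O_T.mult is_flow_derivative_mult D that)
  show "flow_field ((\<lambda>_. a) * f) = (\<lambda>_. a) * flow_field f" if "f \<in> OT" for a f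
  proof -
    have e: "(\<lambda>_. a) * g = cst a * g" if "g \<in> OT" for g
      using O_T_vanish[OF that] by (fastforce simp: on_T_def)
    have "flow_field (cst a) = 0"
      by (intro flow_field_eqI O_T.const is_flow_derivative_invariant) (simp add: flow_in_T)
    then have "flow_field (cst a * f) = cst a * flow_field f"
      using mult[OF O_T.const that] by simp
    moreover have "flow_field f \<in> OT" using D[OF that] by (simp add: is_flow_derivative_def)
    ultimately show ?thesis using e[OF that] e[of "flow_field f"] by (simp only:)
  qed
qed

lemma flow_field_coordinates:
  shows "flow_field tx = 0" "flow_field ty = 0"
    and "i \<in> {1..n + 1} \<Longrightarrow> j \<in> {1..n + 1} \<Longrightarrow> flow_field (s i j) = translate i j"
proof -
  show "flow_field tx = 0"
    by (intro flow_field_eqI tx_regular is_flow_derivative_invariant) (simp add: flow_in_T)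
  show "flow_field ty = 0"
    by (intro flow_field_eqI ty_regular is_flow_derivative_invariant) (simp add: flow_in_T)
  show "flow_field (s i j) = translate i j" if "i \<in> {1..n + 1}" "j \<in> {1..n + 1}"
    by (rule flow_field_eqI)
      (use that s_regular s_flow_derivative translate_regular in \<open>auto simp: is_flow_derivative_def\<close>)
qed

end

lemma entry_const_mat:
  assumes "g \<in> carrier_mat (n + 1) (n + 1)" "i \<in> {1..n + 1}" "j \<in> {1..n + 1}"
  shows "entry (const_mat n Om g) i j = cst (entry g i j)"
  unfolding const_mat_def by (rule entry_map_mat[OF assms])

lemma const_mat_regular:
  assumes g: "g \<in> carrier_mat (n + 1) (n + 1)"
  shows "const_mat n Om g \<in> carrier_mat (n + 1) (n + 1)" "elements_mat (const_mat n Om g) \<subseteq> OT"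
proof -
  show c: "const_mat n Om g \<in> carrier_mat (n + 1) (n + 1)" using g by (simp add: const_mat_def)
  show "elements_mat (const_mat n Om g) \<subseteq> OT"
    by (rule elements_mat_subsetI[OF c]) (simp only: entry_const_mat[OF g] O_T.const)
qed

text \<open>A field that kills x and y has B(V) = 0, so the Gauss--Manin equation reduces to V(S) =
  A S, and \<open>is_R_g\<close> records the transpose of A.\<close>

lemma is_R_g_I:
  assumes V: "V \<in> VF" and A: "A \<in> carrier_mat (n + 1) (n + 1)"
    and xy: "V tx = 0" "V ty = 0"
    and s: "\<And>i j. i \<in> {1..n + 1} \<Longrightarrow> j \<in> {1..n + 1} \<Longrightarrow>
      V (s i j) = (\<Sum>l = 1..n + 1. cst (entry A i l) * s l j)"
  shows "is_R_g n Om A\<^sup>T V"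
proof -
  have B: "entry (B_along n Om V) i j p = 0" if "i \<in> {1..n + 1}" "j \<in> {1..n + 1}" for i j p
    unfolding entry_B_along[OF that] xy by simp
  have "V (s i j) p = (\<Sum>l = 1..n + 1. entry (const_mat n Om A) i l p * s l j p) -
      (\<Sum>l = 1..n + 1. s i l p * entry (B_along n Om V) l j p)"
    if ij: "i \<in> {1..n + 1}" "j \<in> {1..n + 1}" for i j p
  proof -
    have "(\<Sum>l = 1..n + 1. s i l p * entry (B_along n Om V) l j p) = 0"
      by (intro sum.neutral ballI) (use B ij in simp)
    moreover have "V (s i j) p = (\<Sum>l = 1..n + 1. entry (const_mat n Om A) i l p * s l j p)"
      unfolding s[OF ij] sum_fun_apply
      by (intro sum.cong refl) (use ij A in \<open>simp add: entry_const_mat\<close>)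
    ultimately show ?thesis by simp
  qed
  then have "map_mat V (S_mat n Om) = const_mat n Om A * S_mat n Om - S_mat n Om * B_along n Om V"
    using gauss_manin_iff[OF const_mat_regular(1)[OF A]] by blast
  then show ?thesis
    using V const_mat_regular[OF A] by (simp add: is_R_g_def is_gauss_manin_matrix_def)
qed

lemma lie_G_I:
  assumes A: "A \<in> carrier_mat (n + 1) (n + 1)"
    and low: "\<And>i j. i \<in> {1..n + 1} \<Longrightarrow> j \<in> {1..n + 1} \<Longrightarrow> i < j \<Longrightarrow> entry A i j = 0"
    and lie: "A * Phi n + Phi n * A\<^sup>T = 0\<^sub>m (n + 1) (n + 1)"
  shows "A\<^sup>T \<in> lie_G n"
proof -
  have "upper_triangular A\<^sup>T"
  proof (rule upper_triangularI)
    fix i j assume ij: "j < i" "i < dim_row A\<^sup>T"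
    have "entry A (j + 1) (i + 1) = 0" by (rule low) (use ij A in auto)
    then show "A\<^sup>T $$ (i, j) = 0" using ij A by (simp add: entry_def)
  qed
  then show ?thesis using A lie by (simp add: lie_G_def)
qed

lemma ex_nilpotent_R_g:
  assumes A: "A \<in> carrier_mat (n + 1) (n + 1)"
    and strictly_lower: "\<forall>i\<in>{1..n + 1}. \<forall>j\<in>{1..n + 1}. i \<le> j \<longrightarrow> entry A i j = 0"
    and nil: "A * (A * A) = 0\<^sub>m (n + 1) (n + 1)"
    and lie: "A * Phi n + Phi n * A\<^sup>T = 0\<^sub>m (n + 1) (n + 1)"
  obtains V where "is_R_g n Om A\<^sup>T V" "V tx = 0" "V ty = 0"
    "\<And>i j. i \<in> {1..n + 1} \<Longrightarrow> j \<in> {1..n + 1} \<Longrightarrow>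
      V (s i j) = (\<Sum>l = 1..n + 1. cst (entry A i l) * s l j)"
proof
  have low: "entry A i j = 0" if "i \<in> {1..n + 1}" "j \<in> {1..n + 1}" "i \<le> j" for i j
    using strictly_lower that by blast
  have F: "flow_field A \<in> VF"
    by (rule flow_field_VF[OF A _ nil lie]) (rule low; assumption)
  show x: "flow_field A tx = 0"
    by (rule flow_field_coordinates(1)[OF A _ nil lie]) (rule low; assumption)
  show y: "flow_field A ty = 0"
    by (rule flow_field_coordinates(2)[OF A _ nil lie]) (rule low; assumption)
  show s: "flow_field A (s i j) = (\<Sum>l = 1..n + 1. cst (entry A i l) * s l j)"
    if "i \<in> {1..n + 1}" "j \<in> {1..n + 1}" for i j
  proof -
    have "flow_field A (s i j) = translate A i j"
      by (rule flow_field_coordinates(3)[OF A _ nil lie that]) (rule low; assumption)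
    also have "\<dots> = (\<Sum>l = 1..n + 1. cst (entry A i l) * s l j)"
      by (rule translate_def[OF A _ nil lie]) (rule low; assumption)
    finally show ?thesis .
  qed
  show "is_R_g n Om A\<^sup>T (flow_field A)"
    by (rule is_R_g_I[OF F A x y s])
qed

end

section \<open>The radial vector field\<close>

context dwork_family
begin

text \<open>The factor 1 + delta of the theorem, which is at the same time the weight of x under
  H.\<close>

definition wt1 :: complex where
  "wt1 = (if n = 2 then 2 else 1)"

text \<open>The diagonal of the Gauss--Manin matrix of H; its first entry is -
  \<open>wt1\<close>.\<close>

definition row_weight :: "nat \<Rightarrow> complex" where
  "row_weight i = (if n = 2 then (if i = 1 then - 2 else if i = 3 then 2 else 0)
     else if i = 1 then - 1 else if i = n + 1 then 1 else if i = 2 then 1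
     else if i = n then - 1 else 0)"

definition entry_weight :: "nat \<Rightarrow> nat \<Rightarrow> complex" where
  "entry_weight i j = row_weight i + wt1 * of_nat j"

text \<open>For diagonal g the first row of the equation gives mu = - d 1 and, since
  \<open>s 1 2\<close> is zero, ka = 0. This removes \<open>B1\<close>, and the remaining equation
  is diagonal in the entries of S.\<close>

lemma diagonal_R_g:
  assumes g: "g \<in> carrier_mat (n + 1) (n + 1)"
    and d: "\<forall>i\<in>{1..n + 1}. \<forall>j\<in>{1..n + 1}. entry g i j = (if i = j then d i else 0)"
    and R: "is_R_g n Om g V"
  shows "V \<in> VF" "weight V (- d 1) tx" "weight V (- of_nat (n + 2) * d 1) ty"
    and "\<And>i j. i \<in> {1..n + 1} \<Longrightarrow> j \<in> {1..n + 1} \<Longrightarrow> weight V (d i - d 1 * of_nat j) (s i j)"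
proof -
  show V: "V \<in> VF" using R by (simp add: is_R_g_def)
  interpret gauss_manin n c Om V "const_mat n Om g\<^sup>T"
    by standard (use R in \<open>auto simp: is_R_g_def\<close>)
  have e: "entry (const_mat n Om g\<^sup>T) i l = cst (if i = l then d i else 0)"
    if "i \<in> {1..n + 1}" "l \<in> {1..n + 1}" for i l
    using that g by (subst entry_const_mat) (auto simp: entry_transpose d)
  have row: "(\<Sum>l = 1..n + 1. entry (const_mat n Om g\<^sup>T) i l p * s l j p) = d i * s i j p"
    if p: "p \<in> T n Om" and i: "i \<in> {1..n + 1}" for p i j
  proof -
    have "(\<Sum>l = 1..n + 1. entry (const_mat n Om g\<^sup>T) i l p * s l j p) =
        (\<Sum>l = 1..n + 1. if l = i then d i * s i j p else 0)"
      by (intro sum.cong refl) (use i p in \<open>auto simp: e\<close>)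
    then show ?thesis using i by simp
  qed
  have 1: "1 \<in> {1..n + 1}" "2 \<in> {1..n + 1}" using n_pos by auto
  have mu: "mu p = - d 1" and ka: "ka p = 0" if p: "p \<in> T n Om" for p
  proof -
    have "s 1 1 p = 1" using p by (simp only: s_11 on_T_in)
    then show "mu p = - d 1" unfolding mu_eq[OF p] row[OF p 1(1)] by (simp only: mult_1_right)
    have "s 1 2 p = 0" by (rule s_upper_apply) (use 1 in auto)
    then show "ka p = 0" unfolding ka_eq[OF p] row[OF p 1(1)] by (simp only: mult_zero_right)
  qed
  have "V tx p = - d 1 * tx p" for p
    using derivative_of_x[of p] mu[of p] ka[of p] by (cases "p \<in> T n Om") (auto simp: VF_out[OF V])
  then show "weight V (- d 1) tx" by (auto simp: weight_def tx_regular fun_eq_iff)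
  have "V ty p = - of_nat (n + 2) * d 1 * ty p" for p
    using derivative_of_y[of p] mu[of p]
    by (cases "p \<in> T n Om") (auto simp: VF_out[OF V] algebra_simps)
  then show "weight V (- of_nat (n + 2) * d 1) ty" by (auto simp: weight_def ty_regular fun_eq_iff)
  show "weight V (d i - d 1 * of_nat j) (s i j)" if ij: "i \<in> {1..n + 1}" "j \<in> {1..n + 1}" for i j
  proof -
    have "V (s i j) p = (d i - d 1 * of_nat j) * s i j p" for p
    proof (cases "p \<in> T n Om")
      case True
      show ?thesis
        unfolding derivative_of_entry[OF True ij] row[OF True ij(1)] mu[OF True] ka[OF True]
        by (simp add: algebra_simps)
    qed (simp add: VF_out[OF V])
    then show ?thesis using ij by (auto simp: weight_def s_regular fun_eq_iff)
  qed
qed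

lemma weight_minus_field:
  assumes "weight V v f" "weight W w f"
  shows "weight (W - V) (w - v) f"
  using assms by (auto simp: weight_def fun_eq_iff algebra_simps)

lemma weight_cscale_field: "weight V v f \<Longrightarrow> weight (cscale a V) (a * v) f"
  by (auto simp: weight_def fun_eq_iff algebra_simps)

lemma entry_mat_unit_diff:
  assumes "i \<in> {1..n + 1}" "j \<in> {1..n + 1}"
  shows "entry (mat_unit (n + 1) a a - mat_unit (n + 1) b b) i j =
    (if i = j then (if i = a then 1 else 0) - (if i = b then 1 else 0) else 0)"
  using assms by (subst entry_diff[where N = "n + 1"]) (auto simp: mat_unit_def)

lemma mat_unit_diff_carrier: "mat_unit (n + 1) a a - mat_unit (n + 1) b b \<in> carrier_mat (n + 1) (n + 1)"
  unfolding mat_unit_def by (intro minus_carrier_mat mat1_carrier)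

lemma mat_unit_diff_lie_G:
  assumes "a \<in> {1..n + 1}"
  shows "mat_unit (n + 1) a a - mat_unit (n + 1) (n + 2 - a) (n + 2 - a) \<in> lie_G n" (is "?g \<in> _")
proof -
  have g: "?g \<in> carrier_mat (n + 1) (n + 1)" by (rule mat_unit_diff_carrier)
  have sym: "?g\<^sup>T = ?g"
  proof (rule mat_eqI_entry)
    show "?g \<in> carrier_mat (n + 1) (n + 1)" by (rule g)
    then show "?g\<^sup>T \<in> carrier_mat (n + 1) (n + 1)" by simp
    show "entry ?g\<^sup>T i j = entry ?g i j" if "i \<in> {1..n + 1}" "j \<in> {1..n + 1}" for i j
      unfolding entry_transpose[OF g that] entry_mat_unit_diff[OF that]
        entry_mat_unit_diff[OF that(2,1)] by auto
  qed
  have "(?g)\<^sup>T \<in> lie_G n"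
  proof (rule lie_G_I[OF g])
    show "?g * Phi n + Phi n * ?g\<^sup>T = 0\<^sub>m (n + 1) (n + 1)"
      unfolding mult_Phi_transpose_eq_0_iff[OF g]
    proof (intro ballI)
      fix i j assume ij: "i \<in> {1..n + 1}" "j \<in> {1..n + 1}"
      then have r: "n + 2 - i \<in> {1..n + 1}" "n + 2 - j \<in> {1..n + 1}" by auto
      show "entry ?g i (n + 2 - j) * phi_sign n (n + 2 - j) + phi_sign n i * entry ?g j (n + 2 - i) = 0"
      proof (cases "i + j = n + 2")
        case True
        then have "j = a \<longleftrightarrow> i = n + 2 - a" "j = n + 2 - a \<longleftrightarrow> i = a"
          "n + 2 - i = j" "n + 2 - j = i" using ij assms by auto
        then show ?thesis
          unfolding entry_mat_unit_diff[OF ij(1) r(2)] entry_mat_unit_diff[OF ij(2) r(1)]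
          by (simp only:) (simp add: algebra_simps)
      next
        case False
        then have "i \<noteq> n + 2 - j" "j \<noteq> n + 2 - i" using ij by auto
        then show ?thesis
          unfolding entry_mat_unit_diff[OF ij(1) r(2)] entry_mat_unit_diff[OF ij(2) r(1)]
          by (simp only: if_False mult_zero_left mult_zero_right add_0_left)
      qed
    qed
    show "entry ?g i j = 0" if "i \<in> {1..n + 1}" "j \<in> {1..n + 1}" "i < j" for i j
      unfolding entry_mat_unit_diff[OF that(1,2)] using that(3) by simp
  qed
  then show ?thesis unfolding sym .
qed

lemma g11_eq: "g11 n = mat_unit (n + 1) 1 1 - mat_unit (n + 1) (n + 2 - 1) (n + 2 - 1)"
  and g22_eq: "g22 n = mat_unit (n + 1) 2 2 - mat_unit (n + 1) (n + 2 - 2) (n + 2 - 2)"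
  by (simp_all add: g11_def g22_def)

end

locale radial_field = dwork_family +
  fixes H :: vfield
  assumes radial: "is_radial_vector_field n Om H"
begin

lemma H_weights:
  shows H_VF: "H \<in> VF" and H_x: "weight H wt1 tx" and H_y: "weight H (of_nat (n + 2) * wt1) ty"
    and H_s: "\<And>i j. i \<in> {1..n + 1} \<Longrightarrow> j \<in> {1..n + 1} \<Longrightarrow> weight H (entry_weight i j) (s i j)"
proof -
  obtain R11 where R11: "is_R_g n Om (g11 n) R11"
    and H: "if n = 1 then H = - R11 else if n = 2 then H = cscale (- 2) R11
       else (\<exists>R22. is_R_g n Om (g22 n) R22 \<and> H = R22 - R11)"
    using radial by (auto simp: is_radial_vector_field_def)
  define d1 :: "nat \<Rightarrow> complex" where "d1 i = (if i = 1 then 1 else 0) - (if i = n + 1 then 1 else 0)" for i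
  have c1: "g11 n \<in> carrier_mat (n + 1) (n + 1)" unfolding g11_def by (rule mat_unit_diff_carrier)
  have e1: "\<forall>i\<in>{1..n + 1}. \<forall>j\<in>{1..n + 1}. entry (g11 n) i j = (if i = j then d1 i else 0)"
    unfolding g11_def d1_def by (intro ballI entry_mat_unit_diff)
  note w1 = diagonal_R_g[OF c1 e1 R11]
  have d11: "d1 1 = 1" using n_pos by (simp add: d1_def)
  have "H \<in> VF \<and> weight H wt1 tx \<and> weight H (of_nat (n + 2) * wt1) ty \<and>
    (\<forall>i\<in>{1..n + 1}. \<forall>j\<in>{1..n + 1}. weight H (entry_weight i j) (s i j))"
  proof (cases "n \<le> 2")
    case True
    \<comment> \<open>The definitions of H for n = 1 and n = 2 differ only by this scalar.\<close>
    have H': "H = cscale (- wt1) R11"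
      using H True n_pos by (auto simp: wt1_def fun_eq_iff)
    have "weight H wt1 tx"
      using weight_cscale_field[OF w1(2), of "- wt1"] unfolding H' d11 by simp
    moreover have "weight H (of_nat (n + 2) * wt1) ty"
      using weight_cscale_field[OF w1(3), of "- wt1"] unfolding H' d11 by (simp add: algebra_simps)
    moreover have "weight H (- wt1 * (d1 i - d1 1 * of_nat j)) (s i j)"
      if "i \<in> {1..n + 1}" "j \<in> {1..n + 1}" for i j
      unfolding H' by (rule weight_cscale_field[OF w1(4)[OF that]])
    moreover have "- wt1 * (d1 i - d1 1 * of_nat j) = entry_weight i j" if "i \<in> {1..n + 1}" for i j
      unfolding d11 using that True n_pos
      by (auto simp: entry_weight_def row_weight_def wt1_def d1_def algebra_simps)
    moreover have "H \<in> VF" unfolding H' by (rule cscale_in_VF[OF w1(1)])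
    ultimately show ?thesis by simp
  next
    case False
    then obtain R22 where R22: "is_R_g n Om (g22 n) R22" and H': "H = R22 - R11"
      using H by auto
    define d2 :: "nat \<Rightarrow> complex" where "d2 i = (if i = 2 then 1 else 0) - (if i = n then 1 else 0)" for i
    have c2: "g22 n \<in> carrier_mat (n + 1) (n + 1)" unfolding g22_def by (rule mat_unit_diff_carrier)
    have e2: "\<forall>i\<in>{1..n + 1}. \<forall>j\<in>{1..n + 1}. entry (g22 n) i j = (if i = j then d2 i else 0)"
      unfolding g22_def d2_def by (intro ballI entry_mat_unit_diff)
    note w2 = diagonal_R_g[OF c2 e2 R22]
    have d21: "d2 1 = 0" using False by (simp add: d2_def)
    have wt1: "wt1 = 1" using False by (simp add: wt1_def)
    have "weight H wt1 tx"
      using weight_minus_field[OF w1(2) w2(2)] unfolding H' d11 d21 wt1 by simp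
    moreover have "weight H (of_nat (n + 2) * wt1) ty"
      using weight_minus_field[OF w1(3) w2(3)] unfolding H' d11 d21 wt1 by (simp add: add.commute)
    moreover have "weight H ((d2 i - d2 1 * of_nat j) - (d1 i - d1 1 * of_nat j)) (s i j)"
      if "i \<in> {1..n + 1}" "j \<in> {1..n + 1}" for i j
      unfolding H' by (rule weight_minus_field[OF w1(4)[OF that] w2(4)[OF that]])
    moreover have "(d2 i - d2 1 * of_nat j) - (d1 i - d1 1 * of_nat j) = entry_weight i j" for i j
      unfolding d11 d21 using False
      by (auto simp: entry_weight_def row_weight_def wt1_def d1_def d2_def)
    moreover have "H \<in> VF" unfolding H' by (rule diff_in_VF[OF w2(1) w1(1)])
    ultimately show ?thesis by simp
  qed
  then show "H \<in> VF" "weight H wt1 tx" "weight H (of_nat (n + 2) * wt1) ty"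
    "\<And>i j. i \<in> {1..n + 1} \<Longrightarrow> j \<in> {1..n + 1} \<Longrightarrow> weight H (entry_weight i j) (s i j)"
    by blast+
qed

end

context dwork_family
begin

section \<open>The AMSY-Lie algebra\<close>

lemma AMSY_I:
  assumes "\<And>M. is_O_T_submodule n Om M \<Longrightarrow>
    (\<And>R. is_modular_vector_field n Om R \<Longrightarrow> R \<in> M) \<Longrightarrow>
    (\<And>g V. g \<in> lie_G n \<Longrightarrow> is_R_g n Om g V \<Longrightarrow> V \<in> M) \<Longrightarrow> V \<in> M"
  shows "V \<in> AMSY n Om"
  using assms by (auto simp: AMSY_def)

lemma AMSY_modular: "is_modular_vector_field n Om R \<Longrightarrow> R \<in> AMSY n Om"
  and AMSY_R_g: "g \<in> lie_G n \<Longrightarrow> is_R_g n Om g V \<Longrightarrow> V \<in> AMSY n Om"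
  by (auto intro: AMSY_I)

lemma AMSY_add: "V \<in> AMSY n Om \<Longrightarrow> W \<in> AMSY n Om \<Longrightarrow> V + W \<in> AMSY n Om"
  unfolding AMSY_def is_O_T_submodule_def by blast

lemma AMSY_fscale: "f \<in> OT \<Longrightarrow> V \<in> AMSY n Om \<Longrightarrow> fscale f V \<in> AMSY n Om"
  unfolding AMSY_def is_O_T_submodule_def by blast

lemma vector_fields_submodule: "is_O_T_submodule n Om VF"
  by (simp add: is_O_T_submodule_def zero_in_VF add_in_VF fscale_in_VF)

lemma AMSY_subset_VF: "AMSY n Om \<subseteq> VF"
proof
  fix V assume "V \<in> AMSY n Om"
  moreover have "{R. is_modular_vector_field n Om R} \<union> {V. \<exists>g\<in>lie_G n. is_R_g n Om g V} \<subseteq> VF"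
    by (auto simp: is_modular_vector_field_def is_R_g_def)
  ultimately show "V \<in> VF" using vector_fields_submodule unfolding AMSY_def by blast
qed

lemma AMSY_cscale: "V \<in> AMSY n Om \<Longrightarrow> cscale a V \<in> AMSY n Om"
  using AMSY_fscale[OF O_T.const] AMSY_subset_VF cscale_eq_fscale by (metis subsetD)

lemma AMSY_diff:
  assumes "V \<in> AMSY n Om" "W \<in> AMSY n Om" shows "V - W \<in> AMSY n Om"
proof -
  have "V - W = V + cscale (- 1) W" by (auto simp: fun_eq_iff)
  then show ?thesis using assms by (simp only: AMSY_add AMSY_cscale)
qed

end

lemma (in radial_field) H_AMSY: "H \<in> AMSY n Om"
proof -
  have G: "g11 n \<in> lie_G n" unfolding g11_eq by (rule mat_unit_diff_lie_G) simp
  obtain R11 where R11: "is_R_g n Om (g11 n) R11"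
    and H: "if n = 1 then H = - R11 else if n = 2 then H = cscale (- 2) R11
       else (\<exists>R22. is_R_g n Om (g22 n) R22 \<and> H = R22 - R11)"
    using radial by (auto simp: is_radial_vector_field_def)
  have R: "R11 \<in> AMSY n Om" using G R11 by (rule AMSY_R_g)
  have m: "- R11 = cscale (- 1) R11" by (auto simp: fun_eq_iff)
  consider "H = cscale (- 1) R11" | "H = cscale (- 2) R11"
    | R22 where "n \<ge> 3" "is_R_g n Om (g22 n) R22" "H = R22 - R11"
    using H m n_pos by (cases "n = 1"; cases "n = 2") auto
  then show ?thesis
  proof cases
    case 3
    have "g22 n \<in> lie_G n" unfolding g22_eq by (rule mat_unit_diff_lie_G) (use 3 in simp)
    then have "R22 \<in> AMSY n Om" using 3 by (intro AMSY_R_g)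
    then show ?thesis using 3 R AMSY_diff by simp
  qed (use R AMSY_cscale in simp_all)
qed

section \<open>The modular vector field\<close>

context dwork_family
begin

text \<open>The superdiagonal of Y is forced: \<open>s i (i + 1)\<close> vanishes identically, so
  its derivative along R equates the i-th superdiagonal entry times \<open>s (i + 1) (i + 1)\<close>
  with \<open>s 2 2 * s i i\<close>.\<close>

definition ycoeff :: "nat \<Rightarrow> func" where
  "ycoeff i = s 2 2 * s i i * on_T n Om (\<lambda>p. 1 / s (i + 1) (i + 1) p)"

lemma s_22_regular: "s 2 2 \<in> OT" and s_21_regular: "s 2 1 \<in> OT"
  by (rule s_regular; use n_pos in simp)+

lemma ycoeff_regular: "i \<in> {1..n} \<Longrightarrow> ycoeff i \<in> OT"
  unfolding ycoeff_def by (intro O_T.mult s_22_regular s_regular inverse_diag_regular) auto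

lemma ycoeff_mult: "i \<in> {1..n} \<Longrightarrow> ycoeff i * s (i + 1) (i + 1) = s 2 2 * s i i"
proof
  fix p assume i: "i \<in> {1..n}"
  show "(ycoeff i * s (i + 1) (i + 1)) p = (s 2 2 * s i i) p"
  proof (cases "p \<in> T n Om")
    case True
    then have "s (i + 1) (i + 1) p \<noteq> 0" by (rule s_diag_nz) (use i in auto)
    then show ?thesis using True by (simp add: ycoeff_def)
  qed simp
qed

text \<open>The Gauss--Manin equation of R with ka = \<open>s 2 2\<close> and mu = -
  \<open>s 2 1\<close> inserted: the contribution of Y, the companion part of B(R) and its diagonal
  part.\<close>

definition R_entry :: "nat \<Rightarrow> nat \<Rightarrow> func" where
  "R_entry i j = (if i \<le> n then ycoeff i * s (i + 1) j else 0)
     - s 2 2 * ((if 2 \<le> j then s i (j - 1) else 0) + s i (n + 1) * b_last j)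
     - (\<lambda>_. of_nat j) * (s 2 1 * s i j)"

definition R_x :: func where "R_x = s 2 2 - tx * s 2 1"

definition R_y :: func where "R_y = (\<lambda>_. - of_nat (n + 2)) * (ty * s 2 1)"

text \<open>Multiplied by x^(n+2) - y, the entry becomes a constant times x^j. The weight w is
  arbitrary so that w = 0 also covers the fields that kill x and y.\<close>

lemma b_last_weight:
  assumes V: "V \<in> VF" and x: "weight V w tx" and y: "weight V (of_nat (n + 2) * w) ty"
    and j: "j \<in> {1..n + 1}"
  shows "weight V (of_nat j * w - of_nat (n + 2) * w) (b_last j)"
proof (rule weight_quotient[OF V b_last_regular[OF j] weight_discriminant[OF V x y]])
  let ?D = "on_T n Om (\<lambda>p. pt_x p ^ (n + 2) - pt_y p)"
  have "b_last j * ?D = (\<lambda>_. - of_nat (Stirling (n + 2) j)) * on_T n Om (\<lambda>p. pt_x p ^ j)"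
  proof
    fix p
    show "(b_last j * ?D) p = ((\<lambda>_. - of_nat (Stirling (n + 2) j)) * on_T n Om (\<lambda>p. pt_x p ^ j)) p"
    proof (cases "p \<in> T n Om")
      case True
      have "entry (B1 n (pt_x p) (pt_y p)) (n + 1) j =
          - of_nat (Stirling (n + 2) j) * pt_x p ^ j / (pt_x p ^ (n + 2) - pt_y p)"
        unfolding B1_def by (subst entry_mat1) (use j in auto)
      then show ?thesis using True T_nz(2)[OF True] by (simp add: b_last_def del: Stirling.simps power_Suc)
    qed (simp add: b_last_def)
  qed
  then show "weight V (of_nat j * w) (b_last j * ?D)"
    using weight_cmult[OF V weight_power[OF V x]] by (simp only:)
qed (use T_nz in auto)

end

section \<open>Formulas for the modular vector field and their homogeneity\<close>

locale modular_field = radial_field +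
  fixes R :: vfield
  assumes modular: "is_modular_vector_field n Om R"
begin

lemma R_VF: "R \<in> VF"
  using modular by (simp add: is_modular_vector_field_def)

lemma R_formulas:
  shows R_tx: "R tx = R_x" and R_ty: "R ty = R_y"
    and R_s: "\<And>i j. i \<in> {1..n + 1} \<Longrightarrow> j \<in> {1..n + 1} \<Longrightarrow> R (s i j) = R_entry i j"
    and ycoeff_n: "n \<ge> 2 \<Longrightarrow> ycoeff n = cst (- 1)"
proof -
  obtain Y where gm: "is_gauss_manin_matrix n Om R (Y_mat n Om Y)"
    using modular by (auto simp: is_modular_vector_field_def)
  interpret gauss_manin n c Om R "Y_mat n Om Y"
    by standard (rule R_VF, rule gm)
  define Z where "Z i = (if i = 1 then cst 1 else if i = n then cst (- 1) else Y (i - 1))" for i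
  have e: "entry (Y_mat n Om Y) i l = (if l = i + 1 then Z i else 0)"
    if "i \<in> {1..n + 1}" "l \<in> {1..n + 1}" for i l
    using that by (simp add: Y_mat_def Z_def)
  have row: "(\<Sum>l = 1..n + 1. entry (Y_mat n Om Y) i l p * s l j p) =
      (if i \<le> n then Z i p * s (i + 1) j p else 0)" if i: "i \<in> {1..n + 1}" for p i j
  proof -
    have "(\<Sum>l = 1..n + 1. entry (Y_mat n Om Y) i l p * s l j p) =
        (\<Sum>l = 1..n + 1. if l = i + 1 then Z i p * s l j p else 0)"
      by (intro sum.cong refl) (use i in \<open>auto simp: e\<close>)
    then show ?thesis using i by auto
  qed
  have 1: "1 \<in> {1..n + 1}" "1 \<le> n" using n_pos by auto
  \<comment> \<open>Row 1 of Y is the second unit vector, so the two coefficients are entries of row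
    2 of S.\<close>
  have mu: "mu p = - s 2 1 p" and ka: "ka p = s 2 2 p" if p: "p \<in> T n Om" for p
    unfolding mu_eq[OF p] ka_eq[OF p] row[OF 1(1)] using 1(2) p
    by (simp_all add: Z_def numeral_2_eq_2)
  have Z: "Z i p = ycoeff i p" if p: "p \<in> T n Om" and i: "i \<in> {1..n}" for p i
  proof -
    have r: "i \<in> {1..n + 1}" "i + 1 \<in> {1..n + 1}" "i < i + 1" "i < n + 1" "n + 1 \<in> {1..n + 1}"
      using i by auto
    have "R (s i (i + 1)) p = 0" unfolding s_upper[OF r(3,1,2)] VF_zero[OF R_VF] by simp
    moreover have "s i (i + 1) p = 0" by (rule s_upper_apply[OF r(3,1,2)])
    moreover have "s i (n + 1) p = 0" by (rule s_upper_apply[OF r(4,1,5)])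
    ultimately have "Z i p * s (i + 1) (i + 1) p = s 2 2 p * s i i p"
      using derivative_of_entry[OF p r(1,2)] i unfolding row[OF r(1)] ka[OF p] by simp
    also have "\<dots> = ycoeff i p * s (i + 1) (i + 1) p" using ycoeff_mult[OF i] by (metis times_fun_apply)
    finally show ?thesis using s_diag_nz[OF p r(2)] by simp
  qed
  show "R tx = R_x"
  proof
    fix p show "R tx p = R_x p"
      using derivative_of_x[of p] mu[of p] ka[of p] VF_out[OF R_VF]
      by (cases "p \<in> T n Om") (auto simp: R_x_def)
  qed
  show "R ty = R_y"
  proof
    fix p show "R ty p = R_y p"
      using derivative_of_y[of p] mu[of p] VF_out[OF R_VF]
      by (cases "p \<in> T n Om") (auto simp: R_y_def algebra_simps)
  qed
  show "R (s i j) = R_entry i j" if ij: "i \<in> {1..n + 1}" "j \<in> {1..n + 1}" for i j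
  proof
    fix p show "R (s i j) p = R_entry i j p"
    proof (cases "p \<in> T n Om")
      case True
      show ?thesis
        unfolding derivative_of_entry[OF True ij] row[OF ij(1)] ka[OF True] mu[OF True]
        using Z[OF True, of i] ij by (simp add: R_entry_def algebra_simps)
    qed (simp add: VF_out[OF R_VF] R_entry_def)
  qed
  \<comment> \<open>Here the forced value of the last superdiagonal entry is compared with the
    prescribed -1. For n = 1 the only such entry is 1, hence the restriction on n.\<close>
  show "ycoeff n = cst (- 1)" if "n \<ge> 2"
  proof
    fix p show "ycoeff n p = cst (- 1) p"
      using Z[of p n] that by (cases "p \<in> T n Om") (auto simp: Z_def ycoeff_def)
  qed
qed

lemma ycoeff_weight:
  assumes i: "i \<in> {1..n}"
  shows "weight H (entry_weight 2 2 + entry_weight i i - entry_weight (i + 1) (i + 1)) (ycoeff i)"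
proof (rule weight_quotient[OF H_VF ycoeff_regular[OF i]])
  show "weight H (entry_weight (i + 1) (i + 1)) (s (i + 1) (i + 1))" using i by (intro H_s) auto
  show "weight H (entry_weight 2 2 + entry_weight i i) (ycoeff i * s (i + 1) (i + 1))"
    unfolding ycoeff_mult[OF i] by (intro weight_mult[OF H_VF] H_s) (use i in auto)
qed (use i s_diag_nz in auto)

text \<open>In other words, \<open>s 2 1\<close> has weight 2 for every n. This gives R degree 2 and
  F degree -2.\<close>

lemma row_weight_2: "row_weight 2 + wt1 = 2"
  by (auto simp: row_weight_def wt1_def)

lemma weight_cong: "weight V w f \<Longrightarrow> w = v \<Longrightarrow> weight V v f"
  by simp

lemma weight_0: "V \<in> VF \<Longrightarrow> weight V w 0"
  by (simp add: weight_def O_T_zero VF_zero fun_eq_iff)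

text \<open>Multiplication by \<open>s 2 1\<close> raises weights by 2. The column shift and the
  last-column term lower them by \<open>wt1\<close>, which \<open>s 2 2\<close> of weight 2 +
  \<open>wt1\<close> turns into + 2; the weight of \<open>ycoeff i\<close> compensates the change
  from row i to row i + 1 in the same way.\<close>

lemma R_homogeneous:
  shows "weight H (wt1 + 2) R_x" "weight H (of_nat (n + 2) * wt1 + 2) R_y"
    and "i \<in> {1..n + 1} \<Longrightarrow> j \<in> {1..n + 1} \<Longrightarrow> weight H (entry_weight i j + 2) (R_entry i j)"
proof -
  note m = weight_mult[OF H_VF] and d = weight_diff[OF H_VF] and a = weight_add[OF H_VF]
    and c = weight_cmult[OF H_VF]
  have r2: "row_weight 2 = 2 - wt1" using row_weight_2 by (simp add: algebra_simps)
  have s22: "weight H (2 + wt1) (s 2 2)" and s21: "weight H 2 (s 2 1)"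
    by (rule weight_cong[OF H_s]; use n_pos in \<open>simp add: entry_weight_def r2\<close>)+
  show "weight H (wt1 + 2) R_x" unfolding R_x_def
    by (rule d, rule weight_cong[OF s22], simp, rule m[OF H_x s21])
  show "weight H (of_nat (n + 2) * wt1 + 2) R_y" unfolding R_y_def
    by (rule c, rule m[OF H_y s21])
  assume ij: "i \<in> {1..n + 1}" "j \<in> {1..n + 1}"
  show "weight H (entry_weight i j + 2) (R_entry i j)" unfolding R_entry_def
  proof (intro d)
    show "weight H (entry_weight i j + 2) (if i \<le> n then ycoeff i * s (i + 1) j else 0)"
    proof (cases "i \<le> n")
      case True
      then have i: "i \<in> {1..n}" using ij by simp
      have "weight H (entry_weight 2 2 + entry_weight i i - entry_weight (i + 1) (i + 1) +
          entry_weight (i + 1) j) (ycoeff i * s (i + 1) j)"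
        by (rule m[OF ycoeff_weight[OF i] H_s]) (use i ij in auto)
      then show ?thesis unfolding if_P[OF True]
        by (rule weight_cong) (simp add: entry_weight_def r2 algebra_simps)
    qed (simp add: weight_0 H_VF)
    have 1: "weight H (entry_weight i j - wt1) (if 2 \<le> j then s i (j - 1) else 0)"
    proof (cases "2 \<le> j")
      case True
      have "weight H (entry_weight i (j - 1)) (s i (j - 1))" using True ij by (intro H_s) auto
      then show ?thesis unfolding if_P[OF True]
        by (rule weight_cong) (use True in \<open>simp add: entry_weight_def of_nat_diff algebra_simps\<close>)
    qed (simp add: weight_0 H_VF)
    have 2: "weight H (entry_weight i j - wt1) (s i (n + 1) * b_last j)"
    proof (rule weight_cong)
      show "weight H (entry_weight i (n + 1) + (of_nat j * wt1 - of_nat (n + 2) * wt1)) (s i (n + 1) * b_last j)"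
        by (rule m[OF H_s b_last_weight[OF H_VF H_x H_y]]) (use ij in auto)
    qed (simp add: entry_weight_def algebra_simps)
    have "weight H (2 + wt1 + (entry_weight i j - wt1))
        (s 2 2 * ((if 2 \<le> j then s i (j - 1) else 0) + s i (n + 1) * b_last j))"
      by (rule m[OF s22 a[OF 1 2]])
    then show "weight H (entry_weight i j + 2)
        (s 2 2 * ((if 2 \<le> j then s i (j - 1) else 0) + s i (n + 1) * b_last j))"
      by (rule weight_cong) simp
    have "weight H (2 + entry_weight i j) ((\<lambda>_. of_nat j) * (s 2 1 * s i j))"
      by (rule c, rule m[OF s21 H_s[OF ij]])
    then show "weight H (entry_weight i j + 2) ((\<lambda>_. of_nat j) * (s 2 1 * s i j))"
      by (rule weight_cong) simp
  qed
qed

text \<open>On an eigenfunction of V the relation [V, W] = a W means that W raises the weight by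
  a.\<close>

lemma bracket_eq_cscale:
  assumes "V \<in> VF" "W \<in> VF" "weight V w f" "weight V (w + a) (W f)"
  shows "lie_bracket V W f = cscale a W f"
proof -
  have "W (V f) = (\<lambda>_. w) * W f"
    unfolding weightD(2)[OF assms(3)] by (rule VF_cmult[OF assms(2) weightD(1)[OF assms(3)]])
  then show ?thesis using weightD(2)[OF assms(4)] by (auto simp: fun_eq_iff lie_bracket_def algebra_simps)
qed

lemma bracket_H_R: "lie_bracket H R = cscale 2 R"
proof (rule vf_eqI_entries)
  show "lie_bracket H R \<in> VF" "cscale 2 R \<in> VF"
    by (rule lie_bracket_in_VF[OF H_VF R_VF], rule cscale_in_VF[OF R_VF])
  note B = bracket_eq_cscale[OF H_VF R_VF]
  show "lie_bracket H R tx = cscale 2 R tx"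
    by (rule B[OF H_x]) (simp only: R_tx R_homogeneous)
  show "lie_bracket H R ty = cscale 2 R ty"
    by (rule B[OF H_y]) (simp only: R_ty R_homogeneous)
  fix i k assume "(i, k) \<in> set (coord_entries n)"
  then have ik: "i \<in> {1..n + 1}" "k \<in> {1..n + 1}" by (auto simp: in_coord_entries_iff)
  show "lie_bracket H R (s i k) = cscale 2 R (s i k)"
    by (rule B[OF H_s[OF ik]]) (simp only: R_s[OF ik] R_homogeneous(3)[OF ik])
qed

section \<open>Derivatives of the formulas for R along fields that fix x, y and the diagonal of
  S\<close>

context
  fixes V
  assumes V: "V \<in> VF" and Vx: "V tx = 0" and Vy: "V ty = 0"
    and V_diagonal: "\<forall>i\<in>{1..n + 1}. V (s i i) = 0"
begin

lemma Vdiag: "i \<in> {1..n + 1} \<Longrightarrow> V (s i i) = 0"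
  using V_diagonal by blast

lemma vertical_ycoeff:
  assumes i: "i \<in> {1..n}" shows "V (ycoeff i) = 0"
proof -
  have "weight V (0 - 0) (ycoeff i)"
  proof (rule weight_quotient[OF V ycoeff_regular[OF i]])
    show "weight V 0 (s (i + 1) (i + 1))" using i by (simp add: weight_0_iff s_regular Vdiag)
    have "weight V (0 + 0) (s 2 2 * s i i)"
      by (rule weight_mult[OF V]) (use i in \<open>auto simp: weight_0_iff s_regular Vdiag\<close>)
    then show "weight V 0 (ycoeff i * s (i + 1) (i + 1))" unfolding ycoeff_mult[OF i] by simp
  qed (use i s_diag_nz in auto)
  then show ?thesis by (simp add: weight_0_iff)
qed

lemma vertical_last_column:
  assumes i: "i \<in> {1..n + 1}" shows "V (s i (n + 1)) = 0"
proof (cases "i = n + 1")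
  case False
  then have "s i (n + 1) = 0" using i by (intro s_upper) auto
  then show ?thesis by (simp only: VF_zero[OF V])
qed (use Vdiag in auto)

lemma vertical_b_last:
  assumes j: "j \<in> {1..n + 1}" shows "V (b_last j) = 0"
  using b_last_weight[OF V, of 0 j] Vx Vy j by (simp add: weight_0_iff tx_regular ty_regular)

lemma vertical_R_x: "V R_x p = - (tx p * V (s 2 1) p)"
proof -
  have "V (s 2 2) = 0" using n_pos by (intro Vdiag) auto
  then show ?thesis
    unfolding R_x_def VF_diff[OF V s_22_regular O_T.mult[OF tx_regular s_21_regular]]
      VF_mult[OF V tx_regular s_21_regular] Vx by simp
qed

lemma vertical_R_y: "V R_y p = - of_nat (n + 2) * (ty p * V (s 2 1) p)"
  unfolding R_y_def VF_cmult[OF V O_T.mult[OF ty_regular s_21_regular]]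
    VF_mult[OF V ty_regular s_21_regular] Vy by simp

text \<open>The diagonal of S, its last column, \<open>ycoeff\<close> and \<open>b_last\<close> are
  constant along V, so the Leibniz rule leaves only derivatives of \<open>s 2 1\<close> and of the
  entries below, left of and at (i, j).\<close>

lemma vertical_R_entry:
  assumes ij: "i \<in> {1..n + 1}" "j \<in> {1..n + 1}"
  shows "V (R_entry i j) p = (if i \<le> n then ycoeff i p * V (s (i + 1) j) p else 0)
    - s 2 2 p * (if 2 \<le> j then V (s i (j - 1)) p else 0)
    - of_nat j * (V (s 2 1) p * s i j p + s 2 1 p * V (s i j) p)"
proof -
  define f1 where "f1 = (if i \<le> n then ycoeff i * s (i + 1) j else 0)"
  define f2 where "f2 = (if 2 \<le> j then s i (j - 1) else 0)"
  have f1: "f1 \<in> OT" "V f1 = (if i \<le> n then ycoeff i * V (s (i + 1) j) else 0)"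
    using ij by (auto simp: f1_def O_T_zero VF_zero[OF V] VF_mult[OF V] O_T.mult ycoeff_regular s_regular
        vertical_ycoeff)
  have f2: "f2 \<in> OT" "V f2 = (if 2 \<le> j then V (s i (j - 1)) else 0)"
  proof -
    have "s i (j - 1) \<in> OT" if "2 \<le> j" using that ij by (intro s_regular) auto
    then show "f2 \<in> OT" unfolding f2_def using O_T_zero by presburger
    show "V f2 = (if 2 \<le> j then V (s i (j - 1)) else 0)"
      unfolding f2_def using VF_zero[OF V] by presburger
  qed
  have sn: "s i (n + 1) \<in> OT" using ij by (intro s_regular) auto
  have f3: "s i (n + 1) * b_last j \<in> OT" "V (s i (n + 1) * b_last j) = 0"
  proof -
    show "s i (n + 1) * b_last j \<in> OT" by (rule O_T.mult[OF sn b_last_regular[OF ij(2)]])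
    show "V (s i (n + 1) * b_last j) = 0"
      unfolding VF_mult[OF V sn b_last_regular[OF ij(2)]] vertical_last_column[OF ij(1)]
        vertical_b_last[OF ij(2)] by simp
  qed
  have f23: "f2 + s i (n + 1) * b_last j \<in> OT" "V (f2 + s i (n + 1) * b_last j) = V f2"
    unfolding VF_add[OF V f2(1) f3(1)] f3(2) by (rule O_T.add[OF f2(1) f3(1)], rule add_0_right)
  have f4: "s 2 2 * (f2 + s i (n + 1) * b_last j) \<in> OT"
    "V (s 2 2 * (f2 + s i (n + 1) * b_last j)) = s 2 2 * V f2"
  proof -
    have "V (s 2 2) = 0" using n_pos by (intro Vdiag) auto
    then show "V (s 2 2 * (f2 + s i (n + 1) * b_last j)) = s 2 2 * V f2"
      unfolding VF_mult[OF V s_22_regular f23(1)] f23(2) by simp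
    show "s 2 2 * (f2 + s i (n + 1) * b_last j) \<in> OT" by (rule O_T.mult[OF s_22_regular f23(1)])
  qed
  have ss: "s 2 1 * s i j \<in> OT" by (rule O_T.mult[OF s_21_regular s_regular[OF ij]])
  have f5: "(\<lambda>_. of_nat j) * (s 2 1 * s i j) \<in> OT"
    "V ((\<lambda>_. of_nat j) * (s 2 1 * s i j)) = (\<lambda>_. of_nat j) * (V (s 2 1) * s i j + s 2 1 * V (s i j))"
    unfolding VF_cmult[OF V ss] VF_mult[OF V s_21_regular s_regular[OF ij]] by (rule O_T_cmult[OF ss], rule refl)
  have "V (R_entry i j) = V f1 - s 2 2 * V f2 -
      (\<lambda>_. of_nat j) * (V (s 2 1) * s i j + s 2 1 * V (s i j))"
    unfolding R_entry_def f1_def[symmetric] f2_def[symmetric]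
      VF_diff[OF V O_T_diff[OF f1(1) f4(1)] f5(1)] VF_diff[OF V f1(1) f4(1)] f4(2) f5(2) ..
  then show ?thesis unfolding f1(2) f2(2) by simp
qed

end

end

section \<open>The vector field dual to the second coordinate\<close>

context dwork_family
begin

lemma chart_cases:
  assumes j: "j \<in> chart_idx n"
  obtains "j = 1" "chart opt n Om j = tx"
  | "j = n + 2" "chart opt n Om j = ty"
  | "odd n" "n \<ge> 3" "opt = Option1" "j \<noteq> 2"
      "chart opt n Om j = s (n + 1) 1 + s 2 1 * s n 1"
  | i k where "(i, k) \<in> set (coord_entries n)" "chart opt n Om j = s i k" "j = 2 \<longleftrightarrow> (i, k) = (2, 1)"
      "odd n \<Longrightarrow> n \<ge> 3 \<Longrightarrow> opt = Option1 \<Longrightarrow> (i, k) \<noteq> (n + 1, 1)"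
proof (cases "opt = Option1 \<and> odd n \<and> n \<ge> 3")
  case False
  then have c: "chart opt n Om j = tcoord n Om j" by (auto simp: chart_def)
  from j show ?thesis
    by (rule tcoord_cases[OF n_pos, where Om = Om]) (use False that c in auto)
next
  case True
  then have n: "odd n" "n \<ge> 3" and opt: "opt = Option1" by auto
  note d = chart_modified(1-3)[OF n, where Om = Om] chart_modified(4-6)[OF n]
  show ?thesis
  proof (cases "j = dim_T n")
    case True
    then show ?thesis using that(3) n opt d by blast
  next
    case False
    then have c: "chart opt n Om j = tcoord n Om j" by (auto simp: chart_def)
    show ?thesis
    proof (cases "j \<in> {1, n + 2}")
      case True
      moreover have "chart opt n Om j = tx" if "j = 1" using c that tcoord_1 by (simp only:)
      moreover have "chart opt n Om j = ty" if "j = n + 2" using c that tcoord_n2 by (simp only:)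
      ultimately show ?thesis using that(1,2) by blast
    next
      case out: False
      obtain i k where ik: "coord_entries n ! coord_index n j = (i, k)" by fastforce
      have ts: "tcoord n Om j = s i k" using out ik by (intro tcoord_other) auto
      have mem: "(i, k) \<in> set (coord_entries n)"
        using coord_index_bij[OF n_pos] out j ik by (metis Diff_iff bij_betwE lessThan_iff nth_mem)
      have "(i, k) \<noteq> (n + 1, 1)"
        using coord_entry_inj[OF n_pos, of j "dim_T n"] out j d(5,6) False ik by auto
      moreover have "j = 2 \<longleftrightarrow> (i, k) = (2, 1)"
      proof
        assume "j = 2"
        then show "(i, k) = (2, 1)" using ik coord_entries_0[OF n_pos] n by (simp add: coord_index_def)
      next
        assume "(i, k) = (2, 1)"
        moreover have "coord_entries n ! coord_index n 2 = (2, 1)"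
          using coord_entries_0[OF n_pos] n by (simp add: coord_index_def)
        moreover have "2 \<in> chart_idx n - {1, n + 2}" using two_in_chart_idx[OF n_pos] n by auto
        ultimately show "j = 2" using coord_entry_inj[OF n_pos, of j 2] out j ik by auto
      qed
      ultimately show ?thesis using that(4)[OF mem] c ts by simp
    qed
  qed
qed

text \<open>The change of chart in Option 1 is triangular: \<open>s 2 1\<close> and
  \<open>s n 1\<close> belong to both charts, so the value on \<open>s (n + 1) 1\<close> can be
  recovered from that on the modified coordinate.\<close>

lemma vf_eqI_chart:
  assumes V: "V \<in> VF" and W: "W \<in> VF"
    and eq: "\<And>j. j \<in> chart_idx n \<Longrightarrow> V (chart opt n Om j) = W (chart opt n Om j)"
  shows "V = W"
proof (rule vf_eqI_tcoord[OF V W])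
  fix j assume j: "j \<in> chart_idx n"
  show "V (tcoord n Om j) = W (tcoord n Om j)"
  proof (cases "opt = Option1 \<and> odd n \<and> n \<ge> 3 \<and> j = dim_T n")
    case False
    then have "chart opt n Om j = tcoord n Om j" by (auto simp: chart_def)
    then show ?thesis using eq[OF j] by simp
  next
    case True
    then have n: "odd n" "n \<ge> 3" and opt: "opt = Option1" and jd: "j = dim_T n" by auto
    note d = chart_modified(1-3)[OF n, where Om = Om] chart_modified(4-6)[OF n]
    obtain j' where j': "j' \<in> chart_idx n" "j' \<noteq> dim_T n" "tcoord n Om j' = s n 1" using d(3) by blast
    then have "chart opt n Om j' = s n 1" by (auto simp: chart_def)
    then have sn: "V (s n 1) = W (s n 1)" using eq[OF j'(1)] by simp
    have "chart opt n Om 2 = s 2 1" using d(4) tcoord_2[OF n_pos] by (auto simp: chart_def)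
    then have s2: "V (s 2 1) = W (s 2 1)" using eq[OF two_in_chart_idx[OF n_pos]] by simp
    have r: "s (n + 1) 1 \<in> OT" "s n 1 \<in> OT" using n by (auto intro: s_regular)
    have "V (s (n + 1) 1 + s 2 1 * s n 1) = W (s (n + 1) 1 + s 2 1 * s n 1)"
      using eq[OF j] d(1) opt jd by simp
    then have "V (s (n + 1) 1) = W (s (n + 1) 1)"
      unfolding VF_add[OF V r(1) O_T.mult[OF s_21_regular r(2)]]
        VF_add[OF W r(1) O_T.mult[OF s_21_regular r(2)]]
        VF_mult[OF V s_21_regular r(2)] VF_mult[OF W s_21_regular r(2)] sn s2
      by (simp only: add_right_cancel)
    then show ?thesis using d(2) jd by simp
  qed
qed

lemma partial_derivative_eqI:
  assumes P: "is_partial_derivative n Om (chart opt n Om) 2 P" and V: "V \<in> VF"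
    and tx: "V tx = 0" and ty: "V ty = 0"
    and s: "\<And>i k. (i, k) \<in> set (coord_entries n) \<Longrightarrow>
      (odd n \<Longrightarrow> n \<ge> 3 \<Longrightarrow> opt = Option1 \<Longrightarrow> (i, k) \<noteq> (n + 1, 1)) \<Longrightarrow>
      V (s i k) = cst (if (i, k) = (2, 1) then a else 0)"
    and d: "odd n \<Longrightarrow> n \<ge> 3 \<Longrightarrow> opt = Option1 \<Longrightarrow> V (s (n + 1) 1 + s 2 1 * s n 1) = 0"
  shows "cscale a P = V"
proof (rule vf_eqI_chart[where opt = opt])
  have PV: "P \<in> VF" using P by (simp add: is_partial_derivative_def)
  then show "cscale a P \<in> VF" by (rule cscale_in_VF)
  show "V \<in> VF" by (rule V)
  fix j assume j: "j \<in> chart_idx n"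
  then have "P (chart opt n Om j) = cst (if j = 2 then 1 else 0)"
    using P by (auto simp: is_partial_derivative_def)
  then have Pj: "cscale a P (chart opt n Om j) = cst (if j = 2 then a else 0)"
    by (auto simp: fun_eq_iff on_T_def)
  have z: "cst 0 = 0" by (auto simp: on_T_def)
  have "V (chart opt n Om j) = cst (if j = 2 then a else 0)"
    using j
  proof (cases rule: chart_cases[where opt = opt])
    case 1
    then show ?thesis using tx z by (simp only:) simp
  next
    case 2
    then show ?thesis using ty z n_pos by (simp only:) simp
  next
    case 3
    have "V (s (n + 1) 1 + s 2 1 * s n 1) = 0" by (rule d) (use 3 in auto)
    then show ?thesis unfolding 3(5) using 3(4) z by (simp only: if_False)
  next
    case (4 i k)
    then show ?thesis using s[OF 4(1)] by auto
  qed
  then show "cscale a P (chart opt n Om j) = V (chart opt n Om j)" using Pj by simp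
qed

text \<open>The entry (2, 1) produces the derivative \<open>wt1\<close> of \<open>s 2 1\<close>, and
  the condition defining the Lie algebra forces the mirrored entry (n + 1, n). For n = 1 the two
  positions coincide and the first alternative wins.\<close>

definition F_mat :: "complex mat" where
  "F_mat = mat1 (n + 1) (\<lambda>i j. if i = 2 \<and> j = 1 then wt1 else if i = n + 1 \<and> j = n then - wt1 else 0)"

lemma F_mat_carrier: "F_mat \<in> carrier_mat (n + 1) (n + 1)"
  unfolding F_mat_def by (rule mat1_carrier)

lemma entry_F_mat:
  "i \<in> {1..n + 1} \<Longrightarrow> j \<in> {1..n + 1} \<Longrightarrow>
    entry F_mat i j = (if i = 2 \<and> j = 1 then wt1 else if i = n + 1 \<and> j = n then - wt1 else 0)"
  unfolding F_mat_def by (rule entry_mat1)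

lemma cube_zeroI:
  assumes A: "A \<in> carrier_mat N N"
    and z: "\<And>i l k j. i \<in> {1..N} \<Longrightarrow> l \<in> {1..N} \<Longrightarrow> k \<in> {1..N} \<Longrightarrow> j \<in> {1..N} \<Longrightarrow>
      entry A i l * (entry A l k * entry A k j) = (0 :: complex)"
  shows "A * (A * A) = 0\<^sub>m N N"
proof (rule mat_eqI_entry)
  have AA: "A * A \<in> carrier_mat N N" by (rule mult_carrier_mat[OF A A])
  show "A * (A * A) \<in> carrier_mat N N" by (rule mult_carrier_mat[OF A AA])
  fix i j assume ij: "i \<in> {1..N}" "j \<in> {1..N}"
  have "entry (A * (A * A)) i j = (\<Sum>l = 1..N. \<Sum>k = 1..N. entry A i l * (entry A l k * entry A k j))"
    unfolding entry_mult[OF A AA ij] sum_distrib_left[symmetric]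
    by (intro sum.cong refl) (use entry_mult[OF A A _ ij(2)] in simp)
  also have "\<dots> = 0" by (intro sum.neutral ballI z ij)
  finally show "entry (A * (A * A)) i j = entry (0\<^sub>m N N) i j" using ij by (simp add: entry_zero)
qed simp

lemma F_mat_lie: "F_mat * Phi n + Phi n * F_mat\<^sup>T = 0\<^sub>m (n + 1) (n + 1)"
  unfolding mult_Phi_transpose_eq_0_iff[OF F_mat_carrier]
proof (intro ballI)
  fix i j assume ij: "i \<in> {1..n + 1}" "j \<in> {1..n + 1}"
  then have r: "n + 2 - i \<in> {1..n + 1}" "n + 2 - j \<in> {1..n + 1}" by auto
  show "entry F_mat i (n + 2 - j) * phi_sign n (n + 2 - j) + phi_sign n i * entry F_mat j (n + 2 - i) = 0"
  \<comment> \<open>For n >= 2 rows 1 and 2 carry the same sign, so opposite entries cancel. For n =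
    1 a single entry is left and the two signs themselves cancel.\<close>
  proof (cases "n = 1")
    case True
    then show ?thesis unfolding entry_F_mat[OF ij(1) r(2)] entry_F_mat[OF ij(2) r(1)]
      using ij by (auto simp: phi_sign_def)
  next
    case False
    then have "odd n \<Longrightarrow> n \<ge> 3" using n_pos by presburger
    then have "phi_sign n 1 = 1" "phi_sign n 2 = 1" "phi_sign n (n + 1) = phi_sign n n"
      using n_pos by (auto simp: phi_sign_def)
    moreover have "n + 2 - k = 1 \<longleftrightarrow> k = n + 1" "n + 2 - k = n \<longleftrightarrow> k = 2"
      if "k \<in> {1..n + 1}" for k using that n_pos False by auto
    ultimately show ?thesis unfolding entry_F_mat[OF ij(1) r(2)] entry_F_mat[OF ij(2) r(1)]
      using ij False by auto
  qed
qed

text \<open>Outside Option 2 with odd n >= 3 this field turns out to be F. For n >= 2 the only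
  coordinate that can lie in row n + 1 is \<open>s (n + 1) 1\<close>, for odd n; in Option 1 it
  enters the chart only through \<open>s (n + 1) 1 + s 2 1 * s n 1\<close>, on which the two
  contributions cancel.\<close>

lemma ex_F0:
  obtains F0 where "F0 \<in> VF" "F0 \<in> AMSY n Om" "F0 tx = 0" "F0 ty = 0"
    "\<forall>i\<in>{1..n + 1}. \<forall>j\<in>{1..n + 1}. F0 (s i j) =
      (if i = 2 then cst (if j = 1 then wt1 else 0)
       else if i = n + 1 then (\<lambda>_. - wt1) * s n j else 0)"
proof -
  have low: "\<forall>i\<in>{1..n + 1}. \<forall>j\<in>{1..n + 1}. i \<le> j \<longrightarrow> entry F_mat i j = 0"
    by (simp add: entry_F_mat del: One_nat_def)
  have nil: "F_mat * (F_mat * F_mat) = 0\<^sub>m (n + 1) (n + 1)"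
    by (rule cube_zeroI[OF F_mat_carrier]) (auto simp: entry_F_mat)
  obtain V where V: "is_R_g n Om F_mat\<^sup>T V" "V tx = 0" "V ty = 0"
    and Vs: "\<And>i j. i \<in> {1..n + 1} \<Longrightarrow> j \<in> {1..n + 1} \<Longrightarrow>
      V (s i j) = (\<Sum>l = 1..n + 1. cst (entry F_mat i l) * s l j)"
    using ex_nilpotent_R_g[OF F_mat_carrier low nil F_mat_lie] by blast
  have "F_mat\<^sup>T \<in> lie_G n" by (rule lie_G_I[OF F_mat_carrier _ F_mat_lie]) (use low in simp)
  then have "V \<in> AMSY n Om" using V(1) by (rule AMSY_R_g)
  moreover have "V (s i j) = (if i = 2 then cst (if j = 1 then wt1 else 0)
       else if i = n + 1 then (\<lambda>_. - wt1) * s n j else 0)"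
    if ij: "i \<in> {1..n + 1}" "j \<in> {1..n + 1}" for i j
  proof
    fix p
    have "V (s i j) p = (\<Sum>l = 1..n + 1. cst (entry F_mat i l) p * s l j p)"
      unfolding Vs[OF ij] sum_fun_apply by simp
    also have "\<dots> = (\<Sum>l = 1..n + 1. if l = (if i = 2 then 1 else n)
        then (if i = 2 then wt1 else if i = n + 1 then - wt1 else 0) * s l j p else 0)"
      by (intro sum.cong refl, cases "p \<in> T n Om") (use ij in \<open>auto simp: entry_F_mat\<close>)
    also have "\<dots> = (if i = 2 then wt1 else if i = n + 1 then - wt1 else 0) * s (if i = 2 then 1 else n) j p"
      using n_pos by (subst sum.delta) auto
    also have "\<dots> = (if i = 2 then cst (if j = 1 then wt1 else 0)
       else if i = n + 1 then (\<lambda>_. - wt1) * s n j else 0) p"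
    proof (cases "i = 2")
      case True
      have "s 1 j p = cst (if j = 1 then 1 else 0) p"
      proof (cases "j = 1")
        case False
        then have "s 1 j p = 0" using ij by (intro s_upper_apply) auto
        then show ?thesis using False by (simp add: on_T_def)
      qed (simp only: s_11 simp_thms if_True)
      then show ?thesis using True by (auto simp: on_T_def)
    qed auto
    finally show "V (s i j) p = (if i = 2 then cst (if j = 1 then wt1 else 0)
       else if i = n + 1 then (\<lambda>_. - wt1) * s n j else 0) p" .
  qed
  ultimately show ?thesis using that V(2,3) AMSY_subset_VF by blast
qed

text \<open>The matrix unit at (n + 1, 1) belongs to the Lie algebra because for odd n the signs of
  the first and the last row of Phi are opposite. It adds multiples of row 1, that is of (1, 0, ...,
  0), to the last row.\<close>

lemma ex_Q:
  assumes n: "odd n"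
  obtains Q where "Q \<in> VF" "Q \<in> AMSY n Om" "Q tx = 0" "Q ty = 0"
    "\<forall>i\<in>{1..n + 1}. \<forall>j\<in>{1..n + 1}.
      Q (s i j) = cst (if i = n + 1 \<and> j = 1 then 1 else 0)"
proof -
  define A :: "complex mat" where "A = mat1 (n + 1) (\<lambda>i j. if i = n + 1 \<and> j = 1 then 1 else 0)"
  have A: "A \<in> carrier_mat (n + 1) (n + 1)" unfolding A_def by (rule mat1_carrier)
  have e: "entry A i j = (if i = n + 1 \<and> j = 1 then 1 else 0)"
    if "i \<in> {1..n + 1}" "j \<in> {1..n + 1}" for i j
    unfolding A_def by (rule entry_mat1[OF that])
  have low: "\<forall>i\<in>{1..n + 1}. \<forall>j\<in>{1..n + 1}. i \<le> j \<longrightarrow> entry A i j = 0"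
    using n_pos by (simp add: e)
  have nil: "A * (A * A) = 0\<^sub>m (n + 1) (n + 1)"
    by (rule cube_zeroI[OF A]) (use n_pos in \<open>auto simp: e\<close>)
  have lie: "A * Phi n + Phi n * A\<^sup>T = 0\<^sub>m (n + 1) (n + 1)"
    unfolding mult_Phi_transpose_eq_0_iff[OF A]
  proof (intro ballI)
    fix i j assume ij: "i \<in> {1..n + 1}" "j \<in> {1..n + 1}"
    then have r: "n + 2 - i \<in> {1..n + 1}" "n + 2 - j \<in> {1..n + 1}" by auto
    show "entry A i (n + 2 - j) * phi_sign n (n + 2 - j) + phi_sign n i * entry A j (n + 2 - i) = 0"
      unfolding e[OF ij(1) r(2)] e[OF ij(2) r(1)] using ij n n_pos by (auto simp: phi_sign_def)
  qed
  obtain V where V: "is_R_g n Om A\<^sup>T V" "V tx = 0" "V ty = 0"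
    and Vs: "\<And>i j. i \<in> {1..n + 1} \<Longrightarrow> j \<in> {1..n + 1} \<Longrightarrow>
      V (s i j) = (\<Sum>l = 1..n + 1. cst (entry A i l) * s l j)"
    using ex_nilpotent_R_g[OF A low nil lie] by blast
  have "A\<^sup>T \<in> lie_G n" by (rule lie_G_I[OF A _ lie]) (use low in simp)
  then have "V \<in> AMSY n Om" using V(1) by (rule AMSY_R_g)
  moreover have "V (s i j) = cst (if i = n + 1 \<and> j = 1 then 1 else 0)"
    if ij: "i \<in> {1..n + 1}" "j \<in> {1..n + 1}" for i j
  proof
    fix p
    have "V (s i j) p = (\<Sum>l = 1..n + 1. cst (entry A i l) p * s l j p)"
      unfolding Vs[OF ij] sum_fun_apply by simp
    also have "\<dots> = (\<Sum>l = 1..n + 1. if l = 1 then (if i = n + 1 then s l j p else 0) else 0)"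
      by (intro sum.cong refl, cases "p \<in> T n Om") (use ij in \<open>auto simp: e\<close>)
    also have "\<dots> = (if i = n + 1 then s 1 j p else 0)"
      by (subst sum.delta) auto
    also have "s 1 j p = cst (if j = 1 then 1 else 0) p"
    proof (cases "j = 1")
      case False
      then have "s 1 j p = 0" using ij by (intro s_upper_apply) auto
      then show ?thesis using False by (simp add: on_T_def)
    qed (simp only: s_11 simp_thms if_True)
    finally show "V (s i j) p = cst (if i = n + 1 \<and> j = 1 then 1 else 0) p"
      by (auto simp: on_T_def)
  qed
  ultimately show ?thesis using that V(2,3) AMSY_subset_VF by blast
qed

end

section \<open>Brackets with the modular vector field\<close>

context modular_field
begin

context
  fixes F0
  assumes F0: "F0 \<in> VF" and F0x: "F0 tx = 0" and F0y: "F0 ty = 0"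
    and F0_entries: "\<forall>i\<in>{1..n + 1}. \<forall>j\<in>{1..n + 1}. F0 (s i j) =
      (if i = 2 then cst (if j = 1 then wt1 else 0)
       else if i = n + 1 then (\<lambda>_. - wt1) * s n j else 0)"
begin

lemma F0s: "i \<in> {1..n + 1} \<Longrightarrow> j \<in> {1..n + 1} \<Longrightarrow> F0 (s i j) =
    (if i = 2 then cst (if j = 1 then wt1 else 0)
     else if i = n + 1 then (\<lambda>_. - wt1) * s n j else 0)"
  using F0_entries by blast

lemma F0_s:
  assumes "p \<in> T n Om" "i \<in> {1..n + 1}" "j \<in> {1..n + 1}"
  shows "F0 (s i j) p = (if i = 2 then if j = 1 then wt1 else 0
    else if i = n + 1 then - wt1 * s n j p else 0)"
  unfolding F0s[OF assms(2,3)] using assms(1) by simp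

lemma F0_diag: "\<forall>i\<in>{1..n + 1}. F0 (s i i) = 0"
proof
  fix i assume i: "i \<in> {1..n + 1}"
  have "s n (n + 1) = 0" by (rule s_upper) (use n_pos in auto)
  then show "F0 (s i i) = 0" unfolding F0s[OF i i] by (auto simp: on_T_def)
qed

text \<open>Differentiating the factor \<open>s 2 1\<close> in the formulas for R produces
  \<open>wt1\<close> times the column index, the column part of the weights of H. The row part comes
  from the rows 2 and n + 1 that \<open>F0\<close> moves.\<close>

lemma bracket_R_F0: "lie_bracket R F0 = H"
proof (rule vf_eqI_entries)
  note vert = F0 F0x F0y F0_diag
  show "lie_bracket R F0 \<in> VF" "H \<in> VF" by (rule lie_bracket_in_VF[OF R_VF F0], rule H_VF)
  have B: "lie_bracket R F0 f p = R (F0 f) p - F0 (R f) p" for f p by (rule lie_bracket_apply)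
  have F021: "F0 (s 2 1) = cst wt1" using F0s[of 2 1] n_pos by simp
  show "lie_bracket R F0 tx = H tx"
  proof
    fix p
    have "lie_bracket R F0 tx p = tx p * cst wt1 p"
      unfolding B F0x VF_zero[OF R_VF] R_tx vertical_R_x[OF vert] F021 by simp
    also have "\<dots> = H tx p" using weightD(3)[OF H_x, of p] by (auto simp: on_T_def)
    finally show "lie_bracket R F0 tx p = H tx p" .
  qed
  show "lie_bracket R F0 ty = H ty"
  proof
    fix p
    have "lie_bracket R F0 ty p = of_nat (n + 2) * (ty p * cst wt1 p)"
      unfolding B F0y VF_zero[OF R_VF] R_ty vertical_R_y[OF vert] F021 by (simp add: algebra_simps)
    also have "\<dots> = H ty p" using weightD(3)[OF H_y, of p] by (auto simp: on_T_def)
    finally show "lie_bracket R F0 ty p = H ty p" .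
  qed
  fix i k assume c: "(i, k) \<in> set (coord_entries n)"
  then have ik: "i \<in> {1..n + 1}" "k \<in> {1..n + 1}" by (auto simp: in_coord_entries_iff)
  show "lie_bracket R F0 (s i k) = H (s i k)"
  proof
    fix p
    show "lie_bracket R F0 (s i k) p = H (s i k) p"
    proof (cases "p \<in> T n Om")
      case False
      then show ?thesis
        unfolding B using VF_out[OF R_VF False] VF_out[OF F0 False] VF_out[OF H_VF False] by simp
    next
      case p: True
      have H': "H (s i k) p = entry_weight i k * s i k p" by (rule weightD(3)[OF H_s[OF ik]])
      have RF: "F0 (R (s i k)) p = (if i \<le> n then ycoeff i p * F0 (s (i + 1) k) p else 0)
        - s 2 2 p * (if 2 \<le> k then F0 (s i (k - 1)) p else 0)
        - of_nat k * (wt1 * s i k p + s 2 1 p * F0 (s i k) p)"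
        unfolding R_s[OF ik] vertical_R_entry[OF vert ik] F021 using p by simp
      have yn: "ycoeff n p = - 1" if "n \<ge> 2" using ycoeff_n[OF that] p by simp
      have k1: "k - 1 \<in> {1..n + 1}" if "2 \<le> k" using that ik by auto
      consider "i = 2" | "3 \<le> i" "i < n" | "3 \<le> i" "i = n" | "odd n" "3 \<le> n" "i = n + 1" "k = 1"
      proof (cases "i = n + 1")
        case True
        then have o: "odd n" "k = 1" using c by (auto simp: in_coord_entries_iff split: if_splits)
        then show ?thesis using that(1,4) True n_pos by (cases "n = 1"; cases "n = 2") auto
      next
        case False
        have "i \<noteq> 1" using c by (auto simp: in_coord_entries_iff)
        then have "i = 2 \<or> 3 \<le> i \<and> i < n \<or> 3 \<le> i \<and> i = n" using ik False by auto
        then show ?thesis using that(1,2,3) by blast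
      qed
      then show ?thesis
      proof cases
        case 1
        have R2: "F0 (R (s 2 k)) p = (if 2 \<le> n then ycoeff 2 p * F0 (s 3 k) p else 0)
            - s 2 2 p * (if 2 \<le> k then F0 (s 2 (k - 1)) p else 0)
            - of_nat k * (wt1 * s 2 k p + s 2 1 p * F0 (s 2 k) p)"
          using RF 1 by simp
        have "F0 (s 2 k) = cst (if k = 1 then wt1 else 0)" using F0s[of 2 k] ik 1 by simp
        then have R0: "R (F0 (s 2 k)) p = 0" using VF_cst[OF R_VF] by simp
        have F21: "F0 (s 2 1) p = wt1" using F0_s[OF p, of 2 1] n_pos by simp
        have "k = 1 \<or> (k = 2 \<and> n \<ge> 3)"
          using c 1 by (cases "n = 2") (auto simp: in_coord_entries_iff split: if_splits)
        then consider "k = 1" | "k = 2" "n \<ge> 3" by blast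
        then have "lie_bracket R F0 (s 2 k) p = H (s 2 k) p"
        proof cases
          case k: 1
          \<comment> \<open>Row 3 is moved by \<open>F0\<close> only if it is the last row, so for n
            = 2; the right-hand side is written so that it vanishes when \<open>wt1\<close> is
            1.\<close>
          have e3: "(if 2 \<le> n then ycoeff 2 p * F0 (s 3 1) p else 0) = 2 * (1 - wt1) * - s 2 1 p"
          proof (cases "n = 2")
            case True
            then have "ycoeff 2 p = - 1" using yn by simp
            moreover have "wt1 = 2" unfolding wt1_def using True by (rule if_P)
            moreover have "F0 (s 3 1) p = - wt1 * s 2 1 p" using F0_s[OF p, of 3 1] True by simp
            ultimately show ?thesis using True by simp
          next
            case False
            then have "wt1 = 1" by (simp add: wt1_def)
            moreover have "F0 (s 3 1) p = 0" if "2 \<le> n" using F0_s[OF p, of 3 1] that False by simp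
            ultimately show ?thesis by simp
          qed
          have Hk: "H (s 2 1) p = 2 * s 2 1 p"
            using weightD(3)[OF H_s[of 2 1], of p] row_weight_2 n_pos by (simp add: entry_weight_def)
          show ?thesis unfolding B R0 R2 unfolding k e3 F21 Hk by (simp add: algebra_simps)
        next
          case k: 2
          have "F0 (s 3 2) p = 0" "F0 (s 2 2) p = 0"
            using F0_s[OF p, of 3 2] F0_s[OF p, of 2 2] k by simp_all
          moreover have wt1: "wt1 = 1" using k by (simp add: wt1_def)
          moreover have "H (s 2 2) p = 3 * s 2 2 p"
            using weightD(3)[OF H_s[of 2 2], of p] row_weight_2 wt1 k by (simp add: entry_weight_def)
          ultimately show ?thesis
            unfolding B R0 R2 using F21 k by (simp add: algebra_simps)
        qed
        then show ?thesis using 1 by simp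
      next
        case 2
        have "F0 (s i k) = 0" using F0s[OF ik] 2 by auto
        then have "R (F0 (s i k)) p = 0" "F0 (s i k) p = 0" using VF_zero[OF R_VF] by auto
        moreover have "F0 (s (i + 1) k) p = 0" using F0_s[OF p, of "i + 1" k] ik 2 by auto
        moreover have "F0 (s i (k - 1)) p = 0" if "2 \<le> k"
          unfolding F0_s[OF p ik(1) k1[OF that]] using 2 by simp
        ultimately show ?thesis
          unfolding B H' RF using 2 by (auto simp: entry_weight_def row_weight_def wt1_def algebra_simps)
      next
        case 3
        have "F0 (s i k) = 0" using F0s[OF ik] 3 by auto
        then have "R (F0 (s i k)) p = 0" "F0 (s i k) p = 0" using VF_zero[OF R_VF] by auto
        \<comment> \<open>Together with \<open>ycoeff n\<close> = -1 this motion of the last row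
          yields the row weight -1 of row n.\<close>
        moreover have "F0 (s (i + 1) k) p = - wt1 * s n k p" using F0_s[OF p, of "i + 1" k] ik 3 by auto
        moreover have "F0 (s i (k - 1)) p = 0" if "2 \<le> k"
          unfolding F0_s[OF p ik(1) k1[OF that]] using 3 by simp
        ultimately show ?thesis
          unfolding B H' RF using 3 yn by (auto simp: entry_weight_def row_weight_def wt1_def algebra_simps)
      next
        case 4
        have n1: "n \<in> {1..n + 1}" "1 \<in> {1..n + 1}" using 4 by auto
        have "F0 (s i k) = (\<lambda>_. - wt1) * s n 1" using F0s[OF ik] 4 by auto
        then have "R (F0 (s i k)) = (\<lambda>_. - wt1) * R_entry n 1"
          using VF_cmult[OF R_VF s_regular[OF n1]] R_s[OF n1] by simp
        moreover have "s n (n + 1) p = 0" by (rule s_upper_apply) (use n1 in auto)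
        then have "R_entry n 1 p = - s (n + 1) 1 p - s 2 1 p * s n 1 p"
          using yn 4 by (simp add: R_entry_def)
        moreover have "F0 (s i k) p = - wt1 * s n 1 p" using F0_s[OF p ik] 4 by auto
        ultimately show ?thesis
          unfolding B H' RF using 4 by (auto simp: entry_weight_def row_weight_def wt1_def algebra_simps)
      qed
    qed
  qed
qed

end

text \<open>Every function of the chart is an eigenfunction of H, the modified coordinate included
  since both of its summands have weight 2. So H is diagonal in the chart, and the coordinate dual
  to F has weight 2.\<close>

lemma bracket_H_F:
  assumes P: "is_partial_derivative n Om (chart opt n Om) 2 P"
  shows "lie_bracket H (cscale a P) = cscale (- 2) (cscale a P)"
proof (rule vf_eqI_chart[where opt = opt])
  have PV: "P \<in> VF" using P by (simp add: is_partial_derivative_def)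
  define F where "F = cscale a P"
  have F: "F \<in> VF" unfolding F_def by (rule cscale_in_VF[OF PV])
  show "lie_bracket H (cscale a P) \<in> VF" "cscale (- 2) (cscale a P) \<in> VF"
    using F lie_bracket_in_VF[OF H_VF] cscale_in_VF by (auto simp: F_def)
  fix j assume j: "j \<in> chart_idx n"
  then have "P (chart opt n Om j) = cst (if j = 2 then 1 else 0)"
    using P by (auto simp: is_partial_derivative_def)
  then have Fj: "F (chart opt n Om j) = cst (if j = 2 then a else 0)"
    unfolding F_def by (auto simp: fun_eq_iff on_T_def)
  obtain w where w: "weight H w (chart opt n Om j)" "j = 2 \<Longrightarrow> w = 2"
    using j
  proof (cases rule: chart_cases[where opt = opt])
    case 1
    show ?thesis by (rule that[of wt1]) (use 1 H_x in auto)
  next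
    case 2
    show ?thesis by (rule that[of "of_nat (n + 2) * wt1"]) (use 2 H_y n_pos in auto)
  next
    case 3
    have r: "1 \<in> {1..n + 1}" "2 \<in> {1..n + 1}" "n \<in> {1..n + 1}" "n + 1 \<in> {1..n + 1}"
      using 3 by auto
    have e: "entry_weight (n + 1) 1 = 2" "entry_weight 2 1 + entry_weight n 1 = 2"
      using 3 by (auto simp: entry_weight_def row_weight_def wt1_def)
    have "weight H 2 (s 2 1 * s n 1)"
      using weight_mult[OF H_VF H_s[OF r(2,1)] H_s[OF r(3,1)]] by (simp only: e)
    then have "weight H 2 (s (n + 1) 1 + s 2 1 * s n 1)"
      using weight_add[OF H_VF, of 2 "s (n + 1) 1"] H_s[OF r(4,1)] by (simp only: e)
    then show ?thesis using 3 by (intro that[of 2]) simp_all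
  next
    case (4 i k)
    then have ik: "i \<in> {1..n + 1}" "k \<in> {1..n + 1}" by (auto simp: in_coord_entries_iff)
    have "entry_weight 2 1 = 2" using row_weight_2 by (simp add: entry_weight_def)
    then show ?thesis using 4 H_s[OF ik] by (intro that[of "entry_weight i k"]) auto
  qed
  have "H (F (chart opt n Om j)) = 0" unfolding Fj by (rule VF_cst[OF H_VF])
  moreover have "F (H (chart opt n Om j)) = (\<lambda>_. w) * F (chart opt n Om j)"
    unfolding weightD(2)[OF w(1)] by (rule VF_cmult[OF F weightD(1)[OF w(1)]])
  ultimately show "lie_bracket H (cscale a P) (chart opt n Om j) = cscale (- 2) (cscale a P) (chart opt n Om j)"
    unfolding F_def[symmetric] using w(2) by (auto simp: fun_eq_iff lie_bracket_def Fj on_T_def)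
qed

end

section \<open>The Lie algebra generated by an \<open>sl\<^sub>2\<close>-triple\<close>

context dwork_family
begin

definition triple_comb :: "vfield \<Rightarrow> vfield \<Rightarrow> vfield \<Rightarrow> complex \<Rightarrow> complex \<Rightarrow> complex \<Rightarrow> vfield" where
  "triple_comb D H F a b d = cscale a D + cscale b H + cscale d F"

lemma triple_comb_apply: "triple_comb D H F a b d f p = a * D f p + b * H f p + d * F f p"
  by (simp add: triple_comb_def)

lemma VF_triple_comb:
  assumes V: "V \<in> VF" and f: "f \<in> OT" "g \<in> OT" "h \<in> OT"
  shows "V (\<lambda>p. a * f p + b * g p + d * h p) p = a * V f p + b * V g p + d * V h p"
proof -
  have e: "(\<lambda>p. a * f p + b * g p + d * h p) = (\<lambda>_. a) * f + (\<lambda>_. b) * g + (\<lambda>_. d) * h"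
    by (simp add: fun_eq_iff)
  note r = O_T_cmult[OF f(1), of a] O_T_cmult[OF f(2), of b] O_T_cmult[OF f(3), of d]
  show ?thesis
    unfolding e VF_add[OF V O_T.add[OF r(1,2)] r(3)] VF_add[OF V r(1,2)]
      VF_cmult[OF V f(1)] VF_cmult[OF V f(2)] VF_cmult[OF V f(3)] by simp
qed

lemma bracket_apply_eq:
  "lie_bracket V W = U \<Longrightarrow> V (W f) p = U f p + W (V f) p"
  using lie_bracket_apply[of V W f p] by (simp add: eq_diff_eq)

context
  fixes D H F :: vfield
  assumes D: "D \<in> VF" and H: "H \<in> VF" and F: "F \<in> VF"
    and DF: "lie_bracket D F = H" and HD: "lie_bracket H D = cscale 2 D"
    and HF: "lie_bracket H F = cscale (- 2) F" and nz: "F \<noteq> 0"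
begin

abbreviation "comb \<equiv> triple_comb D H F"

lemma comb_VF: "comb a b d \<in> VF"
  unfolding triple_comb_def by (intro add_in_VF cscale_in_VF D H F)

lemma bracket_comb:
  "lie_bracket (comb a b d) (comb a' b' d') =
    comb (2 * (b * a' - a * b')) (a * d' - d * a') (2 * (d * b' - b * d'))"
proof (intro ext)
  fix f p
  show "lie_bracket (comb a b d) (comb a' b' d') f p =
    comb (2 * (b * a' - a * b')) (a * d' - d * a') (2 * (d * b' - b * d')) f p"
  \<comment> \<open>Off the regular functions all fields are 0 by convention; expanding the bracket
    uses linearity, which is available on regular functions only.\<close>
  proof (cases "f \<in> OT")
    case False
    then show ?thesis
      using VF_not_regular[OF lie_bracket_in_VF[OF comb_VF comb_VF] False] VF_not_regular[OF comb_VF False]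
      by simp
  next
    case True
    note r = VF_regular[OF D True] VF_regular[OF H True] VF_regular[OF F True]
    have d: "comb a b d f = (\<lambda>p. a * D f p + b * H f p + d * F f p)" for a b d
      by (simp add: fun_eq_iff triple_comb_apply)
    show ?thesis
      unfolding lie_bracket_apply d triple_comb_apply
        VF_triple_comb[OF D r] VF_triple_comb[OF H r] VF_triple_comb[OF F r]
        bracket_apply_eq[OF DF] bracket_apply_eq[OF HD] bracket_apply_eq[OF HF]
      by (simp add: algebra_simps)
  qed
qed

lemma comb_F: "F = comb 0 0 1"
  by (simp add: fun_eq_iff triple_comb_apply)

text \<open>Applying \<open>ad F\<close> to a linear relation isolates its coefficients one after the other.\<close>

lemma comb_eq_0D:
  assumes "comb a b d = 0"
  shows "a = 0" "b = 0" "d = 0"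
proof -
  have ad: "lie_bracket F 0 = 0"
    using VF_zero[OF F] by (auto simp: fun_eq_iff lie_bracket_def)
  have 1: "comb 0 (- a) (2 * b) = 0"
    using bracket_comb[of 0 0 1 a b d] ad unfolding assms comb_F[symmetric] by simp
  have 2: "comb 0 0 (2 * (- a)) = 0"
    using bracket_comb[of 0 0 1 0 "- a" "2 * b"] ad unfolding 1 comb_F[symmetric] by simp
  obtain f p where fp: "F f p \<noteq> 0" using nz by (auto simp: fun_eq_iff)
  show a: "a = 0" using fun_cong[OF fun_cong[OF 2, of f], of p] fp by (simp add: triple_comb_apply)
  show b: "b = 0" using fun_cong[OF fun_cong[OF 1, of f], of p] fp a by (simp add: triple_comb_apply)
  show "d = 0" using fun_cong[OF fun_cong[OF assms, of f], of p] fp a b by (simp add: triple_comb_apply)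
qed

lemma comb_inj:
  assumes "comb a b d = comb a' b' d'"
  shows "a = a'" "b = b'" "d = d'"
proof -
  have "comb (a - a') (b - b') (d - d') = comb a b d - comb a' b' d'"
    by (simp add: fun_eq_iff triple_comb_apply algebra_simps)
  then have "comb (a - a') (b - b') (d - d') = 0" using assms by simp
  from comb_eq_0D[OF this] show "a = a'" "b = b'" "d = d'" by simp_all
qed

lemma lie_generated_triple: "lie_generated n Om {D, H, F} = range (\<lambda>(a, b, d). comb a b d)"
proof
  let ?L = "range (\<lambda>(a, b, d). comb a b d)"
  have gens: "D = comb 1 0 0" "H = comb 0 1 0" "F = comb 0 0 1"
    by (simp_all add: fun_eq_iff triple_comb_apply)
  have in_L: "comb a b d \<in> ?L" for a b d by (rule range_eqI[of _ _ "(a, b, d)"]) simp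
  have add: "comb a b d + comb a' b' d' = comb (a + a') (b + b') (d + d')" for a b d a' b' d'
    by (simp add: fun_eq_iff triple_comb_apply algebra_simps)
  have scale: "cscale r (comb a b d) = comb (r * a) (r * b) (r * d)" for r a b d
    by (simp add: fun_eq_iff triple_comb_apply algebra_simps)
  have zero: "0 = comb 0 0 0" by (simp add: fun_eq_iff triple_comb_apply)
  have "is_lie_subalgebra n Om ?L"
    unfolding is_lie_subalgebra_def
  proof (intro conjI ballI allI)
    show "?L \<subseteq> VF" using comb_VF by auto
    show "0 \<in> ?L" unfolding zero by (rule in_L)
    show "V + W \<in> ?L" "lie_bracket V W \<in> ?L" if "V \<in> ?L" "W \<in> ?L" for V W
      using that by (auto simp: add bracket_comb in_L)
    show "cscale a V \<in> ?L" if "V \<in> ?L" for a V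
      using that by (auto simp: scale in_L)
  qed
  moreover have "{D, H, F} \<subseteq> ?L" using in_L gens by (metis empty_subsetI insert_subset)
  ultimately show "lie_generated n Om {D, H, F} \<subseteq> ?L"
    unfolding lie_generated_def by blast
  show "?L \<subseteq> lie_generated n Om {D, H, F}"
    unfolding lie_generated_def triple_comb_def is_lie_subalgebra_def by auto
qed

lemma triple_isomorphic_to_sl2: "isomorphic_to_sl2 (lie_generated n Om {D, H, F})"
proof -
  \<comment> \<open>D, H and F correspond to the standard basis e, h, f of
    \<open>sl2\<close>.\<close>
  define \<phi> where "\<phi> A = comb (A $$ (0, 1)) (A $$ (0, 0)) (A $$ (1, 0))" for A :: "complex mat"
  have carrier: "A \<in> carrier_mat 2 2" if "A \<in> sl2" for A using that by (simp add: sl2_def)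
  have tr: "A $$ (1, 1) = - A $$ (0, 0)" if "A \<in> sl2" for A
    using that by (simp add: sl2_def add_eq_0_iff)
  have "inj_on \<phi> sl2"
  proof (rule inj_onI)
    fix A C assume A: "A \<in> sl2" and C: "C \<in> sl2" and eq: "\<phi> A = \<phi> C"
    from comb_inj[OF eq[unfolded \<phi>_def]] tr[OF A] tr[OF C] show "A = C"
      by (intro eq_matI) (use carrier[OF A] carrier[OF C] in \<open>auto simp: less_2_cases_iff\<close>)
  qed
  moreover have "\<phi> ` sl2 = range (\<lambda>(a, b, d). comb a b d)"
  proof
    show "\<phi> ` sl2 \<subseteq> range (\<lambda>(a, b, d). comb a b d)"
      by (auto simp: \<phi>_def intro: range_eqI[of _ _ "(a, b, d)" for a b d])
    show "range (\<lambda>(a, b, d). comb a b d) \<subseteq> \<phi> ` sl2"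
    proof clarify
      fix a b d :: complex
      let ?A = "mat 2 2 (\<lambda>(i, j). if i = 0 then if j = 0 then b else a else if j = 0 then d else - b)"
      have "?A \<in> sl2" by (simp add: sl2_def)
      moreover have "\<phi> ?A = comb a b d" by (simp add: \<phi>_def)
      ultimately show "comb a b d \<in> \<phi> ` sl2" by (intro image_eqI[of _ \<phi> ?A]) (rule sym)
    qed
  qed
  ultimately have "bij_betw \<phi> sl2 (lie_generated n Om {D, H, F})"
    by (simp add: bij_betw_def lie_generated_triple)
  moreover have "\<phi> (A + C) = \<phi> A + \<phi> C" if "A \<in> sl2" "C \<in> sl2" for A C
    using carrier[OF that(1)] carrier[OF that(2)]
    by (simp add: \<phi>_def fun_eq_iff triple_comb_apply algebra_simps)
  moreover have "\<phi> (a \<cdot>\<^sub>m A) = cscale a (\<phi> A)" if "A \<in> sl2" for a A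
    using carrier[OF that] by (simp add: \<phi>_def fun_eq_iff triple_comb_apply algebra_simps)
  moreover have "\<phi> (A * C - C * A) = lie_bracket (\<phi> A) (\<phi> C)" if A: "A \<in> sl2" and C: "C \<in> sl2" for A C
  proof -
    have m: "(X * Y) $$ (i, j) = X $$ (i, 0) * Y $$ (0, j) + X $$ (i, 1) * Y $$ (1, j)"
      if "X \<in> sl2" "Y \<in> sl2" "i < 2" "j < 2" for X Y i j
      using carrier[OF that(1)] carrier[OF that(2)] that(3,4)
      by (simp add: scalar_prod_def numeral_2_eq_2)
    have d: "(A * C - C * A) $$ (i, j) = (A * C) $$ (i, j) - (C * A) $$ (i, j)" if "i < 2" "j < 2" for i j
      using carrier[OF A] carrier[OF C] that by (intro index_minus_mat) auto
    have z: "(0::nat) < 2" "(1::nat) < 2" by simp_all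
    have "(A * C - C * A) $$ (0, 1) = 2 * (A $$ (0, 0) * C $$ (0, 1) - A $$ (0, 1) * C $$ (0, 0))"
      unfolding d[OF z(1,2)] m[OF A C z(1,2)] m[OF C A z(1,2)] tr[OF A] tr[OF C]
      by (simp add: algebra_simps)
    moreover have "(A * C - C * A) $$ (0, 0) = A $$ (0, 1) * C $$ (1, 0) - A $$ (1, 0) * C $$ (0, 1)"
      unfolding d[OF z(1,1)] m[OF A C z(1,1)] m[OF C A z(1,1)] by (simp add: algebra_simps)
    moreover have "(A * C - C * A) $$ (1, 0) = 2 * (A $$ (1, 0) * C $$ (0, 0) - A $$ (0, 0) * C $$ (1, 0))"
      unfolding d[OF z(2,1)] m[OF A C z(2,1)] m[OF C A z(2,1)] tr[OF A] tr[OF C]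
      by (simp add: algebra_simps)
    ultimately show ?thesis unfolding \<phi>_def bracket_comb by (simp only:)
  qed
  ultimately show ?thesis unfolding isomorphic_to_sl2_def by blast
qed

lemma lie_generated_triple_AMSY:
  assumes "D \<in> AMSY n Om" "H \<in> AMSY n Om" "F \<in> AMSY n Om"
  shows "lie_generated n Om {D, H, F} \<subseteq> AMSY n Om"
  unfolding lie_generated_triple triple_comb_def using assms by (auto intro: AMSY_add AMSY_cscale)

end

lemma bracket_fscale_right:
  assumes V: "V \<in> VF" and W: "W \<in> VF" and U: "U \<in> VF" and h: "h \<in> OT"
  shows "lie_bracket V (W + fscale h U) = lie_bracket V W + fscale (V h) U + fscale h (lie_bracket V U)"
proof
  fix f
  have VFs: "lie_bracket V (W + fscale h U) \<in> VF"
    "lie_bracket V W + fscale (V h) U + fscale h (lie_bracket V U) \<in> VF"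
    by (intro lie_bracket_in_VF[OF V] lie_bracket_in_VF[OF V U] add_in_VF fscale_in_VF V W U h
        VF_regular[OF V h])+
  show "lie_bracket V (W + fscale h U) f =
    (lie_bracket V W + fscale (V h) U + fscale h (lie_bracket V U)) f"
  proof (cases "f \<in> OT")
    case False
    show ?thesis
      by (rule trans[OF VF_not_regular[OF VFs(1) False] VF_not_regular[OF VFs(2) False, symmetric]])
  next
    case True
    note Wf = VF_regular[OF W True] and Uf = VF_regular[OF U True]
    have e: "(W + fscale h U) f = W f + h * U f" by (simp add: fscale_def)
    have "V ((W + fscale h U) f) = V (W f) + (V h * U f + h * V (U f))"
      unfolding e VF_add[OF V Wf O_T.mult[OF h Uf]] VF_mult[OF V h Uf] ..
    then show ?thesis by (simp add: lie_bracket_def fscale_def fun_eq_iff algebra_simps)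
  qed
qed

lemma bracket_swap: "lie_bracket V W = - lie_bracket W V"
  by (simp add: lie_bracket_def fun_eq_iff)

end

context modular_field
begin

text \<open>
  In Option 2 with \<open>n \<ge> 3\<close> odd, \<open>F = F0 + s\<^sub>n\<^sub>1 Q\<close> for \<open>Q = \<partial>/\<partial>s\<^sub>n\<^sub>+\<^sub>1\<^sub>,\<^sub>1\<close>.  The field \<open>C\<close> below is
  then \<open>[R, F] - H\<close>; being diagonal in the chart, it commutes with \<open>H\<close> and with \<open>F\<close>.
\<close>

context
  fixes Q
  assumes n: "odd n" "n \<ge> 3"
    and Q: "Q \<in> VF" and QA: "Q \<in> AMSY n Om" and Qx: "Q tx = 0" and Qy: "Q ty = 0"
    and Q_entries: "\<forall>i\<in>{1..n + 1}. \<forall>j\<in>{1..n + 1}.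
      Q (s i j) = cst (if i = n + 1 \<and> j = 1 then 1 else 0)"
begin

lemma Qs: "i \<in> {1..n + 1} \<Longrightarrow> j \<in> {1..n + 1} \<Longrightarrow>
    Q (s i j) = cst (if i = n + 1 \<and> j = 1 then 1 else 0)"
  using Q_entries by blast

lemma cst_0: "cst 0 = 0"
  by (auto simp: on_T_def)

lemma Q_diag: "\<forall>i\<in>{1..n + 1}. Q (s i i) = 0"
  using Qs n cst_0 by auto

lemma bracket_R_Q:
  shows "lie_bracket R Q tx = 0" "lie_bracket R Q ty = 0"
    and "i \<in> {1..n + 1} \<Longrightarrow> j \<in> {1..n + 1} \<Longrightarrow> lie_bracket R Q (s i j) =
      (if i = n then cst (if j = 1 then 1 else 0) else if i = n + 1 then s 2 j else 0)"
proof -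
  note vert = Q Qx Qy Q_diag
  have Q21: "Q (s 2 1) = 0" using Qs[of 2 1] n cst_0 by auto
  show "lie_bracket R Q tx = 0"
  proof
    fix p show "lie_bracket R Q tx p = 0 p"
      unfolding lie_bracket_apply Qx VF_zero[OF R_VF] R_tx vertical_R_x[OF vert] Q21 by simp
  qed
  show "lie_bracket R Q ty = 0"
  proof
    fix p show "lie_bracket R Q ty p = 0 p"
      unfolding lie_bracket_apply Qy VF_zero[OF R_VF] R_ty vertical_R_y[OF vert] Q21 by simp
  qed
  assume ij: "i \<in> {1..n + 1}" "j \<in> {1..n + 1}"
  show "lie_bracket R Q (s i j) =
    (if i = n then cst (if j = 1 then 1 else 0) else if i = n + 1 then s 2 j else 0)"
  proof
    fix p
    show "lie_bracket R Q (s i j) p =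
      (if i = n then cst (if j = 1 then 1 else 0) else if i = n + 1 then s 2 j else 0) p"
    proof (cases "p \<in> T n Om")
      case False
      then show ?thesis
        using VF_out[OF lie_bracket_in_VF[OF R_VF Q] False] by auto
    next
      case p: True
      have Qsp: "Q (s i j) p = (if i = n + 1 \<and> j = 1 then 1 else 0)"
        if "i \<in> {1..n + 1}" "j \<in> {1..n + 1}" for i j
        unfolding Qs[OF that] using p by simp
      have "R (Q (s i j)) p = 0" unfolding Qs[OF ij] VF_cst[OF R_VF] by simp
      moreover have "i \<le> n \<Longrightarrow> Q (s (i + 1) j) p = (if i = n \<and> j = 1 then 1 else 0)"
        using Qsp[of "i + 1" j] ij by auto
      moreover have "Q (s i (j - 1)) p = (if i = n + 1 \<and> j = 2 then 1 else 0)" if "2 \<le> j"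
      proof -
        have "j - 1 \<in> {1..n + 1}" "j - 1 = 1 \<longleftrightarrow> j = 2" using that ij by auto
        then show ?thesis using Qsp[OF ij(1)] by simp
      qed
      moreover have "ycoeff n p = - 1" using ycoeff_n n p by simp
      moreover have "s 2 j p = 0" if "j > 2" by (rule s_upper_apply) (use that ij n in auto)
      moreover have "j = 1 \<or> j = 2 \<or> j > 2" using ij by auto
      \<comment> \<open>The 1 in row n comes from \<open>ycoeff n\<close> = -1 acting on the last
        row. In row n + 1 the entry \<open>s 2 1\<close> comes from the diagonal part of B(R) and
        \<open>s 2 2\<close> from the column shift.\<close>
      ultimately show ?thesis
        unfolding lie_bracket_apply R_s[OF ij] vertical_R_entry[OF vert ij] Q21 Qsp[OF ij]
        using p ij n by auto
    qed
  qed
qed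

text \<open>The bracket kills x and y and acts on S as left multiplication by a constant matrix with
  1 at (n, 1) and (n + 1, 2). These positions mirror each other with opposite signs, so the bracket
  is one of the generating fields.\<close>

lemma bracket_R_Q_AMSY: "lie_bracket R Q \<in> AMSY n Om"
proof -
  define A :: "complex mat" where
    "A = mat1 (n + 1) (\<lambda>i j. if i = n \<and> j = 1 \<or> i = n + 1 \<and> j = 2 then 1 else 0)"
  have A: "A \<in> carrier_mat (n + 1) (n + 1)" unfolding A_def by (rule mat1_carrier)
  have e: "entry A i j = (if i = n \<and> j = 1 \<or> i = n + 1 \<and> j = 2 then 1 else 0)"
    if "i \<in> {1..n + 1}" "j \<in> {1..n + 1}" for i j
    unfolding A_def by (rule entry_mat1[OF that])
  have "is_R_g n Om A\<^sup>T (lie_bracket R Q)"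
  proof (rule is_R_g_I[OF lie_bracket_in_VF[OF R_VF Q] A bracket_R_Q(1,2)])
    fix i j assume ij: "i \<in> {1..n + 1}" "j \<in> {1..n + 1}"
    show "lie_bracket R Q (s i j) = (\<Sum>l = 1..n + 1. cst (entry A i l) * s l j)"
    proof
      fix p
      have "(\<Sum>l = 1..n + 1. cst (entry A i l) * s l j) p = (\<Sum>l = 1..n + 1. cst (entry A i l) p * s l j p)"
        by (simp add: sum_fun_apply)
      also have "\<dots> = (\<Sum>l = 1..n + 1. if l = (if i = n then 1 else 2)
          then (if i = n \<or> i = n + 1 then s l j p else 0) else 0)"
        by (intro sum.cong refl, cases "p \<in> T n Om") (use ij in \<open>auto simp: e\<close>)
      also have "\<dots> = (if i = n then s 1 j p else if i = n + 1 then s 2 j p else 0)"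
        using n by (subst sum.delta) auto
      also have "s 1 j p = cst (if j = 1 then 1 else 0) p"
      proof (cases "j = 1")
        case False
        then have "s 1 j p = 0" using ij by (intro s_upper_apply) auto
        then show ?thesis using False by (simp add: on_T_def)
      qed (simp only: s_11 simp_thms if_True)
      finally have e: "(\<Sum>l = 1..n + 1. cst (entry A i l) * s l j) p =
          (if i = n then cst (if j = 1 then 1 else 0) p else if i = n + 1 then s 2 j p else 0)" .
      show "lie_bracket R Q (s i j) p = (\<Sum>l = 1..n + 1. cst (entry A i l) * s l j) p"
        unfolding bracket_R_Q(3)[OF ij] e by auto
    qed
  qed
  moreover have "A\<^sup>T \<in> lie_G n"
  proof (rule lie_G_I[OF A])
    show "A * Phi n + Phi n * A\<^sup>T = 0\<^sub>m (n + 1) (n + 1)"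
      unfolding mult_Phi_transpose_eq_0_iff[OF A]
    proof (intro ballI)
      fix i j assume ij: "i \<in> {1..n + 1}" "j \<in> {1..n + 1}"
      then have r: "n + 2 - i \<in> {1..n + 1}" "n + 2 - j \<in> {1..n + 1}" by auto
      show "entry A i (n + 2 - j) * phi_sign n (n + 2 - j) + phi_sign n i * entry A j (n + 2 - i) = 0"
        unfolding e[OF ij(1) r(2)] e[OF ij(2) r(1)] using ij n by (auto simp: phi_sign_def)
    qed
  qed (use n in \<open>auto simp: e\<close>)
  ultimately show ?thesis by (intro AMSY_R_g)
qed

definition C where "C = fscale (R (s n 1)) Q + fscale (s n 1) (lie_bracket R Q)"

lemma s_n1_regular: "s n 1 \<in> OT"
  using n by (auto intro: s_regular)

lemma C_VF: "C \<in> VF" and C_AMSY: "C \<in> AMSY n Om"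
proof -
  show "C \<in> AMSY n Om" unfolding C_def
    by (intro AMSY_add AMSY_fscale QA bracket_R_Q_AMSY s_n1_regular VF_regular[OF R_VF])
  then show "C \<in> VF" using AMSY_subset_VF by blast
qed

lemma R_s_n1: "p \<in> T n Om \<Longrightarrow> R (s n 1) p = - s (n + 1) 1 p - s 2 1 p * s n 1 p"
proof -
  assume p: "p \<in> T n Om"
  have r: "n \<in> {1..n + 1}" "1 \<in> {1..n + 1}" using n by auto
  have "s n (n + 1) p = 0" by (rule s_upper_apply) (use r in auto)
  moreover have "ycoeff n p = - 1" using ycoeff_n n p by simp
  ultimately show ?thesis unfolding R_s[OF r] by (simp add: R_entry_def)
qed

text \<open>On \<open>s n 1\<close> the second summand of \<open>C\<close> gives weight 1. On
  \<open>s (n + 1) 1\<close> the value R(\<open>s n 1\<close>) + \<open>s n 1 * s 2 1\<close> equals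
  - \<open>s (n + 1) 1\<close>, weight -1. All other coordinates are killed.\<close>

lemma C_chart_weight:
  assumes j: "j \<in> chart_idx n"
  obtains w where "weight C w (tcoord n Om j)" "j = 2 \<Longrightarrow> w = 0"
proof -
  have z: "weight C 0 f" if "f \<in> OT" "Q f = 0" "lie_bracket R Q f = 0" for f
    using that by (simp add: weight_0_iff C_def fscale_def)
  consider "tcoord n Om j = tx" | "tcoord n Om j = ty"
    | i k where "(i, k) \<in> set (coord_entries n)" "tcoord n Om j = s i k" "j = 2 \<longleftrightarrow> (i, k) = (2, 1)"
    using j by (rule tcoord_cases[OF n_pos, where Om = Om]) blast+
  then show ?thesis
  proof cases
    case 1
    show ?thesis by (rule that[of 0]) (use 1 z tx_regular Qx bracket_R_Q in auto)
  next
    case 2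
    show ?thesis by (rule that[of 0]) (use 2 z ty_regular Qy bracket_R_Q in auto)
  next
    case (3 i k)
    then have ik: "i \<in> {1..n + 1}" "k \<in> {1..n + 1}" by (auto simp: in_coord_entries_iff)
    note val = Qs[OF ik] bracket_R_Q(3)[OF ik]
    consider "i = n" "k = 1" | "i = n" "k \<noteq> 1" | "i = n + 1" "k = 1" | "i < n"
      using 3(1) n by (fastforce simp: in_coord_entries_iff)
    then show ?thesis
    proof cases
      case 1
      have "C (s i k) p = 1 * s i k p" for p
        unfolding C_def using 1 val n by (cases "p \<in> T n Om") (auto simp: on_T_def)
      then have "weight C 1 (s i k)" using ik by (auto simp: weight_def s_regular fun_eq_iff)
      then show ?thesis using 1 3 n by (intro that[of 1]) auto
    next
      case 2
      then have "weight C 0 (s i k)" using z[OF s_regular[OF ik]] val n cst_0 by auto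
      then show ?thesis using 3 by (intro that[of 0]) auto
    next
      case n1: 3
      have "C (s i k) p = - 1 * s i k p" for p
        unfolding C_def using n1 val n R_s_n1[of p]
        by (cases "p \<in> T n Om") (auto simp: on_T_def algebra_simps)
      then have "weight C (- 1) (s i k)" using ik by (auto simp: weight_def s_regular fun_eq_iff)
      then show ?thesis using n1 3 n by (intro that[of "- 1"]) auto
    next
      case 4
      then have "weight C 0 (s i k)" using z[OF s_regular[OF ik]] val n cst_0 by auto
      then show ?thesis using 3 by (intro that[of 0]) auto
    qed
  qed
qed

lemma bracket_H_C: "lie_bracket H C = 0"
proof (rule vf_eqI_tcoord)
  show "lie_bracket H C \<in> VF" "0 \<in> VF" by (rule lie_bracket_in_VF[OF H_VF C_VF], rule zero_in_VF)
  fix j assume j: "j \<in> chart_idx n"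
  obtain w where w: "weight C w (tcoord n Om j)" using C_chart_weight[OF j] by blast
  obtain v where v: "weight H v (tcoord n Om j)"
    using j
  proof (rule tcoord_cases[OF n_pos, where Om = Om])
    fix i k assume "(i, k) \<in> set (coord_entries n)" "tcoord n Om j = s i k"
    then show ?thesis using that H_s[of i k] by (auto simp: in_coord_entries_iff)
  qed (use that H_x H_y in auto)
  have "H (C (tcoord n Om j)) = (\<lambda>_. w) * H (tcoord n Om j)"
    unfolding weightD(2)[OF w] by (rule VF_cmult[OF H_VF tcoord_in_OT[OF j]])
  moreover have "C (H (tcoord n Om j)) = (\<lambda>_. v) * C (tcoord n Om j)"
    unfolding weightD(2)[OF v] by (rule VF_cmult[OF C_VF tcoord_in_OT[OF j]])
  ultimately show "lie_bracket H C (tcoord n Om j) = 0 (tcoord n Om j)"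
    using weightD(3)[OF w] weightD(3)[OF v] by (auto simp: lie_bracket_def fun_eq_iff)
qed

text \<open>The coordinates have constant derivatives along F, so only the second one matters, and
  its weight under \<open>C\<close> is 0.\<close>

lemma bracket_F_C:
  assumes F: "F \<in> VF" and Fj: "\<And>j. j \<in> chart_idx n \<Longrightarrow> F (tcoord n Om j) = cst (if j = 2 then a else 0)"
  shows "lie_bracket F C = 0"
proof (rule vf_eqI_tcoord)
  show "lie_bracket F C \<in> VF" "0 \<in> VF" by (rule lie_bracket_in_VF[OF F C_VF], rule zero_in_VF)
  fix j assume j: "j \<in> chart_idx n"
  obtain w where w: "weight C w (tcoord n Om j)" "j = 2 \<Longrightarrow> w = 0" using C_chart_weight[OF j] by blast
  have "F (C (tcoord n Om j)) = (\<lambda>_. w) * F (tcoord n Om j)"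
    unfolding weightD(2)[OF w(1)] by (rule VF_cmult[OF F tcoord_in_OT[OF j]])
  also have "\<dots> = 0" unfolding Fj[OF j] using w(2) by (auto simp: on_T_def fun_eq_iff)
  finally show "lie_bracket F C (tcoord n Om j) = 0 (tcoord n Om j)"
    unfolding lie_bracket_def Fj[OF j] VF_cst[OF C_VF] by simp
qed

end

text \<open>Outside Option 2 with odd n >= 3, [R, F] is H already and D is R. In that case put K =
  [R, F] - H, so D = R + t_2 K. Then [D, F] = [R, F] - F(t_2) K - t_2 [F, K] is H since F(t_2) = 1
  and [F, K] = 0, and [H, D] = 2 D since t_2 has weight 2 and [H, K] = 0.\<close>

lemma sl2_triple:
  assumes P: "is_partial_derivative n Om (chart opt n Om) 2 P"
    and F: "F = cscale wt1 P" and D: "D = D_field opt n Om R H F"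
  shows "D \<in> AMSY n Om" "F \<in> AMSY n Om" "lie_bracket D F = H" "lie_bracket H D = cscale 2 D"
proof -
  obtain F0 where F0: "F0 \<in> VF" and F0A: "F0 \<in> AMSY n Om" and F0x: "F0 tx = 0" and F0y: "F0 ty = 0"
    and F0_entries: "\<forall>i\<in>{1..n + 1}. \<forall>j\<in>{1..n + 1}. F0 (s i j) =
      (if i = 2 then cst (if j = 1 then wt1 else 0)
       else if i = n + 1 then (\<lambda>_. - wt1) * s n j else 0)"
    using ex_F0 by blast
  have F0s: "F0 (s i j) = (if i = 2 then cst (if j = 1 then wt1 else 0)
       else if i = n + 1 then (\<lambda>_. - wt1) * s n j else 0)"
    if "i \<in> {1..n + 1}" "j \<in> {1..n + 1}" for i j
    using F0_entries that by blast
  have RF0: "lie_bracket R F0 = H" by (rule bracket_R_F0[OF F0 F0x F0y F0_entries])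
  have RA: "R \<in> AMSY n Om" using modular by (rule AMSY_modular)
  have PV: "P \<in> VF" using P by (simp add: is_partial_derivative_def)
  have c0: "cst 0 = 0" by (auto simp: on_T_def)
  have "D \<in> AMSY n Om \<and> F \<in> AMSY n Om \<and> lie_bracket D F = H \<and> lie_bracket H D = cscale 2 D"
  proof (cases "opt = Option2 \<and> odd n \<and> n \<ge> 3")
    case False
    have "F = F0" unfolding F
    proof (rule partial_derivative_eqI[OF P F0 F0x F0y])
      fix i k assume c: "(i, k) \<in> set (coord_entries n)"
        and x: "odd n \<Longrightarrow> n \<ge> 3 \<Longrightarrow> opt = Option1 \<Longrightarrow> (i, k) \<noteq> (n + 1, 1)"
      then have ik: "i \<in> {1..n + 1}" "k \<in> {1..n + 1}" by (auto simp: in_coord_entries_iff)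
      have "i \<noteq> n + 1 \<or> i = 2"
      proof (rule ccontr)
        assume i: "\<not> (i \<noteq> n + 1 \<or> i = 2)"
        then have "odd n" "k = 1" using c by (auto simp: in_coord_entries_iff split: if_splits)
        moreover have "n \<ge> 3" using i n_pos \<open>odd n\<close> by (cases "n = 1"; cases "n = 2") auto
        moreover have "opt = Option1" using False calculation by (cases opt) auto
        ultimately show False using x i by auto
      qed
      then show "F0 (s i k) = cst (if (i, k) = (2, 1) then wt1 else 0)"
        unfolding F0s[OF ik] using c0 by auto
    next
      assume n: "odd n" "n \<ge> 3" "opt = Option1"
      have r: "s (n + 1) 1 \<in> OT" "s n 1 \<in> OT" using n by (auto intro: s_regular)
      have "F0 (s (n + 1) 1) = (\<lambda>_. - wt1) * s n 1" "F0 (s n 1) = 0" "F0 (s 2 1) = cst wt1"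
        using F0s[of "n + 1" 1] F0s[of n 1] F0s[of 2 1] n by auto
      then show "F0 (s (n + 1) 1 + s 2 1 * s n 1) = 0"
        unfolding VF_add[OF F0 r(1) O_T.mult[OF s_21_regular r(2)]] VF_mult[OF F0 s_21_regular r(2)]
        by (auto simp: fun_eq_iff on_T_def)
    qed
    moreover have "D = R"
    proof (cases opt)
      case Option2
      then show ?thesis unfolding D \<open>F = F0\<close> by (simp add: D_field_def RF0 fscale_def fun_eq_iff)
    qed (simp add: D D_field_def)
    ultimately show ?thesis using RA F0A RF0 bracket_H_R by simp
  next
    case True
    then have opt: "opt = Option2" and n: "odd n" "n \<ge> 3" by auto
    have wt1: "wt1 = 1" using n by (simp add: wt1_def)
    obtain Q where Q: "Q \<in> VF" and QA: "Q \<in> AMSY n Om" and Qx: "Q tx = 0" and Qy: "Q ty = 0"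
      and Q_entries: "\<forall>i\<in>{1..n + 1}. \<forall>j\<in>{1..n + 1}.
        Q (s i j) = cst (if i = n + 1 \<and> j = 1 then 1 else 0)"
      using ex_Q[OF n(1)] by blast
    have Qs: "Q (s i j) = cst (if i = n + 1 \<and> j = 1 then 1 else 0)"
      if "i \<in> {1..n + 1}" "j \<in> {1..n + 1}" for i j
      using Q_entries that by blast
    have sn: "s n 1 \<in> OT" using n by (auto intro: s_regular)
    \<comment> \<open>In the original chart \<open>F0\<close> still moves the coordinate
      \<open>s (n + 1) 1\<close> with velocity - \<open>s n 1\<close>; the added multiple of
      \<open>Q\<close> stops it.\<close>
    define F' where "F' = F0 + fscale (s n 1) Q"
    have F'V: "F' \<in> VF" unfolding F'_def by (intro add_in_VF fscale_in_VF F0 Q sn)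
    have FF': "F = F'" unfolding F
    proof (rule partial_derivative_eqI[OF P F'V])
      show "F' tx = 0" "F' ty = 0" by (simp_all add: F'_def F0x F0y Qx Qy fscale_def)
      fix i k assume c: "(i, k) \<in> set (coord_entries n)"
      then have ik: "i \<in> {1..n + 1}" "k \<in> {1..n + 1}" by (auto simp: in_coord_entries_iff)
      have k: "k = 1" if "i = n + 1" using c that n by (auto simp: in_coord_entries_iff)
      show "F' (s i k) = cst (if (i, k) = (2, 1) then wt1 else 0)"
        unfolding F'_def plus_fun_apply fscale_def F0s[OF ik] Qs[OF ik]
        using k n wt1 by (auto simp: fun_eq_iff on_T_def)
    qed (use opt in simp)
    define K where "K = C Q"
    note C = C_VF[OF n Q QA Qx Qy Q_entries] C_AMSY[OF n Q QA Qx Qy Q_entries]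
    have KV: "K \<in> VF" and KA: "K \<in> AMSY n Om" unfolding K_def by (rule C)+
    have HK: "lie_bracket H K = 0" unfolding K_def by (rule bracket_H_C[OF n Q QA Qx Qy Q_entries])
    have "F (tcoord n Om j) = cst (if j = 2 then 1 else 0)" if "j \<in> chart_idx n" for j
      using P that opt wt1 unfolding F is_partial_derivative_def chart_def
      by (auto simp: fun_eq_iff)
    then have FK: "lie_bracket F K = 0"
      unfolding K_def by (intro bracket_F_C[OF n Q QA Qx Qy Q_entries]) (auto simp: FF' F'V)
    have RF: "lie_bracket R F = H + K"
      unfolding FF' F'_def bracket_fscale_right[OF R_VF F0 Q sn] RF0 K_def C_def[OF n Q QA Qx Qy Q_entries]
      by (simp add: add.assoc)
    have D': "D = R + fscale (s 2 1) K"
      unfolding D opt D_field_def construction.case tcoord_2[OF n_pos] RF by simp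
    have "lie_bracket H D = lie_bracket H R + fscale (H (s 2 1)) K + fscale (s 2 1) (lie_bracket H K)"
      unfolding D' by (rule bracket_fscale_right[OF H_VF R_VF KV s_21_regular])
    also have "\<dots> = cscale 2 D"
    proof -
      have "entry_weight 2 1 = 2" using row_weight_2 by (simp add: entry_weight_def)
      then have "H (s 2 1) = (\<lambda>_. 2) * s 2 1" using weightD(2)[OF H_s, of 2 1] n by simp
      then show ?thesis unfolding bracket_H_R HK D' by (simp add: fun_eq_iff algebra_simps)
    qed
    finally have HD: "lie_bracket H D = cscale 2 D" .
    have F21: "F (s 2 1) = cst 1"
      using F0s[of 2 1] Qs[of 2 1] n wt1 unfolding FF' F'_def
      by (auto simp: fun_eq_iff on_T_def)
    have "lie_bracket F D = lie_bracket F R + fscale (F (s 2 1)) K + fscale (s 2 1) (lie_bracket F K)"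
      unfolding D' by (rule bracket_fscale_right[OF _ R_VF KV s_21_regular]) (simp add: FF' F'V)
    also have "fscale (F (s 2 1)) K = K"
      unfolding F21 cscale_eq_fscale[OF KV, symmetric] by (simp add: fun_eq_iff)
    also have "lie_bracket F R = - (H + K)" by (subst bracket_swap) (simp only: RF)
    finally have "lie_bracket F D = - H" unfolding FK by (simp add: fun_eq_iff)
    then have DF: "lie_bracket D F = H" by (subst bracket_swap) simp
    have "D \<in> AMSY n Om" unfolding D' by (intro AMSY_add AMSY_fscale RA KA s_21_regular)
    moreover have "F \<in> AMSY n Om" unfolding FF' F'_def by (intro AMSY_add AMSY_fscale F0A QA sn)
    ultimately show ?thesis using HD DF by blast
  qed
  then show "D \<in> AMSY n Om" "F \<in> AMSY n Om" "lie_bracket D F = H" "lie_bracket H D = cscale 2 D"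
    by blast+
qed

end

theorem corollary4p1:
  fixes n :: nat and c :: complex and Om :: "complex \<Rightarrow> complex \<Rightarrow> complex mat"
    and opt :: construction and R H P F D :: vfield
  assumes "n \<ge> 1"
    and "c \<noteq> 0"
    and "is_intersection_matrix n c Om"
    and "is_modular_vector_field n Om R"
    and "is_radial_vector_field n Om H"
    and "is_partial_derivative n Om (chart opt n Om) 2 P"
    and "F = cscale (if n = 2 then 2 else 1) P"
    and "D = D_field opt n Om R H F"
  shows "lie_generated n Om {D, H, F} \<subseteq> AMSY n Om \<and>
         isomorphic_to_sl2 (lie_generated n Om {D, H, F})"
proof -
  interpret modular_field n c Om H R
    by standard (use assms in auto)
  have F: "F = cscale wt1 P" using assms(7) by (simp add: wt1_def)
  note triple = sl2_triple[OF assms(6) F assms(8)]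
  have HF: "lie_bracket H F = cscale (- 2) F"
    unfolding F by (rule bracket_H_F[OF assms(6)])
  have VF: "D \<in> VF" "F \<in> VF" using triple(1,2) AMSY_subset_VF by blast+
  have "F \<noteq> 0"
  proof
    assume z: "F = 0"
    obtain p where p: "p \<in> T n Om" using T_nonempty by blast
    have "P (chart opt n Om 2) = cst 1"
      using assms(6) two_in_chart_idx[OF n_pos] by (auto simp: is_partial_derivative_def)
    then have "F (chart opt n Om 2) p = wt1" unfolding F using p by simp
    then show False using z by (simp add: wt1_def split: if_splits)
  qed
  note hyp = VF(1) H_VF VF(2) triple(3,4) HF this
  show ?thesis
    using lie_generated_triple_AMSY[OF hyp triple(1) H_AMSY triple(2)] triple_isomorphic_to_sl2[OF hyp]
    by blast
qed

end
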